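(* Let $X,Y\subset\mathbb{R}^d$ be bounded convex open sets, $\mu\in P(X)$, $\nu\in P(Y)$. Then (i) $\displaystyle\mathcal{T}_2(\mu,\mathrm{P}^{sh}_{\le\nu})=\sup_{\psi\in\mathcal{A}_{sh}\cap C_b(Y)}\Big\{\int_X Q_2(\psi)\,d\mu-\int_Y\psi\,d\nu\Big\}$, with $Q_2(\psi)(x)=\inf_{y\in Y}\{\psi(y)+|x-y|^2\}$; (ii) $\displaystyle\mathcal{T}_2(\mathrm{P}^{sh}_{\mu\le},\nu)=\sup_{\psi\in\mathcal{A}_{sh}\cap C_b(X)}\Big\{\int_X \psi\,d\mu-\int_Y Q_{\bar2}(\psi)\,d\nu\Big\}$, with $Q_{\bar2}(\psi)(y)=\sup_{x\in X}\{\psi(x)-|x-y|^2\}$. In both, $\psi\in\mathcal{A}_{sh}\cap C_b$ may be replaced by $\psi\in\mathcal{A}_{sh}\cap\mathrm{S}_b$ (bounded measurable) without changing the value.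
   Context: A function $\psi$ on an open set $U\subset\mathbb{R}^d$ is subharmonic if it is upper semicontinuous with values in $[-\infty,\infty)$ and $\psi(x_0)\le\frac{1}{|\partial B_r(x_0)|}\int_{\partial B_r(x_0)}\psi\,d\sigma$ for every ball $B_r(x_0)$ contained in $U$. For $U$ bounded convex open and $\eta,\xi\in P(U)$, $\eta\le_{sh}\xi$ means $\int\psi\,d\eta\le\int\psi\,d\xi$ for all subharmonic $\psi\in C_b(U)$. $\mathcal{A}_{sh}$: subharmonic functions bounded from below (on the relevant domain). $\mathrm{P}^{sh}_{\le\nu}=\{\eta\in P(Y):\eta\le_{sh}\nu\}$ (subharmonic on $Y$), $\mathrm{P}^{sh}_{\mu\le}=\{\xi\in P(X):\mu\le_{sh}\xi\}$ (subharmonic on $X$). $\mathcal{T}_2(\alpha,\beta)=\inf_{\pi\in\Pi(\alpha,\beta)}\int|x-y|^2d\pi$, infimized over a cone where a cone appears. *)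

theory Defs
  imports "HOL-Analysis.Analysis" "HOL-Probability.Probability"
begin

definition usc_on :: "'a::topological_space set \<Rightarrow> ('a \<Rightarrow> real) \<Rightarrow> bool" where
  "usc_on U f \<longleftrightarrow> (\<forall>x\<in>U. \<forall>e>0. eventually (\<lambda>y. f y < f x + e) (at x within U))"

text \<open>Mean of f over the sphere of radius r centred at x0 w.r.t. the normalised surface
  measure; the normalised surface measure on the unit sphere is the push-forward of the
  normalised Lebesgue measure on the unit ball under the radial projection u / norm u.\<close>
definition sphere_mean :: "('a::euclidean_space \<Rightarrow> real) \<Rightarrow> 'a \<Rightarrow> real \<Rightarrow> real" where
  "sphere_mean f x0 r =
     (\<integral>u. indicator (ball 0 1) u * f (x0 + r *\<^sub>R (u /\<^sub>R norm u)) \<partial>lborel)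
       / measure lborel (ball (0::'a) 1)"

definition subharmonic_on :: "'a::euclidean_space set \<Rightarrow> ('a \<Rightarrow> real) \<Rightarrow> bool" where
  "subharmonic_on U f \<longleftrightarrow> usc_on U f \<and>
     (\<forall>x0 r. r > 0 \<longrightarrow> cball x0 r \<subseteq> U \<longrightarrow> f x0 \<le> sphere_mean f x0 r)"

definition Cb :: "'a::euclidean_space set \<Rightarrow> ('a \<Rightarrow> real) set" where
  "Cb U = {f. continuous_on U f \<and> bounded (f ` U)}"

definition Sb :: "'a::euclidean_space set \<Rightarrow> ('a \<Rightarrow> real) set" where
  "Sb U = {f. set_borel_measurable borel U f \<and> bounded (f ` U)}"

definition Ash :: "'a::euclidean_space set \<Rightarrow> ('a \<Rightarrow> real) set" where
  "Ash U = {f. subharmonic_on U f \<and> bdd_below (f ` U)}"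

definition Prob :: "'a::euclidean_space set \<Rightarrow> 'a measure set" where
  "Prob U = {m. sets m = sets borel \<and> prob_space m \<and> emeasure m U = 1}"

definition sh_le :: "'a::euclidean_space set \<Rightarrow> 'a measure \<Rightarrow> 'a measure \<Rightarrow> bool" where
  "sh_le U \<eta> \<xi> \<longleftrightarrow>
     (\<forall>\<psi>. subharmonic_on U \<psi> \<and> \<psi> \<in> Cb U \<longrightarrow>
        (\<integral>x\<in>U. \<psi> x \<partial>\<eta>) \<le> (\<integral>x\<in>U. \<psi> x \<partial>\<xi>))"

definition Psh_le :: "'a::euclidean_space set \<Rightarrow> 'a measure \<Rightarrow> 'a measure set" where
  "Psh_le Y \<nu> = {\<eta> \<in> Prob Y. sh_le Y \<eta> \<nu>}"

definition Psh_ge :: "'a::euclidean_space set \<Rightarrow> 'a measure \<Rightarrow> 'a measure set" where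
  "Psh_ge X \<mu> = {\<xi> \<in> Prob X. sh_le X \<mu> \<xi>}"

definition couplings :: "'a::euclidean_space measure \<Rightarrow> 'a measure \<Rightarrow> ('a \<times> 'a) measure set" where
  "couplings \<alpha> \<beta> = {\<pi>. sets \<pi> = sets (borel \<Otimes>\<^sub>M borel) \<and> prob_space \<pi> \<and>
      distr \<pi> borel fst = \<alpha> \<and> distr \<pi> borel snd = \<beta>}"

definition T2 :: "'a::euclidean_space measure \<Rightarrow> 'a measure \<Rightarrow> real" where
  "T2 \<alpha> \<beta> = (INF \<pi>\<in>couplings \<alpha> \<beta>. \<integral>z. (norm (fst z - snd z))\<^sup>2 \<partial>\<pi>)"

definition Q2 :: "'a::euclidean_space set \<Rightarrow> ('a \<Rightarrow> real) \<Rightarrow> 'a \<Rightarrow> real" where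
  "Q2 Y \<psi> x = (INF y\<in>Y. \<psi> y + (norm (x - y))\<^sup>2)"

definition Q2bar :: "'a::euclidean_space set \<Rightarrow> ('a \<Rightarrow> real) \<Rightarrow> 'a \<Rightarrow> real" where
  "Q2bar X \<psi> y = (SUP x\<in>X. \<psi> x - (norm (x - y))\<^sup>2)"

end

theory Submission
  imports Defs
begin

text \<open>
  Weak duality for bounded measurable \<open>\<psi>\<close> rests on a regularisation: the suprema
  \<open>F\<^sub>n y = sup {\<psi> ((1 - d) y + d w) - n d | d \<in> [0,1), w \<in> Y}\<close> are suprema of dilates of \<open>\<psi>\<close>, hence
  again satisfy the sub-mean-value inequality, they are locally Lipschitz on the convex set \<open>Y\<close>, and
  upper semicontinuity of \<open>\<psi>\<close> makes them decrease to \<open>\<psi>\<close>.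

  Strong duality is a Hahn-Banach argument on the compact closures, with the cost, the marginals and
  the subharmonic constraints all dualised at once: if every function of a convex family of
  continuous functions is \<open>\<le> 0\<close> somewhere on a compact set, some probability measure integrates all
  of them to a value \<open>\<le> 0\<close>.  In (i) no mass of the resulting \<open>\<eta>\<close> reaches the boundary, because
  the convex functions \<open>max 0 (1 - k dist(y, -Y))\<close> are subharmonic.  In (ii) mass may reach the
  boundary, and a plain dilation of \<open>\<xi>\<close> would destroy \<open>\<mu> \<le>\<^sub>s\<^sub>h \<xi>\<close>.  Therefore the constraint is imposed
  fibrewise, on measures over triples \<open>(x, w, y)\<close> and for kernels \<open>\<Phi> (x, w)\<close> subharmonic in \<open>w\<close> and
  nonnegative on the diagonal; then \<open>w\<close> may be contracted towards its own starting point \<open>x\<close>.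
\<close>

section \<open>Positive functionals from convex families\<close>

text \<open>Dualising everything at once replaces both a separate Kantorovich duality and a minimax
  theorem: a bound \<open>D\<close> on the dual functional makes every function of one convex family
  nonpositive somewhere, and the resulting measure encodes cost, marginals and order together.
  Scaling the potentials separates these constraints again. The two halves differ because the order
  acts in opposite directions. In (i) \<eta> lies below \<nu>, so a convex barrier has small
  \<eta>-integral. In (ii) \<xi> lies above \<mu>, and such tests bound its boundary mass only from
  below. Contraction to a fixed centre \<open>a\<close> fails there since \<psi> at
  \<open>(1 - t) x + t a\<close> may be smaller than at \<open>x\<close>. Contracting
  \<open>w\<close> to its own \<open>x\<close> leads to the kernel
  \<open>\<psi> ((1 - t) w + t x) - \<psi> x\<close>, which vanishes for \<open>w = x\<close> and is
  thus among the tested ones. The supremum over \<open>x\<close> of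
  \<open>\<Phi> (x, w) + a x\<close> returns to one subharmonic function, so the richer family costs
  nothing in the dual problem. The contraction costs a multiple of \<open>t\<close>, hence (ii) is
  reached up to \<epsilon>, while (i) yields a measure of cost at most \<open>D\<close>.\<close>

lemma maximal_cone:
  fixes \<G> :: "('b \<Rightarrow> real) set"
  assumes ne: "\<G> \<noteq> {}"
    and cvx: "\<And>F G u. F \<in> \<G> \<Longrightarrow> G \<in> \<G> \<Longrightarrow> 0 \<le> u \<Longrightarrow> u \<le> 1 \<Longrightarrow>
                (\<lambda>x. u * F x + (1 - u) * G x) \<in> \<G>"
    and np: "\<And>G e. G \<in> \<G> \<Longrightarrow> e > 0 \<Longrightarrow> \<exists>x\<in>K. G x < e"
  shows "\<exists>M. \<G> \<subseteq> M \<and> (\<forall>f. (\<forall>x\<in>K. f x \<le> 0) \<longrightarrow> f \<in> M) \<and>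
    (\<forall>f\<in>M. \<forall>g\<in>M. (\<lambda>x. f x + g x) \<in> M) \<and>
    (\<forall>f\<in>M. \<forall>t\<ge>0. (\<lambda>x. t * f x) \<in> M) \<and> (\<forall>f\<in>M. \<forall>e>0. \<exists>x\<in>K. f x < e) \<and>
    (\<forall>f. f \<in> M \<or> (\<lambda>x. - f x) \<in> M)"
proof -
  \<comment> \<open>\<open>M0\<close> is the convex cone of all functions lying on \<open>K\<close>
    below a nonnegative multiple of a member of \<open>\<G>\<close>. The multiple 0 brings in every
    function that is nonpositive on \<open>K\<close>.\<close>
  define M0 where "M0 = {f. \<exists>G\<in>\<G>. \<exists>t\<ge>0. \<forall>x\<in>K. f x \<le> t * G x}"
  \<comment> \<open>Admissible means: a convex cone in which no function is bounded below on
    \<open>K\<close> by a positive constant. This passes to unions of chains because each clause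
    concerns at most two functions at a time.\<close>
  define adm where "adm M \<longleftrightarrow> (\<forall>f\<in>M. \<forall>g\<in>M. (\<lambda>x. f x + g x) \<in> M) \<and>
    (\<forall>f\<in>M. \<forall>t\<ge>0. (\<lambda>x. t * f x) \<in> M) \<and> (\<forall>f\<in>M. \<forall>e>0. \<exists>x\<in>K. f x < e)"
    for M :: "('b \<Rightarrow> real) set"
  have "(\<lambda>x. f x + g x) \<in> M0" if f: "f \<in> M0" and g: "g \<in> M0" for f g
  proof -
    obtain F s where F: "F \<in> \<G>" "s \<ge> 0" "\<forall>x\<in>K. f x \<le> s * F x" using f unfolding M0_def by blast
    obtain G t where G: "G \<in> \<G>" "t \<ge> 0" "\<forall>x\<in>K. g x \<le> t * G x" using g unfolding M0_def by blast
    show ?thesis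
    proof (cases "s + t = 0")
      case True
      hence "s = 0" "t = 0" using F G by auto
      hence "\<forall>x\<in>K. f x + g x \<le> 0 * F x" using F(3) G(3) by fastforce
      thus ?thesis unfolding M0_def using F(1) by blast
    next
      case False
      hence pos: "s + t > 0" using F G by auto
      define u where "u = s / (s + t)"
      have u: "0 \<le> u" "u \<le> 1" "s = (s + t) * u" "t = (s + t) * (1 - u)"
        using pos F(2) G(2) by (auto simp: u_def field_simps)
      have "s * F x + t * G x = (s + t) * (u * F x + (1 - u) * G x)" for x
        using u(3,4) by (metis distrib_left mult.assoc)
      hence "\<forall>x\<in>K. f x + g x \<le> (s + t) * (u * F x + (1 - u) * G x)"
        using F(3) G(3) by (metis add_mono)
      thus ?thesis unfolding M0_def using cvx[OF F(1) G(1) u(1,2)] pos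
        by (auto intro!: bexI[of _ "\<lambda>x. u * F x + (1 - u) * G x"] exI[of _ "s + t"])
    qed
  qed
  moreover have "(\<lambda>x. c * f x) \<in> M0" if f: "f \<in> M0" and c: "c \<ge> 0" for f c
  proof -
    obtain F s where F: "F \<in> \<G>" "s \<ge> 0" "\<forall>x\<in>K. f x \<le> s * F x" using f unfolding M0_def by blast
    have "\<forall>x\<in>K. c * f x \<le> (c * s) * F x"
      using F(3) c by (metis mult.assoc mult_left_mono)
    thus ?thesis unfolding M0_def using F c
      by (auto intro!: bexI[of _ F] exI[of _ "c * s"])
  qed
  moreover have "\<exists>x\<in>K. f x < e" if f: "f \<in> M0" and e: "e > 0" for f e
  proof -
    obtain F s where F: "F \<in> \<G>" "s \<ge> 0" "\<forall>x\<in>K. f x \<le> s * F x" using f unfolding M0_def by blast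
    have "e / (s + 1) > 0" using e F by simp
    from np[OF F(1) this] obtain x where x: "x \<in> K" "F x < e / (s + 1)" by blast
    have "s * F x \<le> s * (e / (s + 1))" using x F(2) by (intro mult_left_mono) auto
    also have "\<dots> < e" using F(2) e by (simp add: field_simps)
    finally show ?thesis using x(1) F(3) by force
  qed
  ultimately have adm0: "adm M0" unfolding adm_def by blast
  have "\<exists>M\<in>{M. M0 \<subseteq> M \<and> adm M}. \<forall>N\<in>{M. M0 \<subseteq> M \<and> adm M}. M \<subseteq> N \<longrightarrow> N = M"
  proof (rule subset_Zorn_nonempty)
    show "{M. M0 \<subseteq> M \<and> adm M} \<noteq> {}" using adm0 by blast
    fix \<C> assume C: "\<C> \<noteq> {}" "subset.chain {M. M0 \<subseteq> M \<and> adm M} \<C>"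
    have sub: "\<And>M. M \<in> \<C> \<Longrightarrow> M0 \<subseteq> M \<and> adm M" using C(2) unfolding subset.chain_def by blast
    have tot: "\<And>M N. M \<in> \<C> \<Longrightarrow> N \<in> \<C> \<Longrightarrow> M \<subseteq> N \<or> N \<subseteq> M"
      using C(2) unfolding subset.chain_def by blast
    have "(\<lambda>x. f x + g x) \<in> \<Union>\<C>" if "f \<in> \<Union>\<C>" "g \<in> \<Union>\<C>" for f g
    proof -
      from that obtain M N where "M \<in> \<C>" "N \<in> \<C>" "f \<in> M" "g \<in> N" by blast
      then obtain P where "P \<in> \<C>" "f \<in> P" "g \<in> P" using tot by blast
      thus ?thesis using sub[of P] unfolding adm_def by blast
    qed
    moreover have "(\<lambda>x. t * f x) \<in> \<Union>\<C>" if "f \<in> \<Union>\<C>" "t \<ge> 0" for f t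
      using that sub unfolding adm_def by blast
    moreover have "\<exists>x\<in>K. f x < e" if "f \<in> \<Union>\<C>" "e > 0" for f e
      using that sub unfolding adm_def by blast
    ultimately have "adm (\<Union>\<C>)" unfolding adm_def by blast
    thus "\<Union>\<C> \<in> {M. M0 \<subseteq> M \<and> adm M}" using C(1) sub by blast
  qed
  then obtain M where M': "M \<in> {M. M0 \<subseteq> M \<and> adm M}"
    and mx': "\<forall>N\<in>{M. M0 \<subseteq> M \<and> adm M}. M \<subseteq> N \<longrightarrow> N = M" ..
  have M: "M0 \<subseteq> M" "adm M" using M' by auto
  have mx: "\<And>N. M0 \<subseteq> N \<Longrightarrow> adm N \<Longrightarrow> M \<subseteq> N \<Longrightarrow> N = M" using mx' by simp
  have add: "\<And>f g. f \<in> M \<Longrightarrow> g \<in> M \<Longrightarrow> (\<lambda>x. f x + g x) \<in> M"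
    and scale: "\<And>f t. f \<in> M \<Longrightarrow> 0 \<le> t \<Longrightarrow> (\<lambda>x. t * f x) \<in> M"
    and npM: "\<And>f e. f \<in> M \<Longrightarrow> e > 0 \<Longrightarrow> \<exists>x\<in>K. f x < e"
    using M(2) unfolding adm_def by blast+
  have neg: "f \<in> M" if "\<And>x. x \<in> K \<Longrightarrow> f x \<le> 0" for f
  proof -
    obtain G where "G \<in> \<G>" using ne by blast
    hence "f \<in> M0" unfolding M0_def using that by (auto intro!: bexI[of _ G] exI[of _ 0])
    thus ?thesis using M by blast
  qed
  \<comment> \<open>By maximality, adjoining the ray through a function outside \<open>M\<close>
    breaks admissibility. Sums and nonnegative multiples survive, so some \<open>m + s * f\<close>
    exceeds a positive constant on \<open>K\<close>, and \<open>s = 0\<close> is impossible for a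
    member of \<open>M\<close>.\<close>
  have dich: "\<exists>m\<in>M. \<exists>s>0. \<exists>e>0. \<forall>x\<in>K. m x + s * f x \<ge> e" if f: "f \<notin> M" for f
  proof -
    define N where "N = {h. \<exists>m\<in>M. \<exists>s\<ge>0. h = (\<lambda>x. m x + s * f x)}"
    have NI: "\<And>m s. m \<in> M \<Longrightarrow> s \<ge> 0 \<Longrightarrow> (\<lambda>x. m x + s * f x) \<in> N" unfolding N_def by auto
    have NE: "\<And>h. h \<in> N \<Longrightarrow> \<exists>m\<in>M. \<exists>s\<ge>0. h = (\<lambda>x. m x + s * f x)" unfolding N_def by (simp only: mem_Collect_eq)
    have "M \<subseteq> N" using NI[of _ 0] by auto
    moreover have "f \<in> N" using NI[of "\<lambda>x. 0" 1] neg[of "\<lambda>x. 0"] by simp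
    ultimately have "\<not> adm N" using mx[of N] M(1) f by auto
    moreover have "(\<lambda>x. g x + h x) \<in> N" if g: "g \<in> N" and h: "h \<in> N" for g h
    proof -
      obtain m s where 1: "m \<in> M" "s \<ge> 0" "g = (\<lambda>x. m x + s * f x)" using NE[OF g] by blast
      obtain n t where 2: "n \<in> M" "t \<ge> 0" "h = (\<lambda>x. n x + t * f x)" using NE[OF h] by blast
      show ?thesis using NI[OF add[OF 1(1) 2(1)] add_nonneg_nonneg[OF 1(2) 2(2)]]
        unfolding 1(3) 2(3) by (simp add: algebra_simps)
    qed
    moreover have "(\<lambda>x. c * g x) \<in> N" if g: "g \<in> N" and c: "c \<ge> 0" for g c
    proof -
      obtain m s where 1: "m \<in> M" "s \<ge> 0" "g = (\<lambda>x. m x + s * f x)" using NE[OF g] by blast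
      show ?thesis using NI[OF scale[OF 1(1) c] mult_nonneg_nonneg[OF c 1(2)]]
        unfolding 1(3) by (simp add: algebra_simps)
    qed
    ultimately obtain h e where he: "h \<in> N" "e > 0" "\<And>x. x \<in> K \<Longrightarrow> h x \<ge> e"
      unfolding adm_def by (meson not_less)
    obtain m s where ms: "m \<in> M" "s \<ge> 0" "h = (\<lambda>x. m x + s * f x)" using NE[OF he(1)] by blast
    have "s \<noteq> 0"
    proof
      assume "s = 0"
      hence "\<And>x. x \<in> K \<Longrightarrow> m x \<ge> e" using he(3) ms(3) by simp
      thus False using npM[OF ms(1) he(2)] by force
    qed
    hence "s > 0" using ms(2) by simp
    thus ?thesis using ms(1) he(2,3) unfolding ms(3) by (intro bexI[of _ m] exI[of _ s] exI[of _ e]) auto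
  qed
  have "f \<in> M \<or> (\<lambda>x. - f x) \<in> M" for f
  proof (rule ccontr)
    assume "\<not> ?thesis"
    hence "f \<notin> M" "(\<lambda>x. - f x) \<notin> M" by auto
    from dich[OF this(1)] dich[OF this(2)] obtain m s e n t d
      where A: "m \<in> M" "s > 0" "e > 0" "\<forall>x\<in>K. m x + s * f x \<ge> e"
        and B: "n \<in> M" "t > 0" "d > 0" "\<forall>x\<in>K. n x + t * - f x \<ge> d" by blast
    \<comment> \<open>The weights \<open>t\<close> and \<open>s\<close> cancel \<open>f\<close>: the
      two lower bounds combine to a positive lower bound for a member of \<open>M\<close>.\<close>
    have "(\<lambda>x. t * m x + s * n x) \<in> M"
      using A(1,2) B(1,2) by (intro add scale) auto
    moreover have "t * e + s * d > 0" using A B by (simp add: add_pos_pos)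
    ultimately obtain x where x: "x \<in> K" "t * m x + s * n x < t * e + s * d" using npM by blast
    have "t * (m x + s * f x) \<ge> t * e" "s * (n x + t * - f x) \<ge> s * d"
      using A B x(1) by (auto intro!: mult_left_mono)
    thus False using x(2) by (simp add: algebra_simps)
  qed
  moreover have "\<G> \<subseteq> M"
  proof
    fix G assume "G \<in> \<G>"
    hence "G \<in> M0" unfolding M0_def by (auto intro!: bexI[of _ G] exI[of _ 1])
    thus "G \<in> M" using M by blast
  qed
  ultimately show ?thesis using add scale npM neg by (intro exI[of _ M]) simp
qed

text \<open>\<open>M\<close> behaves like a half-space of functions, and \<open>L f\<close> is the
  threshold at which the translate \<open>f - t\<close> enters it. The cone property makes
  \<open>L\<close> sublinear; the dichotomy that \<open>f\<close> or \<open>- f\<close> lies in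
  \<open>M\<close> closes the gap between \<open>L (- f)\<close> and \<open>- L f\<close>, which
  gives linearity. Monotonicity holds because functions nonpositive on \<open>K\<close> belong to
  \<open>M\<close>.\<close>

lemma positive_functional:
  fixes \<G> :: "('b \<Rightarrow> real) set"
  assumes ne: "\<G> \<noteq> {}" 
    and cvx: "\<And>F G u. F \<in> \<G> \<Longrightarrow> G \<in> \<G> \<Longrightarrow> 0 \<le> u \<Longrightarrow> u \<le> 1 \<Longrightarrow>
                (\<lambda>x. u * F x + (1 - u) * G x) \<in> \<G>"
    and np: "\<And>G e. G \<in> \<G> \<Longrightarrow> e > 0 \<Longrightarrow> \<exists>x\<in>K. G x < e"
    and bd: "\<And>G. G \<in> \<G> \<Longrightarrow> bounded (G ` K)"
  obtains L :: "('b \<Rightarrow> real) \<Rightarrow> real" where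
    "\<And>f g. bounded (f ` K) \<Longrightarrow> bounded (g ` K) \<Longrightarrow> L (\<lambda>x. f x + g x) = L f + L g"
    "\<And>f c. bounded (f ` K) \<Longrightarrow> L (\<lambda>x. c * f x) = c * L f"
    "\<And>f g. bounded (f ` K) \<Longrightarrow> bounded (g ` K) \<Longrightarrow> (\<And>x. x \<in> K \<Longrightarrow> f x \<le> g x) \<Longrightarrow> L f \<le> L g"
    "L (\<lambda>x. 1) = 1" "\<And>G. G \<in> \<G> \<Longrightarrow> L G \<le> 0"
proof -
  have "\<exists>M. \<G> \<subseteq> M \<and> (\<forall>f. (\<forall>x\<in>K. f x \<le> 0) \<longrightarrow> f \<in> M) \<and>
    (\<forall>f\<in>M. \<forall>g\<in>M. (\<lambda>x. f x + g x) \<in> M) \<and>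
    (\<forall>f\<in>M. \<forall>t\<ge>0. (\<lambda>x. t * f x) \<in> M) \<and> (\<forall>f\<in>M. \<forall>e>0. \<exists>x\<in>K. f x < e) \<and>
    (\<forall>f. f \<in> M \<or> (\<lambda>x. - f x) \<in> M)" (is "\<exists>M. ?P M")
    using ne cvx np by (rule maximal_cone)
  then obtain M where MM: "?P M" ..
  have M: "\<G> \<subseteq> M" "\<And>f. (\<And>x. x \<in> K \<Longrightarrow> f x \<le> 0) \<Longrightarrow> f \<in> M"
    "\<And>f g. f \<in> M \<Longrightarrow> g \<in> M \<Longrightarrow> (\<lambda>x. f x + g x) \<in> M"
    "\<And>f t. f \<in> M \<Longrightarrow> 0 \<le> t \<Longrightarrow> (\<lambda>x. t * f x) \<in> M"
    "\<And>f e. f \<in> M \<Longrightarrow> e > 0 \<Longrightarrow> \<exists>x\<in>K. f x < e"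
    "\<And>f. f \<in> M \<or> (\<lambda>x. - f x) \<in> M"
    using MM by simp_all
  define T where "T f = {t. (\<lambda>x. f x - t) \<in> M}" for f
  define L where "L f = Inf (T f)" for f
  have ub: "t \<in> T f" if "\<And>x. x \<in> K \<Longrightarrow> f x \<le> t" for f t
    unfolding T_def mem_Collect_eq by (rule M(2)) (use that in force)
  have lb: "c \<le> t" if "\<And>x. x \<in> K \<Longrightarrow> c \<le> f x" "t \<in> T f" for f t c
  proof (rule ccontr)
    assume "\<not> ?thesis"
    hence "c - t > 0" by simp
    moreover have "(\<lambda>x. f x - t) \<in> M" using that(2) unfolding T_def by simp
    ultimately obtain x where "x \<in> K" "f x - t < c - t" using M(5) by blast
    thus False using that(1)[of x] by simp
  qed
  have Tne: "T f \<noteq> {}" and Tbd: "bdd_below (T f)" if "bounded (f ` K)" for f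
  proof -
    obtain B where B: "\<And>x. x \<in> K \<Longrightarrow> \<bar>f x\<bar> \<le> B" using \<open>bounded (f ` K)\<close>
      unfolding bounded_iff by auto
    have "\<And>x. x \<in> K \<Longrightarrow> f x \<le> B" "\<And>x. x \<in> K \<Longrightarrow> -B \<le> f x" using B by fastforce+
    thus "T f \<noteq> {}" "bdd_below (T f)" using ub[of f B] lb[of "-B" f] by (auto intro!: bdd_belowI)
  qed
  have le: "L f \<le> t" if "bounded (f ` K)" "t \<in> T f" for f t
    unfolding L_def using Tbd[OF that(1)] that(2) by (intro cInf_lower)
  have lbd: "bounded ((\<lambda>x. f x + g x) ` K)" if "bounded (f ` K)" "bounded (g ` K)" for f g :: "'b \<Rightarrow> real"
    using that by (rule bounded_plus_comp)
  have sc: "bounded ((\<lambda>x. c * f x) ` K)" if "bounded (f ` K)" for f :: "'b \<Rightarrow> real" and c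
    using bounded_scaleR_comp[OF that, of c] by simp
  have sub: "L (\<lambda>x. f x + g x) \<le> L f + L g" if b: "bounded (f ` K)" "bounded (g ` K)" for f g
  proof -
    have "L (\<lambda>x. f x + g x) - s \<le> t" if "s \<in> T f" "t \<in> T g" for s t
    proof -
      have "(\<lambda>x. (f x - s) + (g x - t)) \<in> M" using that unfolding T_def by (intro M(3)) auto
      hence "s + t \<in> T (\<lambda>x. f x + g x)" unfolding T_def by (simp add: algebra_simps)
      from le[OF lbd[OF b] this] show ?thesis by simp
    qed
    hence "L (\<lambda>x. f x + g x) - s \<le> L g" if "s \<in> T f" for s
      unfolding L_def[of g] using Tne[OF b(2)] that by (intro cInf_greatest)
    hence "L (\<lambda>x. f x + g x) - L g \<le> s" if "s \<in> T f" for s using that by force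
    hence "L (\<lambda>x. f x + g x) - L g \<le> L f"
      unfolding L_def[of f] using Tne[OF b(1)] by (intro cInf_greatest)
    thus ?thesis by simp
  qed
  have cb: "bounded ((\<lambda>x. c) ` K)" for c :: real by (rule bounded_subset[of "{c}"]) auto
  have const: "L (\<lambda>x. c) = c" for c
  proof (rule antisym)
    show "L (\<lambda>x. c) \<le> c" by (rule le[OF cb]) (auto intro: ub)
    show "c \<le> L (\<lambda>x. c)" unfolding L_def
      by (rule cInf_greatest[OF Tne[OF cb]]) (auto intro: lb)
  qed
  have Lneg: "L (\<lambda>x. - f x) = - L f" if b: "bounded (f ` K)" for f
  proof (rule antisym)
    have b': "bounded ((\<lambda>x. - f x) ` K)" using sc[OF b, of "-1"] by simp
    have "L (\<lambda>x. f x + - f x) \<le> L f + L (\<lambda>x. - f x)" by (rule sub[OF b b'])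
    thus "- L f \<le> L (\<lambda>x. - f x)" using const[of 0] by simp
    show "L (\<lambda>x. - f x) \<le> - L f"
    proof (rule field_le_epsilon)
      fix e :: real assume "e > 0"
      hence "L f - e \<notin> T f" using le[OF b, of "L f - e"] by force
      hence "(\<lambda>x. - (f x - (L f - e))) \<in> M" using M(6)[of "\<lambda>x. f x - (L f - e)"] unfolding T_def by blast
      hence "- (L f - e) \<in> T (\<lambda>x. - f x)" unfolding T_def by (simp add: algebra_simps)
      from le[OF b' this] show "L (\<lambda>x. - f x) \<le> - L f + e" by simp
    qed
  qed
  have L1: "L (\<lambda>x. f x + g x) = L f + L g" if b: "bounded (f ` K)" "bounded (g ` K)" for f g
  proof (rule antisym[OF sub[OF b]])
    have b': "bounded ((\<lambda>x. - g x) ` K)" using sc[OF b(2), of "-1"] by simp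
    have "L (\<lambda>x. (f x + g x) + - g x) \<le> L (\<lambda>x. f x + g x) + L (\<lambda>x. - g x)"
      by (rule sub[OF lbd[OF b] b'])
    thus "L f + L g \<le> L (\<lambda>x. f x + g x)" using Lneg[OF b(2)] by simp
  qed
  have pos: "L (\<lambda>x. c * f x) \<le> c * L f" if b: "bounded (f ` K)" and c: "c > 0" for f c
  proof -
    have "L (\<lambda>x. c * f x) / c \<le> t" if "t \<in> T f" for t
    proof -
      have "(\<lambda>x. c * (f x - t)) \<in> M" using that c unfolding T_def by (intro M(4)) auto
      hence "c * t \<in> T (\<lambda>x. c * f x)" unfolding T_def by (simp add: algebra_simps)
      from le[OF sc[OF b] this] show ?thesis using c by (simp add: field_simps)
    qed
    hence "L (\<lambda>x. c * f x) / c \<le> L f" unfolding L_def[of f] using Tne[OF b] by (intro cInf_greatest)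
    thus ?thesis using c by (simp add: field_simps)
  qed
  have pos': "L (\<lambda>x. c * f x) = c * L f" if b: "bounded (f ` K)" and c: "c > 0" for f c
  proof (rule antisym[OF pos[OF b c]])
    have "L (\<lambda>x. (1 / c) * (c * f x)) \<le> (1 / c) * L (\<lambda>x. c * f x)"
      using c by (intro pos sc[OF b]) auto
    thus "c * L f \<le> L (\<lambda>x. c * f x)" using c by (simp add: field_simps)
  qed
  have L2: "L (\<lambda>x. c * f x) = c * L f" if b: "bounded (f ` K)" for f c
  proof (cases c "0 :: real" rule: linorder_cases)
    case less
    have "L (\<lambda>x. - (c * f x)) = - c * L f" using pos'[OF b, of "-c"] less by simp
    thus ?thesis using Lneg[OF sc[OF b, of c]] by simp
  qed (use const[of 0] pos'[OF b] in auto)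
  show ?thesis
  proof (rule that[of L, OF L1 L2 _ const])
    fix f g :: "'b \<Rightarrow> real"
    assume b: "bounded (f ` K)" "bounded (g ` K)" and fg: "\<And>x. x \<in> K \<Longrightarrow> f x \<le> g x"
    have "L f \<le> t" if "t \<in> T g" for t
    proof -
      have "(\<lambda>x. g x - t) \<in> M" using that unfolding T_def by simp
      moreover have "(\<lambda>x. f x - g x) \<in> M" by (rule M(2)) (use fg in simp)
      ultimately have "(\<lambda>x. (g x - t) + (f x - g x)) \<in> M" by (rule M(3))
      hence "t \<in> T f" unfolding T_def by simp
      thus ?thesis by (rule le[OF b(1)])
    qed
    thus "L f \<le> L g" unfolding L_def[of g] using Tne[OF b(2)] by (intro cInf_greatest)
  next
    fix G assume "G \<in> \<G>"
    thus "L G \<le> 0" using M(1) bd by (intro le) (auto simp: T_def)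
  qed
qed

section \<open>Measures from positive functionals\<close>

text \<open>Restricted to indicators, \<open>L\<close> is a finitely additive set function \<open>m\<close> on all subsets.  On the ring \<open>\<A>\<close> of
  sets that \<open>m\<close> approximates by compact sets from inside and open sets from outside, compactness
  makes \<open>m\<close> continuous at the empty set.  The ring is large enough because all but countably many
  level sets of a continuous function belong to it.\<close>

lemma measure_of_positive_functional:
  fixes K :: "'b::heine_borel set" and L :: "('b \<Rightarrow> real) \<Rightarrow> real"
  assumes K: "compact K"
    and add: "\<And>f g. bounded (f ` K) \<Longrightarrow> bounded (g ` K) \<Longrightarrow> L (\<lambda>x. f x + g x) = L f + L g"
    and scale: "\<And>f c. bounded (f ` K) \<Longrightarrow> L (\<lambda>x. c * f x) = c * L f"
    and mono: "\<And>f g. bounded (f ` K) \<Longrightarrow> bounded (g ` K) \<Longrightarrow> (\<And>x. x \<in> K \<Longrightarrow> f x \<le> g x) \<Longrightarrow> L f \<le> L g"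
    and one: "L (\<lambda>x. 1) = 1"
  obtains M where "sets M = sets borel" "prob_space M" "emeasure M K = 1"
    "\<And>f. continuous_on K f \<Longrightarrow> (\<integral>x\<in>K. f x \<partial>M) = L f"
proof -
  define m where "m A = L (indicator A)" for A
  have bI: "bounded ((indicator A :: 'b \<Rightarrow> real) ` K)" for A
    by (rule bounded_subset[of "{0..1}"]) (auto simp: indicator_def)
  have bc: "bounded ((\<lambda>x. c * f x) ` K)" if "bounded (f ` K)" for f :: "'b \<Rightarrow> real" and c
    using bounded_scaleR_comp[OF that, of c] by simp
  have m_mono: "m A \<le> m B" if "A \<inter> K \<subseteq> B" for A B
    unfolding m_def by (rule mono[OF bI bI]) (use that in \<open>auto simp: indicator_def\<close>)
  have m0: "m A = 0" if "A \<inter> K = {}" for A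
  proof -
    have z: "L (\<lambda>x. 0) = 0" using scale[OF bI, of 0] by simp
    have "bounded ((\<lambda>x. 0::real) ` K)" using bc[OF bI, of 0] by simp
    note bz = this
    have "m A \<le> L (\<lambda>x. 0)" "L (\<lambda>x. 0) \<le> m A" unfolding m_def
      by (rule mono[OF bI bz] mono[OF bz bI]; use that in \<open>auto simp: indicator_def\<close>)+
    thus ?thesis using z by simp
  qed
  have m_pos: "m A \<ge> 0" for A using m_mono[of "{}" A] m0[of "{}"] by simp
  have m_add: "m (A \<union> B) = m A + m B" if "A \<inter> B = {}" for A B
  proof -
    have "indicator (A \<union> B) = (\<lambda>x. indicator A x + indicator B x :: real)"
      using that by (auto simp: indicator_def fun_eq_iff)
    thus ?thesis unfolding m_def using add[OF bI bI] by simp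
  qed
  have m_sub: "m (A \<union> B) \<le> m A + m B" for A B
  proof -
    have "m (A \<union> B) = m A + m (B - A)" using m_add[of A "B - A"] by simp
    also have "m (B - A) \<le> m B" by (rule m_mono) auto
    finally show ?thesis by simp
  qed
  have m_fin: "m (\<Union>i\<le>n. A i) \<le> (\<Sum>i\<le>n. m (A i))" for A and n :: nat
  proof (induction n)
    case (Suc n)
    have "m (\<Union>i\<le>Suc n. A i) \<le> m (\<Union>i\<le>n. A i) + m (A (Suc n))"
      using m_sub[of "\<Union>i\<le>n. A i" "A (Suc n)"] by (simp add: atMost_Suc Un_commute)
    thus ?case using Suc by simp
  qed simp
  have mK: "m K = 1" "m UNIV = 1"
  proof -
    show "m UNIV = 1" using one unfolding m_def indicator_def by simp
    thus "m K = 1" using m_mono[of UNIV K] m_mono[of K UNIV] by simp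
  qed
  \<comment> \<open>The error is measured by \<open>m\<close>, which ignores everything outside
    \<open>K\<close>. So \<open>C\<close> need not fill the part of a set outside \<open>K\<close>:
    an open set disjoint from \<open>K\<close> qualifies with empty \<open>C\<close>, and the whole
    space with \<open>C = K\<close>.\<close>
  define \<A> where "\<A> = {A \<in> sets borel. \<forall>e>0. \<exists>C U. compact C \<and> open U \<and> C \<subseteq> A \<and> A \<subseteq> U \<and> m (U - C) < e}"
  have \<A>D: "\<exists>C U. compact C \<and> open U \<and> C \<subseteq> A \<and> A \<subseteq> U \<and> m (U - C) < e" if "A \<in> \<A>" "e > 0" for A e
    using that unfolding \<A>_def by blast
  have \<A>I: "A \<in> \<A>" if "compact C" "open U" "C \<subseteq> A" "A \<subseteq> U" "(U - C) \<inter> K = {}" "A \<in> sets borel" for A C U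
    unfolding \<A>_def mem_Collect_eq using that m0[OF that(5)] by (intro conjI allI impI exI[of _ C] exI[of _ U]) simp_all
  have \<A>2: "m ((U \<union> V) - (C \<union> D)) < e \<and> m ((U - D) - (C - V)) < e"
    if "m (U - C) < e / 2" "m (V - D) < e / 2" for U V C D e
  proof -
    have "m ((U \<union> V) - (C \<union> D)) \<le> m ((U - C) \<union> (V - D))" by (rule m_mono) auto
    moreover have "m ((U - D) - (C - V)) \<le> m ((U - C) \<union> (V - D))" by (rule m_mono) auto
    ultimately show ?thesis using m_sub[of "U - C" "V - D"] that by simp
  qed
  have \<A>Un: "A \<union> B \<in> \<A>" and \<A>Diff: "A - B \<in> \<A>" if A: "A \<in> \<A>" and B: "B \<in> \<A>" for A B
  proof -
    have *: "\<exists>C U D V. compact C \<and> open U \<and> C \<subseteq> A \<and> A \<subseteq> U \<and>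
      compact D \<and> open V \<and> D \<subseteq> B \<and> B \<subseteq> V \<and> m ((U \<union> V) - (C \<union> D)) < e \<and> m ((U - D) - (C - V)) < e"
      if "e > 0" for e
      using \<A>D[OF A, of "e/2"] \<A>D[OF B, of "e/2"] \<A>2 \<open>e > 0\<close> by (meson half_gt_zero)
    have AB: "A \<in> sets borel" "B \<in> sets borel" using A B unfolding \<A>_def by auto
    show "A \<union> B \<in> \<A>" unfolding \<A>_def mem_Collect_eq
    proof (intro conjI allI impI)
      fix e :: real assume "e > 0"
      from *[OF this] obtain C U D V where "compact C" "open U" "C \<subseteq> A" "A \<subseteq> U" 
        "compact D" "open V" "D \<subseteq> B" "B \<subseteq> V" "m ((U \<union> V) - (C \<union> D)) < e" by blast
      thus "\<exists>C U. compact C \<and> open U \<and> C \<subseteq> A \<union> B \<and> A \<union> B \<subseteq> U \<and> m (U - C) < e"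
        by (intro exI[of _ "C \<union> D"] exI[of _ "U \<union> V"]) (auto intro: compact_Un)
    qed (use AB in auto)
    show "A - B \<in> \<A>" unfolding \<A>_def mem_Collect_eq
    proof (intro conjI allI impI)
      fix e :: real assume "e > 0"
      from *[OF this] obtain C U D V where "compact C" "open U" "C \<subseteq> A" "A \<subseteq> U" 
        "compact D" "open V" "D \<subseteq> B" "B \<subseteq> V" "m ((U - D) - (C - V)) < e" by blast
      thus "\<exists>C U. compact C \<and> open U \<and> C \<subseteq> A - B \<and> A - B \<subseteq> U \<and> m (U - C) < e"
        by (intro exI[of _ "C - V"] exI[of _ "U - D"])
           (auto intro: compact_diff open_Diff compact_imp_closed)
    qed (use AB in auto)
  qed
  have ring: "ring_of_sets UNIV \<A>"
    unfolding ring_of_sets_iff using \<A>Un \<A>Diff \<A>I[of "{}" "{}" "{}"] by auto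
  have cont: "(\<lambda>i. ennreal (m (A i))) \<longlonglongrightarrow> 0"
    if A: "range A \<subseteq> \<A>" "decseq A" "(\<Inter>i. A i) = {}" for A :: "nat \<Rightarrow> 'b set"
  proof -
    have "(\<lambda>i. m (A i)) \<longlonglongrightarrow> 0"
    proof (rule LIMSEQ_I)
      fix e :: real assume e: "e > 0"
      \<comment> \<open>The geometric errors keep the sum of all losses \<open>A i - C i\<close>
        below \<open>e\<close>.\<close>
      have "\<exists>C. compact C \<and> C \<subseteq> A i \<and> m (A i - C) < e / 2 * (1/2)^i" for i
      proof -
        have "A i \<in> \<A>" using A(1) by auto
        moreover have "e / 2 * (1/2)^i > 0" using e by simp
        ultimately have "\<exists>C U. compact C \<and> open U \<and> C \<subseteq> A i \<and> A i \<subseteq> U \<and> m (U - C) < e / 2 * (1/2)^i"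
          by (rule \<A>D)
        then obtain C U where CU: "compact C" "C \<subseteq> A i" "A i \<subseteq> U" "m (U - C) < e / 2 * (1/2)^i"
          by (elim exE conjE)
        have "m (A i - C) \<le> m (U - C)" by (rule m_mono) (use CU in auto)
        thus ?thesis using CU by (intro exI[of _ C]) auto
      qed
      then obtain C where C: "\<And>i. compact (C i)" "\<And>i. C i \<subseteq> A i" "\<And>i. m (A i - C i) < e / 2 * (1/2)^i"
        by metis
      \<comment> \<open>The nested compact sets \<open>D n\<close> lie in \<open>A n\<close>, so
        their intersection is empty and one of them is already empty. From that index on,
        \<open>A j\<close> is covered by finitely many of the losses
        \<open>A i - C i\<close>.\<close>
      define D where "D n = (\<Inter>i\<le>n. C i)" for n
      have "\<exists>n. D n = {}"
      proof (rule ccontr)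
        assume "\<not> ?thesis"
        moreover have "compact (D n)" for n unfolding D_def
          by (rule compact_Inter) (use C in auto)
        moreover have "D n \<subseteq> D k" if "k \<le> n" for k n unfolding D_def using that by force
        ultimately have "\<Inter>(range D) \<noteq> {}" by (intro compact_nest) auto
        then obtain x where "\<And>n. x \<in> D n" by auto
        hence "\<And>n. x \<in> A n" using C(2) unfolding D_def by blast
        thus False using A(3) by auto
      qed
      then obtain n where n: "D n = {}" ..
      have small: "m (A j) < e" if j: "j \<ge> n" for j
      proof -
        have "A j \<subseteq> (\<Union>i\<le>n. A i - C i)"
        proof
          fix x assume x: "x \<in> A j"
          have "x \<notin> D n" using n by simp
          then obtain i where i: "i \<le> n" "x \<notin> C i" unfolding D_def by auto
          have "A j \<subseteq> A i" using A(2) i j by (auto simp: decseq_def)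
          thus "x \<in> (\<Union>i\<le>n. A i - C i)" using i x by auto
        qed
        hence "m (A j) \<le> m (\<Union>i\<le>n. A i - C i)" by (intro m_mono) auto
        also have "\<dots> \<le> (\<Sum>i\<le>n. m (A i - C i))" by (rule m_fin)
        also have "\<dots> \<le> (\<Sum>i\<le>n. e / 2 * (1/2)^i)" by (intro sum_mono less_imp_le C(3))
        also have "\<dots> = e / 2 * (\<Sum>i\<le>n. (1/2)^i)" by (simp add: sum_distrib_left)
        also have "(\<Sum>i\<le>n. (1/2::real)^i) = 2 - (1/2)^n" by (induction n) auto
        also have "e / 2 * (2 - (1/2)^n) < e" using e by (simp add: field_simps)
        finally show ?thesis .
      qed
      show "\<exists>no. \<forall>j\<ge>no. norm (m (A j) - 0) < e"
        using small m_pos by (intro exI[of _ n]) simp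
    qed
    hence "(\<lambda>i. ennreal (m (A i))) \<longlonglongrightarrow> ennreal 0" by (rule tendsto_ennrealI)
    thus ?thesis by simp
  qed
  have "\<exists>\<mu> :: 'b set \<Rightarrow> ennreal. (\<forall>s\<in>\<A>. \<mu> s = ennreal (m s)) \<and>
      measure_space UNIV (sigma_sets UNIV \<A>) \<mu>"
  proof (rule ring_of_sets.caratheodory_empty_continuous[OF ring])
    show "positive \<A> (\<lambda>s. ennreal (m s))" unfolding positive_def using m0[of "{}"] by simp
    show "additive \<A> (\<lambda>s. ennreal (m s))" unfolding additive_def
      using m_add m_pos by (auto simp: ennreal_plus)
  qed (use cont in auto)
  then obtain \<mu> where \<mu>: "\<And>s. s \<in> \<A> \<Longrightarrow> \<mu> s = ennreal (m s)"
    "measure_space UNIV (sigma_sets UNIV \<A>) \<mu>" by blast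

  have lev: "\<exists>B. countable B \<and> (\<forall>t. t \<notin> B \<longrightarrow> {x \<in> K. f x < t} \<in> \<A>)" if f: "continuous_on K f" for f :: "'b \<Rightarrow> real"
  proof -
    \<comment> \<open>\<open>m\<close> is only known to be finitely additive, so
      \<open>\<phi>\<close> may jump even from the left. At a continuity point a slightly lower
      closed level set \<open>{x \<in> K. f x \<le> s}\<close> carries almost all of the mass and
      serves as the compact approximation.\<close>
    define \<phi> where "\<phi> t = m {x \<in> K. f x < t}" for t
    have "mono \<phi>" unfolding \<phi>_def by (intro monoI m_mono) auto
    hence "countable {t. \<not> isCont \<phi> t}" by (rule mono_ctble_discont)
    moreover have "{x \<in> K. f x < t} \<in> \<A>" if t: "isCont \<phi> t" for t
    proof -
      obtain V where V: "open V" "V \<inter> K = {x \<in> K. f x < t}"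
        using f[unfolded continuous_on_open_invariant, rule_format, of "{..<t}"] by auto
      have "{x \<in> K. f x < t} \<in> sets borel"
        unfolding V(2)[symmetric] using V(1) K by (auto intro: borel_compact)
      moreover have "\<exists>C U. compact C \<and> open U \<and> C \<subseteq> {x \<in> K. f x < t} \<and> {x \<in> K. f x < t} \<subseteq> U \<and> m (U - C) < e"
        if e: "e > 0" for e
      proof -
        obtain d where d: "d > 0" "\<And>s. \<bar>s - t\<bar> < d \<Longrightarrow> \<bar>\<phi> s - \<phi> t\<bar> < e"
          using t[unfolded continuous_at_real_range, rule_format, OF e] by auto
        define s where "s = t - d / 2"
        have s: "s < t" "\<bar>\<phi> s - \<phi> t\<bar> < e" using d unfolding s_def by auto
        obtain C' where C': "closed C'" "C' \<inter> K = {x \<in> K. f x \<le> s}"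
          using f[unfolded continuous_on_closed_invariant, rule_format, of "{..s}"] by auto
        define C where "C = {x \<in> K. f x \<le> s}"
        have C: "compact C" unfolding C_def C'(2)[symmetric] using C'(1) K by (simp add: closed_Int_compact)
        have "m (V - C) \<le> m ({x \<in> K. f x < t} - C)" by (rule m_mono) (use V in auto)
        moreover have "m (C \<union> ({x \<in> K. f x < t} - C)) = m C + m ({x \<in> K. f x < t} - C)"
          by (rule m_add) auto
        moreover have "C \<union> ({x \<in> K. f x < t} - C) = {x \<in> K. f x < t}" using s(1) unfolding C_def by auto
        moreover have "\<phi> s \<le> m C" unfolding \<phi>_def C_def by (rule m_mono) auto
        ultimately have "m (V - C) \<le> \<phi> t - \<phi> s" unfolding \<phi>_def by simp
        hence "m (V - C) < e" using s(2) by simp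
        moreover have "C \<subseteq> {x \<in> K. f x < t}" using s(1) unfolding C_def by auto
        ultimately show ?thesis using C V by (intro exI[of _ C] exI[of _ V]) auto
      qed
      ultimately show ?thesis unfolding \<A>_def by blast
    qed
    ultimately show ?thesis by blast
  qed

  have sig: "sigma_sets UNIV \<A> = sets borel"
  proof
    show "sigma_sets UNIV \<A> \<subseteq> sets borel"
      using sets.sigma_sets_subset[of \<A> borel] unfolding \<A>_def by auto
    have "V \<in> sigma_sets UNIV \<A>" if V: "open V" for V
    proof (cases "V = UNIV")
      case True
      thus ?thesis by (simp add: sigma_sets_top)
    next
      case False
      \<comment> \<open>Inside \<open>K\<close>, the set \<open>V\<close> is the union of sublevel
        sets of minus the distance to its complement, with levels \<open>t n\<close> that tend to 0
        from below and avoid the countable exceptional set.\<close>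
      define f where "f x = - infdist x (- V)" for x
      have f: "continuous_on K f" unfolding f_def by (intro continuous_intros)
      from lev[OF f] obtain B where B: "countable B" "\<And>t. t \<notin> B \<Longrightarrow> {x \<in> K. f x < t} \<in> \<A>" by blast
      have "\<exists>t. t \<in> {- (1 / real (Suc n)) <..< 0} \<and> t \<notin> B" for n
        using open_minus_countable[OF B(1), of "{- (1 / real (Suc n)) <..< 0}"] by auto
      then obtain t where t: "\<And>n. - (1 / real (Suc n)) < t n" "\<And>n. t n < 0" "\<And>n. t n \<notin> B"
        by (metis greaterThanLessThan_iff)
      have "V \<inter> K = (\<Union>n. {x \<in> K. f x < t n})"
      proof (intro equalityI subsetI)
        fix x assume x: "x \<in> V \<inter> K"
        have "infdist x (- V) > 0" using V False x by (intro infdist_pos_not_in_closed) auto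
        then obtain n where "inverse (real (Suc n)) < infdist x (- V)" using reals_Archimedean by blast
        hence "f x < t n" using t(1)[of n] unfolding f_def by (simp add: inverse_eq_divide)
        thus "x \<in> (\<Union>n. {x \<in> K. f x < t n})" using x by auto
      next
        fix x assume "x \<in> (\<Union>n. {x \<in> K. f x < t n})"
        then obtain n where x: "x \<in> K" "f x < t n" by auto
        hence "infdist x (- V) > 0" using t(2)[of n] unfolding f_def by simp
        hence "x \<in> V" by (metis ComplI infdist_zero less_irrefl)
        thus "x \<in> V \<inter> K" using x by simp
      qed
      also have "\<dots> \<in> sigma_sets UNIV \<A>"
        using B(2) t(3) by (intro sigma_sets.Union sigma_sets.Basic) blast
      finally have 1: "V \<inter> K \<in> sigma_sets UNIV \<A>" .
      have "open (V - K)" using V K by (auto intro: open_Diff compact_imp_closed)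
      hence 2: "V - K \<in> \<A>" by (intro \<A>I[of "{}" "V - K"]) auto
      have "V = (V \<inter> K) \<union> (V - K)" by auto
      moreover have "(V \<inter> K) \<union> (V - K) \<in> sigma_sets UNIV \<A>"
        by (rule sigma_sets_Un[OF 1 sigma_sets.Basic[OF 2]])
      ultimately show ?thesis by simp
    qed
    hence "sigma_sets UNIV {S. open S} \<subseteq> sigma_sets UNIV \<A>" by (intro sigma_sets_mono) auto
    thus "sets borel \<subseteq> sigma_sets UNIV \<A>" unfolding borel_def by simp
  qed
  define M where "M = measure_of UNIV (sets borel) \<mu>"
  have setsM: "sets M = sets borel" unfolding M_def by (metis sets.sets_measure_of_eq space_borel)
  have emM: "emeasure M A = \<mu> A" if "A \<in> sets borel" for A
    unfolding M_def using \<mu>(2) that unfolding sig measure_space_def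
    by (intro emeasure_measure_of_sigma) auto
  have emA: "emeasure M A = ennreal (m A)" if "A \<in> \<A>" for A
    using emM[of A] \<mu>(1)[OF that] that unfolding \<A>_def by simp
  have KA: "K \<in> \<A>" by (rule \<A>I[of K UNIV]) (use K in \<open>auto simp: borel_compact\<close>)
  have UA: "UNIV \<in> \<A>" by (rule \<A>I[of K UNIV]) (use K in auto)
  have prob: "prob_space M"
    by (rule prob_spaceI) (use emA[OF UA] mK setsM in \<open>simp add: sets_eq_imp_space_eq[OF setsM]\<close>)
  interpret M: prob_space M by (rule prob)
  have msA: "measure M A = m A" if "A \<in> \<A>" for A
    using emA[OF that] m_pos by (simp add: measure_def)
  show ?thesis
  proof (rule that[OF setsM prob])
    show "emeasure M K = 1" using emA[OF KA] mK by simp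
    fix f :: "'b \<Rightarrow> real" assume f: "continuous_on K f"
    obtain b where b: "\<And>x. x \<in> K \<Longrightarrow> \<bar>f x\<bar> \<le> b" "b > 0"
      using compact_imp_bounded[OF compact_continuous_image[OF f K]] unfolding bounded_pos by auto
    have bf: "bounded (f ` K)" using compact_imp_bounded[OF compact_continuous_image[OF f K]] .
    have Kb: "K \<in> sets M" using K setsM by (simp add: borel_compact)
    have fi: "set_integrable M K f" unfolding set_integrable_def
    proof (rule M.integrable_const_bound[where B=b])
      show "AE x in M. norm (indicator K x *\<^sub>R f x) \<le> b" using b by (auto simp: indicator_def)
      show "(\<lambda>x. indicator K x *\<^sub>R f x) \<in> borel_measurable M"
        using borel_measurable_continuous_on_indicator[OF _ f] K setsM
        by (simp add: borel_compact cong: measurable_cong_sets)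
    qed
    from lev[OF f] obtain B where B: "countable B" "\<And>t. t \<notin> B \<Longrightarrow> {x \<in> K. f x < t} \<in> \<A>" by blast
    have approx: "\<bar>(\<integral>x\<in>K. f x \<partial>M) - L f\<bar> \<le> 2 * e" if e: "e > 0" for e
    proof -
      \<comment> \<open>One offset \<open>s\<close> has to make all levels \<open>s + i * e\<close>
        good at once. The bad offsets are countably many translates of \<open>B\<close>, so some
        point between 0 and \<open>e\<close> avoids them.\<close>
      have "countable (\<Union>i::int. (\<lambda>t. t - real_of_int i * e) ` B)" using B(1) by auto
      from open_minus_countable[OF this, of "{0<..<e}"] e obtain s where
        s: "0 < s" "s < e" "\<And>i. s \<notin> (\<lambda>t. t - real_of_int i * e) ` B" by force
      have s': "s + real_of_int i * e \<notin> B" for i using s(3)[of i] by force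
      define A where "A i = {x \<in> K. f x < s + real_of_int (i + 1) * e} - {x \<in> K. f x < s + real_of_int i * e}" for i :: int
      have AA: "A i \<in> \<A>" for i unfolding A_def by (intro \<A>Diff B(2) s')
      have AK: "A i \<subseteq> K" for i unfolding A_def by auto
      have AM: "A i \<in> sets M" for i using AA[of i] setsM unfolding \<A>_def by simp
      \<comment> \<open>The margin 2 absorbs the offset \<open>s < e\<close> and the rounding of the
        floor, so that the index of the slab containing \<open>f x\<close> lies between
        \<open>- N\<close> and \<open>N\<close>.\<close>
      define N where "N = \<lceil>b / e\<rceil> + 2"
      define c where "c i = s + real_of_int i * e" for i
      define g where "g x = (\<Sum>i\<in>{-N..N}. c i * indicator (A i) x)" for x
      have fg: "\<bar>f x - g x\<bar> \<le> e" if x: "x \<in> K" for x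
      proof -
        define i where "i = \<lfloor>(f x - s) / e\<rfloor>"
        have i: "real_of_int i \<le> (f x - s) / e" "(f x - s) / e < real_of_int i + 1" unfolding i_def by linarith+
        have iA: "x \<in> A j \<longleftrightarrow> j = i" for j
        proof -
          have "x \<in> A j \<longleftrightarrow> real_of_int j \<le> (f x - s) / e \<and> (f x - s) / e < real_of_int j + 1"
            unfolding A_def using x e by (auto simp: field_simps)
          also have "\<dots> \<longleftrightarrow> j = i" unfolding i_def by (metis floor_eq_iff)
          finally show ?thesis .
        qed
        have "\<bar>(f x - s) / e\<bar> \<le> b / e + 1"
          using b(1)[OF x] s(1,2) e by (auto simp: field_simps abs_le_iff)
        hence "i \<in> {-N..N}" unfolding N_def i_def by (auto simp: abs_le_iff le_floor_iff floor_le_iff; linarith)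
        hence "g x = c i" unfolding g_def
          by (subst sum.remove[of _ i]) (auto simp: indicator_def iA)
        thus ?thesis using i e unfolding c_def by (auto simp: field_simps abs_le_iff)
      qed
      have bA: "bounded ((\<lambda>x. c i * indicator (A i) x) ` K)" for i by (rule bc[OF bI])
      have Ls: "bounded ((\<lambda>x. \<Sum>i\<in>I. c i * indicator (A i) x) ` K) \<and>
          L (\<lambda>x. \<Sum>i\<in>I. c i * indicator (A i) x) = (\<Sum>i\<in>I. c i * m (A i))" if "finite I" for I
        using that
      proof (induction I rule: finite_induct)
        case empty
        have "L (\<lambda>x. 0 * indicator K x) = 0 * L (indicator K)" by (rule scale[OF bI])
        thus ?case using bc[OF bI, of 0] by simp
      next
        case (insert i I)
        have e: "(\<lambda>x. \<Sum>i\<in>insert i I. c i * indicator (A i) x) =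
          (\<lambda>x. c i * indicator (A i) x + (\<Sum>i\<in>I. c i * indicator (A i) x))"
          unfolding fun_eq_iff sum.insert[OF insert(1,2)] by (rule allI) (rule refl)
        show ?case unfolding e using insert add[OF bA, of "\<lambda>x. \<Sum>i\<in>I. c i * indicator (A i) x" i]
          scale[OF bI, of "c i" "A i"] bounded_plus_comp[OF bA] by (simp add: m_def)
      qed
      have Lg: "L g = (\<Sum>i\<in>{-N..N}. c i * m (A i))" and bg: "bounded (g ` K)"
        using Ls[of "{-N..N}"] unfolding g_def by auto
      have gi: "integrable M g" unfolding g_def using AM
        by (intro Bochner_Integration.integrable_sum integrable_mult_right integrable_real_indicator)
           (auto simp: M.emeasure_finite less_top[symmetric])
      have "integral\<^sup>L M g = (\<Sum>i\<in>{-N..N}. c i * m (A i))" unfolding g_def using AM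
        by (subst Bochner_Integration.integral_sum)
           (auto simp: M.emeasure_finite less_top[symmetric] msA[OF AA] sets.Int_space_eq2)
      hence gL: "integral\<^sup>L M g = L g" using Lg by simp
      have g0: "g x = 0" if "x \<notin> K" for x unfolding g_def using AK that by (intro sum.neutral) (auto simp: indicator_def)
      have "\<bar>(\<integral>x\<in>K. f x \<partial>M) - integral\<^sup>L M g\<bar> \<le> e"
      proof -
        have "(\<integral>x\<in>K. f x \<partial>M) - integral\<^sup>L M g = (\<integral>x. indicator K x *\<^sub>R f x - g x \<partial>M)"
          unfolding set_lebesgue_integral_def
          by (rule Bochner_Integration.integral_diff[symmetric]) (use fi gi in \<open>auto simp: set_integrable_def\<close>)
        also have "\<bar>\<dots>\<bar> \<le> (\<integral>x. \<bar>indicator K x *\<^sub>R f x - g x\<bar> \<partial>M)"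
          by (rule integral_abs_bound)
        also have "\<dots> \<le> (\<integral>x. e \<partial>M)"
        proof (rule integral_mono)
          show "integrable M (\<lambda>x. \<bar>indicator K x *\<^sub>R f x - g x\<bar>)"
            using fi gi by (auto simp: set_integrable_def)
          show "\<bar>indicator K x *\<^sub>R f x - g x\<bar> \<le> e" for x
            using fg[of x] g0[of x] e by (auto simp: indicator_def)
        qed simp
        finally show ?thesis by (simp add: M.prob_space)
      qed
      moreover have "\<bar>L f - L g\<bar> \<le> e"
      proof -
        have e1: "L (\<lambda>x. e * 1) = e" using scale[of "\<lambda>x. 1" e] one bI[of UNIV] by (simp add: indicator_def)
        have be: "bounded ((\<lambda>x. e * 1) ` K)" by (rule bounded_subset[of "{e}"]) auto
        have "L f \<le> L (\<lambda>x. g x + e * 1)"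
          by (rule mono[OF bf bounded_plus_comp[OF bg be]]) (use fg in \<open>auto simp: abs_le_iff algebra_simps\<close>)
        moreover have "L g \<le> L (\<lambda>x. f x + e * 1)"
          by (rule mono[OF bg bounded_plus_comp[OF bf be]]) (use fg in \<open>auto simp: abs_le_iff algebra_simps\<close>)
        ultimately show ?thesis using add[OF bg be] add[OF bf be] e1 by simp
      qed
      ultimately show ?thesis using gL by simp
    qed
    have "\<bar>(\<integral>x\<in>K. f x \<partial>M) - L f\<bar> \<le> 0 + e" if "e > 0" for e using approx[of "e/2"] that by simp
    hence "\<bar>(\<integral>x\<in>K. f x \<partial>M) - L f\<bar> \<le> 0" by (rule field_le_epsilon)
    thus "(\<integral>x\<in>K. f x \<partial>M) = L f" by simp
  qed
qed

section \<open>The sub-mean-value property\<close>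

text \<open>The mean value inequality is kept apart from semicontinuity because the constructions
  below obtain continuity by other means. Integrability is not part of it either; it comes from
  membership in \<open>Sb\<close>.\<close>

definition submean :: "'a::euclidean_space set \<Rightarrow> ('a \<Rightarrow> real) \<Rightarrow> bool" where
  "submean U f \<longleftrightarrow> (\<forall>x0 r. r > 0 \<longrightarrow> cball x0 r \<subseteq> U \<longrightarrow> f x0 \<le> sphere_mean f x0 r)"

lemma subharmonic_on_iff: "subharmonic_on U f \<longleftrightarrow> usc_on U f \<and> submean U f"
  unfolding subharmonic_on_def submean_def ..

lemma submeanD: "submean U f \<Longrightarrow> r > 0 \<Longrightarrow> cball x r \<subseteq> U \<Longrightarrow> f x \<le> sphere_mean f x r"
  unfolding submean_def by blast

lemma continuous_imp_usc_on:
  assumes "continuous_on U f"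
  shows "usc_on U f"
  unfolding usc_on_def
proof (intro ballI allI impI)
  fix x and e :: real assume "x \<in> U" "e > 0"
  hence "(f \<longlongrightarrow> f x) (at x within U)" using assms unfolding continuous_on_def by blast
  from order_tendstoD(2)[OF this, of "f x + e"] \<open>e > 0\<close>
  show "\<forall>\<^sub>F y in at x within U. f y < f x + e" by simp
qed

lemma Sb_measurable: "f \<in> Sb U \<Longrightarrow> (\<lambda>x. indicator U x * f x) \<in> borel_measurable borel"
  unfolding Sb_def set_borel_measurable_def by simp

lemma Sb_bound: 
  assumes "f \<in> Sb U"
  obtains B where "B > 0" "\<And>x. x \<in> U \<Longrightarrow> \<bar>f x\<bar> \<le> B"
  using assms unfolding Sb_def bounded_pos by auto

lemma SbI:
  assumes "(\<lambda>x. indicator U x * f x) \<in> borel_measurable borel" "\<And>x. x \<in> U \<Longrightarrow> \<bar>f x\<bar> \<le> B"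
  shows "f \<in> Sb U"
  using assms unfolding Sb_def set_borel_measurable_def bounded_iff by auto

lemma Cb_subset_Sb: "open U \<Longrightarrow> Cb U \<subseteq> Sb U"
  unfolding Cb_def Sb_def set_borel_measurable_def
  using borel_measurable_continuous_on_indicator[OF borel_open] by fastforce

text \<open>At \<open>u = 0\<close> the convention for division gives the centre \<open>x\<close>,
  which is why the closed ball appears here rather than the sphere.\<close>

lemma sphere_point_in_cball:
  fixes x u :: "'a::real_normed_vector"
  assumes "r \<ge> 0"
  shows "x + r *\<^sub>R (u /\<^sub>R norm u) \<in> cball x r"
  using assms by (cases "u = 0") (simp_all add: dist_norm field_simps)

text \<open>Only the values of \<open>f\<close> on \<open>U\<close> are under control, so
  measurability is transferred through the truncation of \<open>f\<close> by the indicator of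
  \<open>U\<close>, which changes nothing on the ball.\<close>

lemma sphere_mean_integrable:
  assumes f: "f \<in> Sb U" and r: "r \<ge> 0" and sub: "cball x r \<subseteq> U"
  shows "integrable lborel (\<lambda>u. indicator (ball 0 1) u * f (x + r *\<^sub>R (u /\<^sub>R norm u)))"
proof -
  obtain B where B: "B > 0" "\<And>x. x \<in> U \<Longrightarrow> \<bar>f x\<bar> \<le> B" using Sb_bound[OF f] by blast
  have inU: "x + r *\<^sub>R (u /\<^sub>R norm u) \<in> U" for u
    using sphere_point_in_cball[OF r] sub by blast
  define g where "g x = indicator U x * f x" for x
  have g[measurable]: "g \<in> borel_measurable borel" unfolding g_def by (rule Sb_measurable[OF f])
  show ?thesis
  proof (rule Bochner_Integration.integrable_bound)
    show "integrable lborel (\<lambda>u::'a. B * indicator (ball 0 1) u)"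
      using emeasure_lborel_ball_finite[of "0::'a" 1] by (intro integrable_mult_right) auto
    have "(\<lambda>u. indicator (ball 0 1) u * f (x + r *\<^sub>R (u /\<^sub>R norm u))) =
        (\<lambda>u. indicator (ball 0 1) u * g (x + r *\<^sub>R (inverse (norm u) *\<^sub>R u)))"
      using inU by (auto simp: g_def)
    also have "\<dots> \<in> borel_measurable borel"
    proof (intro borel_measurable_times borel_measurable_indicator measurable_compose[OF _ g])
      show "(\<lambda>u. x + r *\<^sub>R (inverse (norm u) *\<^sub>R u)) \<in> borel \<rightarrow>\<^sub>M borel" by measurable
    qed simp
    finally show "(\<lambda>u. indicator (ball 0 1) u * f (x + r *\<^sub>R (u /\<^sub>R norm u))) \<in> borel_measurable lborel" by simp
    show "AE u in lborel. norm (indicator (ball 0 1) u * f (x + r *\<^sub>R (u /\<^sub>R norm u)))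
        \<le> norm (B * indicator (ball 0 1) u)"
      using B inU by (auto simp: indicator_def)
  qed
qed

lemma sphere_mean_mono:
  assumes "f \<in> Sb U" "g \<in> Sb U" and r: "r \<ge> 0" and sub: "cball x r \<subseteq> U"
    and le: "\<And>y. y \<in> U \<Longrightarrow> f y \<le> g y"
  shows "sphere_mean f x r \<le> sphere_mean g x r"
  unfolding sphere_mean_def
proof (intro divide_right_mono integral_mono sphere_mean_integrable[OF _ r sub] assms(1,2))
  fix u :: 'a
  have "x + r *\<^sub>R (u /\<^sub>R norm u) \<in> U" using sphere_point_in_cball[OF r] sub by blast
  thus "indicator (ball 0 1) u * f (x + r *\<^sub>R (u /\<^sub>R norm u)) \<le>
    indicator (ball 0 1) u * g (x + r *\<^sub>R (u /\<^sub>R norm u))"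
    using le by (auto simp: indicator_def)
qed simp

lemma sphere_mean_lincomb:
  assumes "f \<in> Sb U" "g \<in> Sb U" and r: "r \<ge> 0" and sub: "cball x r \<subseteq> U"
  shows "sphere_mean (\<lambda>y. a * f y + b * g y) x r = a * sphere_mean f x r + b * sphere_mean g x r"
proof -
  have "(\<integral>u. indicator (ball 0 1) u * (a * f (x + r *\<^sub>R (u /\<^sub>R norm u)) + b * g (x + r *\<^sub>R (u /\<^sub>R norm u))) \<partial>lborel) =
    (\<integral>u. a * (indicator (ball 0 1) u * f (x + r *\<^sub>R (u /\<^sub>R norm u))) +
      b * (indicator (ball 0 1) u * g (x + r *\<^sub>R (u /\<^sub>R norm u))) \<partial>lborel)"
    by (simp add: algebra_simps)
  also have "\<dots> = a * (\<integral>u. indicator (ball 0 1) u * f (x + r *\<^sub>R (u /\<^sub>R norm u)) \<partial>lborel) +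
      b * (\<integral>u. indicator (ball 0 1) u * g (x + r *\<^sub>R (u /\<^sub>R norm u)) \<partial>lborel)"
    using sphere_mean_integrable[OF assms(1) r sub] sphere_mean_integrable[OF assms(2) r sub]
    by (subst Bochner_Integration.integral_add)
       (auto simp del: scaleR_scaleR intro!: integrable_mult_right)
  finally show ?thesis unfolding sphere_mean_def by (simp add: add_divide_distrib)
qed

lemma sphere_mean_const: "sphere_mean (\<lambda>y. c) (x::'a::euclidean_space) r = c"
proof -
  have "measure lborel (ball (0::'a) 1) > 0" by (rule content_ball_pos) simp
  moreover have "(\<integral>u. indicator (ball (0::'a) 1) u * c \<partial>lborel) = measure lborel (ball (0::'a) 1) * c"
    by simp
  ultimately show ?thesis unfolding sphere_mean_def by (metis less_irrefl nonzero_mult_div_cancel_left)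
qed

lemma Sb_const: "U \<in> sets borel \<Longrightarrow> (\<lambda>x. c) \<in> Sb U"
  by (rule SbI[of _ _ "\<bar>c\<bar>"]) auto

lemma Sb_lincomb:
  assumes "f \<in> Sb U" "g \<in> Sb U"
  shows "(\<lambda>x. a * f x + b * g x) \<in> Sb U"
proof -
  obtain B where B: "B > 0" "\<And>x. x \<in> U \<Longrightarrow> \<bar>f x\<bar> \<le> B" using Sb_bound[OF assms(1)] by blast
  obtain C where C: "C > 0" "\<And>x. x \<in> U \<Longrightarrow> \<bar>g x\<bar> \<le> C" using Sb_bound[OF assms(2)] by blast
  note [measurable] = Sb_measurable[OF assms(1)] Sb_measurable[OF assms(2)]
  show ?thesis
  proof (rule SbI[of _ _ "\<bar>a\<bar> * B + \<bar>b\<bar> * C"])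
    have "(\<lambda>x. indicator U x * (a * f x + b * g x)) =
      (\<lambda>x. a * (indicator U x * f x) + b * (indicator U x * g x))" by (simp add: algebra_simps)
    also have "\<dots> \<in> borel_measurable borel" by measurable
    finally show "(\<lambda>x. indicator U x * (a * f x + b * g x)) \<in> borel_measurable borel" .
    fix x assume "x \<in> U"
    hence "\<bar>a * f x\<bar> \<le> \<bar>a\<bar> * B" "\<bar>b * g x\<bar> \<le> \<bar>b\<bar> * C"
      using B C by (auto simp: abs_mult intro: mult_left_mono)
    thus "\<bar>a * f x + b * g x\<bar> \<le> \<bar>a\<bar> * B + \<bar>b\<bar> * C" by linarith
  qed
qed

lemma Sb_affine:
  fixes f :: "'a::euclidean_space \<Rightarrow> real"
  assumes f: "f \<in> Sb U" and V: "V \<in> sets borel" and sub: "\<And>x. x \<in> V \<Longrightarrow> t *\<^sub>R x + b \<in> U"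
  shows "(\<lambda>x. f (t *\<^sub>R x + b)) \<in> Sb V"
proof -
  obtain B where B: "B > 0" "\<And>x. x \<in> U \<Longrightarrow> \<bar>f x\<bar> \<le> B" using Sb_bound[OF f] by blast
  define g where "g x = indicator U x * f x" for x
  have [measurable]: "g \<in> borel_measurable borel" unfolding g_def by (rule Sb_measurable[OF f])
  note [measurable] = V
  show ?thesis
  proof (rule SbI[of _ _ B])
    have "(\<lambda>x. indicator V x * f (t *\<^sub>R x + b)) = (\<lambda>x. indicator V x * g (t *\<^sub>R x + b))"
      using sub by (auto simp: g_def indicator_def)
    also have "\<dots> \<in> borel_measurable borel" by measurable
    finally show "(\<lambda>x. indicator V x * f (t *\<^sub>R x + b)) \<in> borel_measurable borel" .
  qed (use B sub in auto)
qed

lemma submean_lincomb: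
  assumes "f \<in> Sb U" "g \<in> Sb U" "submean U f" "submean U g" "a \<ge> 0" "b \<ge> 0"
  shows "submean U (\<lambda>x. a * f x + b * g x)"
  unfolding submean_def
proof (intro allI impI)
  fix x r assume r: "(0::real) < r" "cball x r \<subseteq> U"
  have "a * f x + b * g x \<le> a * sphere_mean f x r + b * sphere_mean g x r"
    using assms r by (intro add_mono mult_left_mono submeanD[of U])
  thus "a * f x + b * g x \<le> sphere_mean (\<lambda>y. a * f y + b * g y) x r"
    using sphere_mean_lincomb[OF assms(1,2)] r by simp
qed

lemma submean_const: "submean U (\<lambda>x. c)"
  unfolding submean_def by (simp add: sphere_mean_const)

text \<open>Homotheties map closed balls to closed balls. Since the spherical mean is parametrised
  by directions, they change only its centre and radius and no Jacobian appears.\<close>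

lemma submean_affine:
  assumes f: "submean U f" and t: "t > 0" and sub: "\<And>x. x \<in> V \<Longrightarrow> t *\<^sub>R x + b \<in> U"
  shows "submean V (\<lambda>x. f (t *\<^sub>R x + b))"
  unfolding submean_def
proof (intro allI impI)
  fix x :: 'a and r :: real assume r: "0 < r" "cball x r \<subseteq> V"
  have "cball (t *\<^sub>R x + b) (t * r) \<subseteq> U"
  proof
    fix z assume z: "z \<in> cball (t *\<^sub>R x + b) (t * r)"
    define y where "y = (z - b) /\<^sub>R t"
    have zy: "z = t *\<^sub>R y + b" using t by (simp add: y_def)
    have "t * dist x y \<le> t * r" using z t unfolding zy by (simp add: dist_scaleR[symmetric] dist_norm flip: scaleR_diff_right)
    hence "y \<in> cball x r" using t by simp
    thus "z \<in> U" using sub r zy by blast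
  qed
  hence "f (t *\<^sub>R x + b) \<le> sphere_mean f (t *\<^sub>R x + b) (t * r)"
    using r t by (intro submeanD[OF f]) auto
  also have "\<dots> = sphere_mean (\<lambda>x. f (t *\<^sub>R x + b)) x r"
    unfolding sphere_mean_def by (simp add: algebra_simps)
  finally show "f (t *\<^sub>R x + b) \<le> sphere_mean (\<lambda>x. f (t *\<^sub>R x + b)) x r" .
qed

text \<open>A member of the family that is nearly optimal at the centre suffices: its mean lies
  below the mean of \<open>h\<close>. The hypothesis \<open>h \<in> Sb U\<close> supplies the
  measurability that an uncountable supremum does not provide by itself.\<close>

lemma submean_sup:
  assumes h: "h \<in> Sb U" and g: "\<And>i. i \<in> I \<Longrightarrow> g i \<in> Sb U" "\<And>i. i \<in> I \<Longrightarrow> submean U (g i)"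
    and le: "\<And>i x. i \<in> I \<Longrightarrow> x \<in> U \<Longrightarrow> g i x \<le> h x"
    and sup: "\<And>x e. x \<in> U \<Longrightarrow> e > 0 \<Longrightarrow> \<exists>i\<in>I. h x - e < g i x"
  shows "submean U h"
  unfolding submean_def
proof (intro allI impI)
  fix x r assume r: "(0::real) < r" "cball x r \<subseteq> U"
  hence x: "x \<in> U" by auto
  show "h x \<le> sphere_mean h x r"
  proof (rule field_le_epsilon)
    fix e :: real assume "e > 0"
    from sup[OF x this] obtain i where i: "i \<in> I" "h x - e < g i x" by blast
    have "g i x \<le> sphere_mean (g i) x r" by (rule submeanD[OF g(2)[OF i(1)] r])
    also have "\<dots> \<le> sphere_mean h x r"
      using r i by (intro sphere_mean_mono[of _ U] g h le) auto
    finally show "h x \<le> sphere_mean h x r + e" using i by simp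
  qed
qed

lemma integral_lborel_uminus:
  fixes f :: "'a::euclidean_space \<Rightarrow> real"
  assumes [measurable]: "f \<in> borel_measurable borel"
  shows "(\<integral>u. f (- u) \<partial>lborel) = (\<integral>u. f u \<partial>lborel)"
proof -
  have "distr lborel borel (uminus :: 'a \<Rightarrow> 'a) = lborel"
    using lborel_affine[of "-1" "0::'a"] by (simp add: density_1)
  hence "(\<integral>u. f u \<partial>lborel) = (\<integral>u. f u \<partial>(distr lborel borel uminus))" by simp
  also have "\<dots> = (\<integral>u. f (- u) \<partial>lborel)" by (rule integral_distr) measurable
  finally show ?thesis by simp
qed

text \<open>Antipodal points average to the centre. Pairing \<open>u\<close> with
  \<open>- u\<close>, a symmetry of Lebesgue measure, turns midpoint convexity into the mean value
  inequality.\<close>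

lemma convex_submean:
  fixes f :: "'a::euclidean_space \<Rightarrow> real"
  assumes cvx: "convex_on U f" and fU: "f \<in> Sb U"
  shows "submean U f"
  unfolding submean_def
proof (intro allI impI)
  fix x :: 'a and r :: real assume r: "0 < r" "cball x r \<subseteq> U"
  define G where "G u = indicator (ball 0 1) u * f (x + r *\<^sub>R (u /\<^sub>R norm u))" for u
  have G: "integrable lborel G" unfolding G_def using r by (intro sphere_mean_integrable[OF fU]) auto
  have Gm: "(\<integral>u. G (- u) \<partial>lborel) = integral\<^sup>L lborel G"
    by (rule integral_lborel_uminus) (use G in \<open>auto dest: borel_measurable_integrable\<close>)
  have "distr lborel borel (uminus :: 'a \<Rightarrow> 'a) = lborel"
    using lborel_affine[of "-1" "0::'a"] by (simp add: density_1)
  hence "integrable (distr lborel borel uminus) G" using G by simp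
  hence G': "integrable lborel (\<lambda>u. G (- u))" by (rule integrable_distr[rotated]) measurable
  have "f x * measure lborel (ball (0::'a) 1) = (\<integral>u. indicator (ball (0::'a) 1) u * f x \<partial>lborel)" by simp
  also have "\<dots> \<le> (\<integral>u. (G u + G (- u)) / 2 \<partial>lborel)"
  proof (rule integral_mono)
    show "integrable lborel (\<lambda>u. indicator (ball (0::'a) 1) u * f x)"
      using emeasure_lborel_ball_finite[of "0::'a" 1] by (intro integrable_mult_left) auto
    show "integrable lborel (\<lambda>u. (G u + G (- u)) / 2)" using G G' by auto
    fix u :: 'a
    define w where "w = r *\<^sub>R (u /\<^sub>R norm u)"
    have "f ((1 - 1/2) *\<^sub>R (x + w) + (1/2) *\<^sub>R (x - w)) \<le> (1 - 1/2) * f (x + w) + (1/2) * f (x - w)"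
    proof (rule convex_onD[OF cvx])
      have "x + w \<in> cball x r" "x + - w \<in> cball x r"
        using sphere_point_in_cball[of r x u] sphere_point_in_cball[of r x "- u"] r(1) unfolding w_def by auto
      thus "x + w \<in> U" "x - w \<in> U" using r(2) by auto
    qed auto
    moreover have "(1 - 1/2) *\<^sub>R (x + w) + (1/2) *\<^sub>R (x - w) = x"
      by (simp add: algebra_simps flip: scaleR_add_left)
    ultimately have "f x \<le> (f (x + w) + f (x - w)) / 2" by simp
    thus "indicator (ball 0 1) u * f x \<le> (G u + G (- u)) / 2"
      unfolding G_def w_def by (auto simp: indicator_def)
  qed
  also have "\<dots> = integral\<^sup>L lborel G" using G G' Gm by simp
  finally show "f x \<le> sphere_mean f x r"
    unfolding sphere_mean_def G_def[symmetric] using content_ball_pos[of 1 "0::'a"]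
    by (simp add: pos_le_divide_eq)
qed

section \<open>Approximation of subharmonic functions\<close>

text \<open>Convexity keeps every dilate inside \<open>Y\<close>, so unlike in a mollification no
  strip along the boundary is lost. The parameter \<open>d\<close> is both the weight of the
  displacement and the source of its price \<open>n * d\<close>: large displacements become too
  expensive for a bounded \<open>\<psi>\<close>, small ones are controlled by upper
  semicontinuity.\<close>

lemma subharmonic_sup_regularization:
  fixes Y :: "'a::euclidean_space set"
  assumes Y: "open Y" "convex Y" "bounded Y" and \<psi>: "\<psi> \<in> Sb Y" "subharmonic_on Y \<psi>"
  obtains F :: "nat \<Rightarrow> 'a \<Rightarrow> real" and B where
    "\<And>n. F n \<in> Cb Y" "\<And>n. submean Y (F n)" "\<And>n x. x \<in> Y \<Longrightarrow> \<bar>F n x\<bar> \<le> B"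
    "\<And>x. x \<in> Y \<Longrightarrow> (\<lambda>n. F n x) \<longlonglongrightarrow> \<psi> x"
proof -
  obtain B where B: "B > 0" "\<And>x. x \<in> Y \<Longrightarrow> \<bar>\<psi> x\<bar> \<le> B" using Sb_bound[OF \<psi>(1)] by blast
  have Bu: "\<psi> x \<le> B" and Bl: "- B \<le> \<psi> x" if "x \<in> Y" for x using B(2)[OF that] by auto
  obtain R where R: "R > 0" "\<And>x y. x \<in> Y \<Longrightarrow> y \<in> Y \<Longrightarrow> dist x y \<le> R"
  proof
    show "diameter Y + 1 > 0" using diameter_ge_0[OF Y(3)] by simp
    show "dist x y \<le> diameter Y + 1" if "x \<in> Y" "y \<in> Y" for x y
      using diameter_bounded_bound[OF Y(3) that] by simp
  qed
  define g where "g n = (\<lambda>(d, w) y. \<psi> ((1 - d) *\<^sub>R y + d *\<^sub>R w) - real n * d)" for n :: nat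
  \<comment> \<open>\<open>d = 0\<close> gives \<open>\<psi> \<le> F n\<close>; excluding
    \<open>d = 1\<close> keeps the dilation factor \<open>1 - d\<close> positive, as
    \<open>submean_affine\<close> requires.\<close>
  define I where "I = {0..<1::real} \<times> Y"
  define F where "F n y = (SUP p\<in>I. g n p y)" for n y
  have mem: "(1 - d) *\<^sub>R y + d *\<^sub>R w \<in> Y" if "0 \<le> d" "d \<le> 1" "y \<in> Y" "w \<in> Y" for d y w
    using convexD_alt[OF Y(2)] that by blast
  have gB: "g n p y \<le> B" if pI: "p \<in> I" and y: "y \<in> Y" for n p y
  proof -
    obtain d w where p: "p = (d, w)" "0 \<le> d" "d < 1" "w \<in> Y" using pI unfolding I_def by auto
    have "\<psi> ((1 - d) *\<^sub>R y + d *\<^sub>R w) \<le> B" using p y by (intro Bu mem) auto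
    moreover have "real n * d \<ge> 0" using p by simp
    ultimately show ?thesis unfolding g_def p(1) by simp
  qed
  have bdd: "bdd_above ((\<lambda>p. g n p y) ` I)" if "y \<in> Y" for n y
    using gB[OF _ that] by (auto intro!: bdd_aboveI2)
  have gF: "g n p y \<le> F n y" if "p \<in> I" "y \<in> Y" for n p y
    unfolding F_def by (rule cSUP_upper[OF that(1) bdd[OF that(2)]])
  have ne: "I \<noteq> {}" if "y \<in> Y" for y unfolding I_def using that by auto
  have F_le: "F n y \<le> c" if "y \<in> Y" "\<And>p. p \<in> I \<Longrightarrow> g n p y \<le> c" for n y c
    unfolding F_def by (rule cSUP_least[OF ne[OF that(1)] that(2)])
  have F_ge: "\<psi> y \<le> F n y" if "y \<in> Y" for n y
    using gF[of "(0, y)" y n] that unfolding I_def g_def by simp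
  have FB: "\<bar>F n y\<bar> \<le> B" if "y \<in> Y" for n y
    using F_ge[OF that, of n] Bl[OF that] F_le[OF that gB, of n] that by (simp add: abs_le_iff)
  \<comment> \<open>Moving by \<open>s\<close> towards \<open>w\<close> and then by \<open>d\<close>
    towards \<open>v\<close> is a single move of weight \<open>e = d + s * (1 - d)\<close> towards a
    point \<open>u\<close> between \<open>w\<close> and \<open>v\<close>. Its price exceeds that of
    \<open>d\<close> by at most \<open>n * s\<close>.\<close>
  have step: "F n ((1 - s) *\<^sub>R y + s *\<^sub>R w) \<le> F n y + real n * s"
    if y: "y \<in> Y" and w: "w \<in> Y" and s: "0 \<le> s" "s < 1" for n y w s
  proof (rule F_le)
    show "(1 - s) *\<^sub>R y + s *\<^sub>R w \<in> Y" using that by (intro mem) auto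
    fix p assume "p \<in> I"
    then obtain d v where p: "p = (d, v)" "0 \<le> d" "d < 1" "v \<in> Y" unfolding I_def by auto
    define e where "e = d + s * (1 - d)"
    have e1: "1 - e = (1 - d) * (1 - s)" unfolding e_def by (simp add: algebra_simps)
    have "1 - e > 0" unfolding e1 using p s by simp
    hence e: "0 \<le> e" "e < 1" using p s unfolding e_def by auto
    have es: "e - d \<le> s" using p s unfolding e_def by (simp add: mult_left_le)
    have "\<exists>u\<in>Y. (1 - d) *\<^sub>R ((1 - s) *\<^sub>R y + s *\<^sub>R w) + d *\<^sub>R v = (1 - e) *\<^sub>R y + e *\<^sub>R u"
    proof (cases "e = 0")
      case True
      have "d = 0" "s * (1 - d) = 0" using True p s unfolding e_def
        by (smt (verit) mult_nonneg_nonneg)+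
      hence "s = 0" by simp
      thus ?thesis using \<open>d = 0\<close> True y by auto
    next
      case False
      define u where "u = (1 - d / e) *\<^sub>R w + (d / e) *\<^sub>R v"
      have "d \<le> e" unfolding e_def using p s by simp
      hence "u \<in> Y" unfolding u_def using p w e False by (intro mem) (auto simp: divide_le_eq)
      moreover have "e * (1 - d / e) = s * (1 - d)" "e * (d / e) = d"
        using False by (simp_all add: right_diff_distrib) (simp add: e_def right_diff_distrib)
      hence "e *\<^sub>R u = (s * (1 - d)) *\<^sub>R w + d *\<^sub>R v"
        unfolding u_def scaleR_add_right scaleR_scaleR by simp
      hence "(1 - d) *\<^sub>R ((1 - s) *\<^sub>R y + s *\<^sub>R w) + d *\<^sub>R v = (1 - e) *\<^sub>R y + e *\<^sub>R u"
        unfolding e1 by (simp add: scaleR_add_right mult.commute)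
      ultimately show ?thesis by blast
    qed
    then obtain u where u: "u \<in> Y" "(1 - d) *\<^sub>R ((1 - s) *\<^sub>R y + s *\<^sub>R w) + d *\<^sub>R v = (1 - e) *\<^sub>R y + e *\<^sub>R u" by blast
    have "g n p ((1 - s) *\<^sub>R y + s *\<^sub>R w) = g n (e, u) y + real n * (e - d)"
      unfolding g_def p(1) prod.case u(2) by (simp add: right_diff_distrib)
    also have "\<dots> \<le> F n y + real n * s"
      using u e es y by (intro add_mono gF mult_left_mono) (auto simp: I_def)
    finally show "g n p ((1 - s) *\<^sub>R y + s *\<^sub>R w) \<le> F n y + real n * s" .
  qed
  have cont: "continuous_on Y (F n)" for n
    unfolding continuous_on_iff
  proof (intro ballI allI impI)
    fix y and e :: real assume y: "y \<in> Y" and e: "e > 0"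
    obtain \<rho> where \<rho>: "\<rho> > 0" "cball y \<rho> \<subseteq> Y" using Y(1) y open_contains_cball by blast
    \<comment> \<open>Inside the ball \<open>step\<close> yields the Lipschitz bound
      \<open>n / \<rho>\<close> around \<open>y\<close>; \<open>n + 1\<close> avoids a division by
      zero.\<close>
    define d where "d = min \<rho> (e * \<rho> / (real n + 1))"
    show "\<exists>d>0. \<forall>x'\<in>Y. dist x' y < d \<longrightarrow> dist (F n x') (F n y) < e"
    proof (intro exI[of _ d] conjI ballI impI)
      show "d > 0" unfolding d_def using e \<rho> by simp
      fix z assume z: "z \<in> Y" "dist z y < d"
      show "dist (F n z) (F n y) < e"
      proof (cases "z = y")
        case False
        \<comment> \<open>\<open>z\<close> arises from \<open>y\<close> by moving the fraction
          \<open>s\<close> towards a point at distance \<open>\<rho>\<close> from \<open>y\<close>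
          in the direction of \<open>z\<close>. Conversely, \<open>y\<close> arises from
          \<open>z\<close> by moving the fraction \<open>s\<close> towards a point on the opposite
          side of \<open>y\<close>, at distance \<open>(1 - s) * \<rho>\<close>. Both targets lie in
          the ball.\<close>
        define s where "s = dist z y / \<rho>"
        have s: "0 < s" "s < 1" using False z(2) \<rho>(1) unfolding s_def d_def by (auto simp: divide_simps)
        have [simp]: "s \<noteq> 0" using s by simp
        have sr: "norm (z - y) = s * \<rho>" using \<rho>(1) unfolding s_def dist_norm by simp
        have "norm ((1 / s) *\<^sub>R (z - y)) = \<rho>" using s sr by simp
        hence w1: "y + (1 / s) *\<^sub>R (z - y) \<in> Y" using \<rho> by (intro subsetD[OF \<rho>(2)]) (simp add: dist_norm)
        have "norm ((1 - 1 / s) *\<^sub>R (z - y)) = \<bar>1 - 1 / s\<bar> * (s * \<rho>)" using sr by simp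
        also have "\<dots> = (1 - s) * \<rho>" using s by (simp add: abs_if field_simps)
        also have "\<dots> \<le> \<rho>" using s \<rho>(1) by (simp add: mult_left_le_one_le)
        finally have w2: "y + (1 - 1 / s) *\<^sub>R (z - y) \<in> Y" by (intro subsetD[OF \<rho>(2)]) (simp add: dist_norm)
        have "s *\<^sub>R (y + (1 / s) *\<^sub>R (z - y)) = s *\<^sub>R y + (z - y)"
          using s(1) by (simp add: scaleR_add_right)
        hence "z = (1 - s) *\<^sub>R y + s *\<^sub>R (y + (1 / s) *\<^sub>R (z - y))" by (simp add: algebra_simps)
        hence 1: "F n z \<le> F n y + real n * s" using step[OF y w1, of s n] s by simp
        have "s * (1 - 1 / s) = s - 1" using s by (simp add: field_simps)
        hence "s *\<^sub>R (y + (1 - 1 / s) *\<^sub>R (z - y)) = s *\<^sub>R y + (s - 1) *\<^sub>R (z - y)"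
          by (simp add: scaleR_add_right)
        hence "y = (1 - s) *\<^sub>R z + s *\<^sub>R (y + (1 - 1 / s) *\<^sub>R (z - y))" by (simp add: algebra_simps)
        hence 2: "F n y \<le> F n z + real n * s" using step[OF z(1) w2, of s n] s by simp
        have "real n * s \<le> (real n + 1) * s" using s by (intro mult_right_mono) auto
        also have "\<dots> < (real n + 1) * (e / (real n + 1))"
        proof (rule mult_strict_left_mono)
          have "dist z y < e * \<rho> / (real n + 1)" using z(2) unfolding d_def by simp
          hence "dist z y / \<rho> < (e * \<rho> / (real n + 1)) / \<rho>" using \<rho>(1) by (intro divide_strict_right_mono)
          thus "s < e / (real n + 1)" unfolding s_def using \<rho>(1) by simp
        qed simp
        finally have "real n * s < e" by simp
        thus ?thesis using 1 2 by (simp add: dist_real_def abs_less_iff)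
      qed (use e in simp)
    qed
  qed
  have Cb: "F n \<in> Cb Y" for n using cont FB unfolding Cb_def bounded_iff by auto
  have Ym: "Y \<in> sets borel" using Y(1) by simp
  have sm: "submean Y (F n)" for n
  proof (rule submean_sup[of _ _ I "g n"])
    show "F n \<in> Sb Y" using Cb Cb_subset_Sb[OF Y(1)] by blast
    fix p assume "p \<in> I"
    then obtain d w where p: "p = (d, w)" "0 \<le> d" "d < 1" "w \<in> Y" unfolding I_def by auto
    have e: "g n p = (\<lambda>y. 1 * \<psi> ((1 - d) *\<^sub>R y + d *\<^sub>R w) + 1 * - (real n * d))" unfolding g_def p(1) by simp
    have "(\<lambda>y. \<psi> ((1 - d) *\<^sub>R y + d *\<^sub>R w)) \<in> Sb Y" using p mem by (intro Sb_affine[OF \<psi>(1) Ym]) auto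
    moreover have "submean Y (\<lambda>y. \<psi> ((1 - d) *\<^sub>R y + d *\<^sub>R w))"
      using \<psi>(2) p mem unfolding subharmonic_on_iff by (intro submean_affine[of Y]) auto
    ultimately show "g n p \<in> Sb Y" "submean Y (g n p)" unfolding e
      by (intro Sb_lincomb submean_lincomb Sb_const[OF Ym] submean_const; simp)+
  next
    show "\<And>i x. i \<in> I \<Longrightarrow> x \<in> Y \<Longrightarrow> g n i x \<le> F n x" by (rule gF)
    fix x and e :: real assume x: "x \<in> Y" and "e > 0"
    hence "F n x - e < F n x" by simp
    thus "\<exists>i\<in>I. F n x - e < g n i x" unfolding F_def using less_cSUP_iff[OF ne[OF x] bdd[OF x]] by blast
  qed
  have lim: "(\<lambda>n. F n y) \<longlonglongrightarrow> \<psi> y" if y: "y \<in> Y" for y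
  proof (rule LIMSEQ_I)
    fix e :: real assume "e > 0"
    hence e2: "e / 2 > 0" by simp
    have "\<forall>\<^sub>F z in at y within Y. \<psi> z < \<psi> y + e / 2"
      using \<psi>(2) y e2 unfolding subharmonic_on_def usc_on_def by blast
    then obtain \<tau> where \<tau>: "\<tau> > 0" "\<And>z. z \<in> Y \<Longrightarrow> z \<noteq> y \<Longrightarrow> dist z y < \<tau> \<Longrightarrow> \<psi> z < \<psi> y + e / 2"
      unfolding eventually_at by blast
    \<comment> \<open>From this index on, a displacement with \<open>d * R\<close> at least
      \<open>\<tau>\<close> costs \<open>n * d > 2 * B\<close>, more than \<open>\<psi>\<close> can
      gain.\<close>
    obtain N :: nat where N: "2 * B * R / \<tau> < real N" using reals_Archimedean2 by blast
    have "norm (F n y - \<psi> y) < e" if n: "n \<ge> N" for n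
    proof -
      have "F n y \<le> \<psi> y + e / 2"
      proof (rule F_le[OF y])
        fix p assume "p \<in> I"
        then obtain d w where p: "p = (d, w)" "0 \<le> d" "d < 1" "w \<in> Y" unfolding I_def by auto
        define z where "z = (1 - d) *\<^sub>R y + d *\<^sub>R w"
        have z: "z \<in> Y" unfolding z_def using p y by (intro mem) auto
        have "z - y = d *\<^sub>R (w - y)" unfolding z_def by (simp add: algebra_simps)
        hence "dist z y = d * dist w y" using p by (simp add: dist_norm)
        also have "\<dots> \<le> d * R" using p y R by (intro mult_left_mono) auto
        finally have dz: "dist z y \<le> d * R" .
        have gz: "g n p y = \<psi> z - real n * d" unfolding g_def p(1) z_def by simp
        show "g n p y \<le> \<psi> y + e / 2"
        proof (cases "d * R < \<tau>")
          case True
          have "\<psi> z \<le> \<psi> y + e / 2" using \<tau>(2)[OF z] dz True e2 by (cases "z = y") auto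
          moreover have "real n * d \<ge> 0" using p by simp
          ultimately show ?thesis using gz by simp
        next
          case False
          have "2 * B * R < real N * \<tau>" using N \<tau>(1) by (simp add: pos_divide_less_eq)
          also have "\<dots> \<le> real n * \<tau>" using n \<tau>(1) by (intro mult_right_mono) auto
          also have "\<dots> \<le> real n * (d * R)" using False by (intro mult_left_mono) auto
          finally have "2 * B < real n * d" using R(1) by (simp add: mult.assoc[symmetric])
          thus ?thesis using gz Bu[OF z] Bl[OF y] e2 by simp
        qed
      qed
      thus ?thesis using F_ge[OF y, of n] \<open>e > 0\<close> by simp
    qed
    thus "\<exists>no. \<forall>n\<ge>no. norm (F n y - \<psi> y) < e" by blast
  qed
  show ?thesis by (rule that[OF Cb sm FB lim])
qed

text \<open>The continuity up to the boundary is what makes these functions usable on compact closures.\<close>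

definition Sc :: "'a::euclidean_space set \<Rightarrow> ('a \<Rightarrow> real) set" where
  "Sc U = {f. continuous_on (closure U) f \<and> submean U f}"

lemma Sc_imp_Cb:
  assumes "f \<in> Sc U" "bounded U"
  shows "f \<in> Cb U"
proof -
  have c: "continuous_on (closure U) f" using assms unfolding Sc_def by auto
  have "compact (closure U)" using assms(2) by (simp add: compact_closure)
  hence "bounded (f ` closure U)" using c compact_continuous_image compact_imp_bounded by blast
  thus ?thesis using c closure_subset[of U] unfolding Cb_def
    by (auto intro: continuous_on_subset bounded_subset image_mono)
qed

lemma Sc_lincomb:
  assumes "f \<in> Sc U" "g \<in> Sc U" "a \<ge> 0" "b \<ge> 0" "open U" "bounded U"
  shows "(\<lambda>x. a * f x + b * g x) \<in> Sc U"
  using assms Sc_imp_Cb[OF assms(1,6)] Sc_imp_Cb[OF assms(2,6)] Cb_subset_Sb[OF assms(5)]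
  unfolding Sc_def by (auto intro!: continuous_intros submean_lincomb)

text \<open>Any positive fraction of the way from a closure point to an interior point already leads
  into the interior. This is how boundary points are brought back into the open set.\<close>

lemma convex_dilation_mem:
  fixes Y :: "'a::euclidean_space set"
  assumes "open Y" "convex Y" "a \<in> Y" "y \<in> closure Y" "0 < t" "t \<le> 1"
  shows "(1 - t) *\<^sub>R y + t *\<^sub>R a \<in> Y"
proof -
  have "y - t *\<^sub>R (y - a) \<in> interior Y"
    using assms by (intro mem_interior_closure_convex_shrink) (auto simp: interior_open)
  thus ?thesis using assms(1) by (simp add: interior_open algebra_simps)
qed

text \<open>A contraction towards \<open>a\<close> maps the closure into \<open>Y\<close>, so
  composing with it gives a function continuous up to the boundary although \<open>\<psi>\<close> is
  controlled on \<open>Y\<close> only.\<close>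

lemma subharmonic_dilation_approximation:
  fixes Y :: "'a::euclidean_space set"
  assumes Y: "open Y" "convex Y" and \<psi>: "\<psi> \<in> Cb Y" "submean Y \<psi>" and a: "a \<in> Y"
  obtains F :: "nat \<Rightarrow> 'a \<Rightarrow> real" and B where
    "\<And>n. F n \<in> Sc Y" "\<And>n x. x \<in> Y \<Longrightarrow> \<bar>F n x\<bar> \<le> B"
    "\<And>x. x \<in> Y \<Longrightarrow> (\<lambda>n. F n x) \<longlonglongrightarrow> \<psi> x"
proof -
  obtain B where B: "\<And>x. x \<in> Y \<Longrightarrow> \<bar>\<psi> x\<bar> \<le> B" using \<psi>(1) unfolding Cb_def bounded_iff by auto
  have c: "continuous_on Y \<psi>" using \<psi>(1) unfolding Cb_def by simp
  \<comment> \<open>The shift by two ensures \<open>t n < 1\<close> from the start, so the dilation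
    factor \<open>1 - t n\<close> is positive.\<close>
  define t where "t n = inverse (real (Suc (Suc n)))" for n
  have t: "0 < t n" "t n < 1" for n unfolding t_def by (auto simp: inverse_less_1_iff)
  define F where "F n y = \<psi> ((1 - t n) *\<^sub>R y + t n *\<^sub>R a)" for n y
  have mem: "(1 - t n) *\<^sub>R y + t n *\<^sub>R a \<in> Y" if "y \<in> closure Y" for n y
    using t[of n] by (intro convex_dilation_mem Y a that) auto
  have mem': "(1 - t n) *\<^sub>R y + t n *\<^sub>R a \<in> Y" if "y \<in> Y" for n y
    using mem closure_subset that by blast
  show ?thesis
  proof (rule that[of F B])
    fix n
    have "continuous_on (closure Y) (F n)" unfolding F_def
      by (rule continuous_on_compose2[OF c]) (auto intro!: continuous_intros mem)
    moreover have "submean Y (F n)" unfolding F_def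
      using t[of n] mem' by (intro submean_affine[OF \<psi>(2)]) auto
    ultimately show "F n \<in> Sc Y" unfolding Sc_def by simp
  next
    fix n x assume "x \<in> Y"
    thus "\<bar>F n x\<bar> \<le> B" unfolding F_def by (intro B mem')
  next
    fix x assume x: "x \<in> Y"
    have "t \<longlonglongrightarrow> 0" unfolding t_def using LIMSEQ_Suc[OF LIMSEQ_inverse_real_of_nat] by simp
    hence "(\<lambda>n. (1 - t n) *\<^sub>R x + t n *\<^sub>R a) \<longlonglongrightarrow> (1 - 0) *\<^sub>R x + 0 *\<^sub>R a" by (intro tendsto_intros)
    hence "(\<lambda>n. (1 - t n) *\<^sub>R x + t n *\<^sub>R a) \<longlonglongrightarrow> x" by simp
    from continuous_on_tendsto_compose[OF c this x] show "(\<lambda>n. F n x) \<longlonglongrightarrow> \<psi> x"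
      unfolding F_def using mem'[OF x] by simp
  qed
qed

section \<open>Probability measures carried by a set, and the subharmonic order between them\<close>

lemma ProbD:
  assumes "\<alpha> \<in> Prob U"
  shows "sets \<alpha> = sets borel" "prob_space \<alpha>" "emeasure \<alpha> U = 1" "space \<alpha> = UNIV"
  using assms sets_eq_imp_space_eq[of \<alpha> borel] unfolding Prob_def by auto

lemma Prob_AE:
  assumes "\<alpha> \<in> Prob U" "U \<in> sets borel"
  shows "AE x in \<alpha>. x \<in> U"
proof -
  interpret prob_space \<alpha> using ProbD[OF assms(1)] by simp
  show ?thesis using ProbD[OF assms(1)] assms(2) by (intro AE_in_set_eq_1[THEN iffD2]) (auto simp: measure_def)
qed

lemma Prob_set_integrable:
  assumes \<alpha>: "\<alpha> \<in> Prob U" and f: "f \<in> Sb U"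
  shows "set_integrable \<alpha> U f"
proof -
  interpret prob_space \<alpha> using ProbD[OF \<alpha>] by simp
  obtain B where B: "B > 0" "\<And>x. x \<in> U \<Longrightarrow> \<bar>f x\<bar> \<le> B" using Sb_bound[OF f] by blast
  show ?thesis unfolding set_integrable_def
  proof (rule integrable_const_bound[where B=B])
    show "AE x in \<alpha>. norm (indicator U x *\<^sub>R f x) \<le> B" using B by (auto simp: indicator_def)
    show "(\<lambda>x. indicator U x *\<^sub>R f x) \<in> borel_measurable \<alpha>"
      using Sb_measurable[OF f] ProbD(1)[OF \<alpha>] by (simp cong: measurable_cong_sets)
  qed
qed

lemma Prob_set_integral_tendsto:
  assumes \<alpha>: "\<alpha> \<in> Prob U" and F: "\<And>n. F n \<in> Sb U" "\<And>n x. x \<in> U \<Longrightarrow> \<bar>F n x\<bar> \<le> B"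
    and lim: "\<And>x. x \<in> U \<Longrightarrow> (\<lambda>n. F n x) \<longlonglongrightarrow> f x"
  shows "(\<lambda>n. \<integral>x\<in>U. F n x \<partial>\<alpha>) \<longlonglongrightarrow> (\<integral>x\<in>U. f x \<partial>\<alpha>)"
  unfolding set_lebesgue_integral_def
proof (rule integral_dominated_convergence[where w = "\<lambda>_. \<bar>B\<bar>"])
  interpret prob_space \<alpha> using ProbD[OF \<alpha>] by simp
  have m: "(\<lambda>x. indicator U x *\<^sub>R F n x) \<in> borel_measurable \<alpha>" for n
    using Sb_measurable[OF F(1)] ProbD(1)[OF \<alpha>] by (simp cong: measurable_cong_sets)
  have l: "(\<lambda>n. indicator U x *\<^sub>R F n x) \<longlonglongrightarrow> indicator U x *\<^sub>R f x" for x
    using lim[of x] by (cases "x \<in> U") auto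
  show "(\<lambda>x. indicator U x *\<^sub>R F n x) \<in> borel_measurable \<alpha>" for n by (rule m)
  show "(\<lambda>x. indicator U x *\<^sub>R f x) \<in> borel_measurable \<alpha>"
    by (rule borel_measurable_LIMSEQ_metric[OF m l])
  show "AE x in \<alpha>. (\<lambda>n. indicator U x *\<^sub>R F n x) \<longlonglongrightarrow> indicator U x *\<^sub>R f x" using l by simp
  show "integrable \<alpha> (\<lambda>_. \<bar>B\<bar>)" by simp
  show "AE x in \<alpha>. norm (indicator U x *\<^sub>R F n x) \<le> \<bar>B\<bar>" for n
  proof (rule AE_I2)
    fix x show "norm (indicator U x *\<^sub>R F n x) \<le> \<bar>B\<bar>"
      using F(2)[of x n] by (cases "x \<in> U") auto
  qed
qed

text \<open>The order is defined by bounded continuous tests; bounded pointwise approximation and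
  dominated convergence extend it. This is what gives the supremum over the larger class
  \<open>Sb\<close> the same upper bound.\<close>

lemma sh_le_Sb:
  fixes Y :: "'a::euclidean_space set"
  assumes Y: "open Y" "convex Y" "bounded Y" and \<alpha>: "\<alpha> \<in> Prob Y" and \<beta>: "\<beta> \<in> Prob Y"
    and le: "sh_le Y \<alpha> \<beta>" and \<psi>: "\<psi> \<in> Sb Y" "subharmonic_on Y \<psi>"
  shows "(\<integral>x\<in>Y. \<psi> x \<partial>\<alpha>) \<le> (\<integral>x\<in>Y. \<psi> x \<partial>\<beta>)"
proof -
  obtain F B where F: "\<And>n. F n \<in> Cb Y" "\<And>n. submean Y (F n)" "\<And>n x. x \<in> Y \<Longrightarrow> \<bar>F n x\<bar> \<le> B"
    "\<And>x. x \<in> Y \<Longrightarrow> (\<lambda>n. F n x) \<longlonglongrightarrow> \<psi> x"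
    using subharmonic_sup_regularization[OF Y \<psi>] by metis
  have Sb: "\<And>n. F n \<in> Sb Y" using F(1) Cb_subset_Sb[OF Y(1)] by blast
  have "subharmonic_on Y (F n)" for n
    using F(1,2) unfolding subharmonic_on_iff Cb_def by (auto intro: continuous_imp_usc_on)
  hence "(\<integral>x\<in>Y. F n x \<partial>\<alpha>) \<le> (\<integral>x\<in>Y. F n x \<partial>\<beta>)" for n
    using le F(1) unfolding sh_le_def by blast
  thus ?thesis
    using Prob_set_integral_tendsto[OF \<alpha> Sb F(3,4)] Prob_set_integral_tendsto[OF \<beta> Sb F(3,4)]
    by (intro LIMSEQ_le) auto
qed

text \<open>Measures produced on compact closures can be tested only by functions continuous up to
  the boundary; the dilation approximation shows that these tests decide the order.\<close>

lemma sh_le_iff_Sc: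
  fixes Y :: "'a::euclidean_space set"
  assumes Y: "open Y" "convex Y" "bounded Y" and \<alpha>: "\<alpha> \<in> Prob Y" and \<beta>: "\<beta> \<in> Prob Y"
    and le: "\<And>\<psi>. \<psi> \<in> Sc Y \<Longrightarrow> (\<integral>x\<in>Y. \<psi> x \<partial>\<alpha>) \<le> (\<integral>x\<in>Y. \<psi> x \<partial>\<beta>)"
  shows "sh_le Y \<alpha> \<beta>"
  unfolding sh_le_def
proof (intro allI impI)
  fix \<psi> assume "subharmonic_on Y \<psi> \<and> \<psi> \<in> Cb Y"
  hence \<psi>: "\<psi> \<in> Cb Y" "submean Y \<psi>" by (auto simp: subharmonic_on_iff)
  have "Y \<noteq> {}" using ProbD(3)[OF \<alpha>] by auto
  then obtain a where a: "a \<in> Y" by blast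
  obtain F B where F: "\<And>n. F n \<in> Sc Y" "\<And>n x. x \<in> Y \<Longrightarrow> \<bar>F n x\<bar> \<le> B"
    "\<And>x. x \<in> Y \<Longrightarrow> (\<lambda>n. F n x) \<longlonglongrightarrow> \<psi> x"
    using subharmonic_dilation_approximation[OF Y(1,2) \<psi> a] by metis
  have Sb: "\<And>n. F n \<in> Sb Y" using Sc_imp_Cb[OF F(1) Y(3)] Cb_subset_Sb[OF Y(1)] by blast
  show "(\<integral>x\<in>Y. \<psi> x \<partial>\<alpha>) \<le> (\<integral>x\<in>Y. \<psi> x \<partial>\<beta>)"
    using Prob_set_integral_tendsto[OF \<alpha> Sb F(2,3)] Prob_set_integral_tendsto[OF \<beta> Sb F(2,3)] le[OF F(1)]
    by (intro LIMSEQ_le) auto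
qed

text \<open>The indicator of a nonempty closed set is a limit of continuous cut-offs of the
  distance, and the closed sets form an intersection-stable generator.\<close>

lemma measure_eqI_continuous:
  fixes M N :: "'a::metric_space measure"
  assumes M: "prob_space M" "sets M = sets borel" and N: "prob_space N" "sets N = sets borel"
    and eq: "\<And>f. continuous_on UNIV f \<Longrightarrow> bounded (range f) \<Longrightarrow> integral\<^sup>L M f = (integral\<^sup>L N f :: real)"
  shows "M = N"
proof (rule measure_eqI_generator_eq[of "Collect closed" UNIV M N "\<lambda>_. UNIV"])
  interpret M: prob_space M by fact
  interpret N: prob_space N by fact
  show "Int_stable (Collect closed)" by (auto simp: Int_stable_def)
  have "sets borel = sigma_sets UNIV (Collect (closed :: 'a set \<Rightarrow> bool))"
    unfolding borel_eq_closed by (rule sets_measure_of) simp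
  thus "sets M = sigma_sets UNIV (Collect closed)" "sets N = sigma_sets UNIV (Collect closed)"
    using M N by auto
  show "emeasure M UNIV \<noteq> \<infinity>" by simp
  fix F :: "'a set" assume "F \<in> Collect closed"
  hence F: "closed F" by simp
  show "emeasure M F = emeasure N F"
  \<comment> \<open>For the empty set \<open>infdist\<close> is 0 by convention, and the cut-offs
    would be constantly 1.\<close>
  proof (cases "F = {}")
    case False
    define f where "f n x = max 0 (1 - real n * infdist x F)" for n x
    have fc: "continuous_on UNIV (f n)" for n unfolding f_def by (intro continuous_intros)
    have f1: "0 \<le> f n x" "f n x \<le> 1" for n x unfolding f_def using infdist_nonneg[of x F] by auto
    have fb: "bounded (range (f n))" for n
      by (rule bounded_subset[of "{0..1}"]) (use f1 in auto)
    have lim: "(\<lambda>n. f n x) \<longlonglongrightarrow> indicator F x" for x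
    proof (cases "x \<in> F")
      case True
      thus ?thesis unfolding f_def by simp
    next
      case False
      have p: "infdist x F > 0" using F \<open>F \<noteq> {}\<close> False by (intro infdist_pos_not_in_closed)
      obtain K :: nat where "1 / infdist x F < real K" using reals_Archimedean2 by blast
      hence "f n x = 0" if "n \<ge> K" for n
      proof -
        have "1 < real K * infdist x F" using \<open>1 / infdist x F < real K\<close> p by (simp add: field_simps)
        also have "\<dots> \<le> real n * infdist x F" using that p by (intro mult_right_mono) auto
        finally show ?thesis unfolding f_def by simp
      qed
      hence "\<forall>\<^sub>F n in sequentially. f n x = 0" using eventually_sequentially by blast
      thus ?thesis using False by (simp add: tendsto_eventually)
    qed
    have conv: "(\<lambda>n. integral\<^sup>L P (f n)) \<longlonglongrightarrow> measure P F" if P: "prob_space P" "sets P = sets borel" for P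
    proof -
      interpret P: prob_space P by fact
      have "(\<lambda>n. integral\<^sup>L P (f n)) \<longlonglongrightarrow> integral\<^sup>L P (indicator F :: 'a \<Rightarrow> real)"
      proof (rule integral_dominated_convergence[where w = "\<lambda>_. 1"])
        show "f n \<in> borel_measurable P" for n
          using borel_measurable_continuous_onI[OF fc] P(2) by (simp cong: measurable_cong_sets)
        show "indicator F \<in> borel_measurable P" using F P(2) by (intro borel_measurable_indicator) simp
        show "AE x in P. norm (f n x) \<le> 1" for n using f1 by simp
      qed (use lim in simp_all)
      thus ?thesis using F P(2) sets_eq_imp_space_eq[OF P(2)] by simp
    qed
    have "measure M F = measure N F"
      using conv[OF M] conv[OF N] eq[OF fc fb] by (intro LIMSEQ_unique) auto
    thus ?thesis by (simp add: M.emeasure_eq_measure N.emeasure_eq_measure)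
  qed simp
qed (auto)

text \<open>The balls in \<open>Y\<close> about \<open>x\<close> and \<open>y\<close> combine by
  convexity into a ball in \<open>Y\<close> about the weighted mean of the centres, whose radius is
  the weighted mean of the radii.\<close>

lemma infdist_compl_concave:
  fixes Y :: "'a::euclidean_space set"
  assumes Y: "open Y" "convex Y" "Y \<noteq> UNIV" and xy: "x \<in> Y" "y \<in> Y" and t: "0 \<le> t" "t \<le> 1"
  shows "(1 - t) * infdist x (- Y) + t * infdist y (- Y) \<le> infdist ((1 - t) *\<^sub>R x + t *\<^sub>R y) (- Y)"
proof -
  define z where "z = (1 - t) *\<^sub>R x + t *\<^sub>R y"
  define a where "a = infdist x (- Y)"
  define b where "b = infdist y (- Y)"
  define r where "r = (1 - t) * a + t * b"
  have ne: "- Y \<noteq> {}" using Y(3) by auto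
  have ab: "a > 0" "b > 0" unfolding a_def b_def using Y xy ne by (auto intro!: infdist_pos_not_in_closed)
  have r: "r > 0"
  proof (cases "t = 0")
    case False
    thus ?thesis unfolding r_def using ab t by (intro add_nonneg_pos) auto
  qed (use ab in \<open>simp add: r_def\<close>)
  have "r \<le> dist z v" if v: "v \<in> - Y" for v
  proof (rule ccontr)
    assume "\<not> ?thesis"
    hence d: "norm (v - z) < r" by (simp add: dist_norm norm_minus_commute)
    \<comment> \<open>A displacement \<open>v - z\<close> shorter than \<open>r\<close> is passed on
      to \<open>x\<close> and \<open>y\<close> in the proportions \<open>a / r\<close> and
      \<open>b / r\<close>. Each piece is shorter than the distance of its base point to the
      complement, and the weighted sum of the proportions is 1.\<close>
    have near: "p + (c / r) *\<^sub>R (v - z) \<in> Y" if "c = infdist p (- Y)" "c > 0" for p c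
    proof (rule ccontr)
      assume "p + (c / r) *\<^sub>R (v - z) \<notin> Y"
      hence "c \<le> dist p (p + (c / r) *\<^sub>R (v - z))" unfolding that(1) by (intro infdist_le) simp
      also have "\<dots> = (c / r) * norm (v - z)" using that r by (simp add: dist_norm)
      also have "\<dots> < (c / r) * r" using that r d by (intro mult_strict_left_mono) auto
      finally show False using r by simp
    qed
    have "(1 - t) *\<^sub>R (x + (a / r) *\<^sub>R (v - z)) + t *\<^sub>R (y + (b / r) *\<^sub>R (v - z)) \<in> Y"
      using convexD_alt[OF Y(2) near[OF a_def ab(1)] near[OF b_def ab(2)] t] .
    also have "(1 - t) *\<^sub>R (x + (a / r) *\<^sub>R (v - z)) + t *\<^sub>R (y + (b / r) *\<^sub>R (v - z)) =
        z + ((1 - t) * (a / r) + t * (b / r)) *\<^sub>R (v - z)"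
      unfolding z_def by (simp add: algebra_simps)
    also have "(1 - t) * (a / r) + t * (b / r) = 1"
      using r unfolding r_def by (simp add: add_divide_distrib[symmetric])
    finally show False using v by simp
  qed
  hence "r \<le> infdist z (- Y)" unfolding infdist_notempty[OF ne] by (intro cINF_greatest[OF ne])
  thus ?thesis unfolding r_def a_def b_def z_def .
qed

text \<open>Concavity of the boundary distance makes the cut-off convex on \<open>Y\<close>, so
  \<open>convex_submean\<close> applies. The function is 1 off \<open>Y\<close> and tends to 0 on
  \<open>Y\<close> as \<open>k\<close> grows.\<close>

lemma boundary_barrier_Sc:
  fixes Y :: "'a::euclidean_space set"
  assumes Y: "open Y" "convex Y" "Y \<noteq> UNIV" and k: "k \<ge> 0"
  shows "(\<lambda>x. max 0 (1 - k * infdist x (- Y))) \<in> Sc Y"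
proof -
  define f where "f x = max 0 (1 - k * infdist x (- Y))" for x
  have c: "continuous_on UNIV f" unfolding f_def by (intro continuous_intros)
  have "convex_on Y f"
  proof (rule convex_onI[OF _ Y(2)])
    fix t :: real and x y assume t: "0 < t" "t < 1" and xy: "x \<in> Y" "y \<in> Y"
    define z where "z = (1 - t) *\<^sub>R x + t *\<^sub>R y"
    have "k * ((1 - t) * infdist x (- Y) + t * infdist y (- Y)) \<le> k * infdist z (- Y)"
      unfolding z_def using k t infdist_compl_concave[OF Y xy] by (intro mult_left_mono) auto
    hence "1 - k * infdist z (- Y) \<le> (1 - t) * (1 - k * infdist x (- Y)) + t * (1 - k * infdist y (- Y))"
      by (simp add: algebra_simps)
    also have "\<dots> \<le> (1 - t) * f x + t * f y"
      using t unfolding f_def by (intro add_mono mult_left_mono) auto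
    finally have "1 - k * infdist z (- Y) \<le> (1 - t) * f x + t * f y" .
    moreover have "0 \<le> (1 - t) * f x + t * f y" using t unfolding f_def by simp
    ultimately show "f ((1 - t) *\<^sub>R x + t *\<^sub>R y) \<le> (1 - t) * f x + t * f y"
      unfolding z_def[symmetric] f_def[of z] by simp
  qed
  moreover have "f \<in> Sb Y"
  proof (rule SbI[of _ _ 1])
    show "(\<lambda>x. indicator Y x * f x) \<in> borel_measurable borel"
      using Y(1) by (intro borel_measurable_times borel_measurable_indicator borel_measurable_continuous_onI[OF c]) simp
    show "\<bar>f x\<bar> \<le> 1" for x unfolding f_def using k infdist_nonneg[of x "- Y"] by (simp add: abs_le_iff)
  qed
  ultimately have "submean Y f" by (rule convex_submean)
  thus ?thesis using c unfolding Sc_def f_def[symmetric] by (auto intro: continuous_on_subset)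
qed

section \<open>Transport cost and weak duality\<close>

lemma continuous_on_compact_Sb:
  fixes f :: "'a::euclidean_space \<Rightarrow> real"
  assumes "compact K" "continuous_on K f"
  shows "f \<in> Sb K"
  using assms borel_measurable_continuous_on_indicator[OF borel_compact, of K f]
    compact_imp_bounded[OF compact_continuous_image[OF assms(2,1)]]
  unfolding Sb_def set_borel_measurable_def by auto

text \<open>Joins separation and representation: continuity on the compact \<open>K\<close> supplies
  the boundedness needed for the functional and the integral formula for the measure.\<close>

lemma probability_measure_of_convex_family:
  fixes K :: "'b::euclidean_space set" and \<G> :: "('b \<Rightarrow> real) set"
  assumes K: "compact K" and ne: "\<G> \<noteq> {}"
    and cvx: "\<And>F G u. F \<in> \<G> \<Longrightarrow> G \<in> \<G> \<Longrightarrow> 0 \<le> u \<Longrightarrow> u \<le> 1 \<Longrightarrow>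
                (\<lambda>x. u * F x + (1 - u) * G x) \<in> \<G>"
    and cont: "\<And>G. G \<in> \<G> \<Longrightarrow> continuous_on K G"
    and np: "\<And>G. G \<in> \<G> \<Longrightarrow> \<exists>x\<in>K. G x \<le> 0"
  obtains M where "M \<in> Prob K" "\<And>G. G \<in> \<G> \<Longrightarrow> (\<integral>x\<in>K. G x \<partial>M) \<le> 0"
proof -
  have np': "\<And>G e. G \<in> \<G> \<Longrightarrow> e > 0 \<Longrightarrow> \<exists>x\<in>K. G x < e" using np by (meson le_less_trans)
  have bd: "\<And>G. G \<in> \<G> \<Longrightarrow> bounded (G ` K)"
    using compact_imp_bounded[OF compact_continuous_image[OF cont K]] .
  show ?thesis
  proof (rule positive_functional[of \<G> K, OF ne cvx np' bd])
    fix L :: "('b \<Rightarrow> real) \<Rightarrow> real"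
    assume L: "\<And>f g. bounded (f ` K) \<Longrightarrow> bounded (g ` K) \<Longrightarrow> L (\<lambda>x. f x + g x) = L f + L g"
      "\<And>f c. bounded (f ` K) \<Longrightarrow> L (\<lambda>x. c * f x) = c * L f"
      "\<And>f g. bounded (f ` K) \<Longrightarrow> bounded (g ` K) \<Longrightarrow> (\<And>x. x \<in> K \<Longrightarrow> f x \<le> g x) \<Longrightarrow> L f \<le> L g"
      "L (\<lambda>x. 1) = 1" and LG: "\<And>G. G \<in> \<G> \<Longrightarrow> L G \<le> 0"
    show thesis
    proof (rule measure_of_positive_functional[OF K L])
      fix M :: "'b measure"
      assume M: "sets M = sets borel" "prob_space M" "emeasure M K = 1"
        "\<And>f. continuous_on K f \<Longrightarrow> (\<integral>x\<in>K. f x \<partial>M) = L f"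
      show thesis
        by (rule that[of M]) (use M LG cont in \<open>auto simp: Prob_def\<close>)
    qed
  qed
qed

section \<open>Integrals, image measures and couplings\<close>

lemma Prob_integral_mono:
  assumes "\<alpha> \<in> Prob U" "f \<in> Sb U" "g \<in> Sb U" "\<And>x. x \<in> U \<Longrightarrow> f x \<le> g x"
  shows "(\<integral>x\<in>U. f x \<partial>\<alpha>) \<le> (\<integral>x\<in>U. g x \<partial>\<alpha>)"
  using assms by (intro set_integral_mono Prob_set_integrable)

lemma Prob_integral_lincomb:
  assumes "\<alpha> \<in> Prob U" "f \<in> Sb U" "g \<in> Sb U"
  shows "(\<integral>x\<in>U. a * f x + b * g x \<partial>\<alpha>) = a * (\<integral>x\<in>U. f x \<partial>\<alpha>) + b * (\<integral>x\<in>U. g x \<partial>\<alpha>)"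
  using Prob_set_integrable[OF assms(1,2)] Prob_set_integrable[OF assms(1,3)]
  by (subst set_integral_add) (auto intro: set_integrable_mult_right)

lemma Prob_integral_const:
  assumes \<alpha>: "\<alpha> \<in> Prob U" and U: "U \<in> sets borel"
  shows "(\<integral>x\<in>U. c \<partial>\<alpha>) = (c :: real)"
  using ProbD[OF \<alpha>] U by (subst set_integral_const) (auto simp: measure_def)

lemma Prob_integral_affine:
  assumes \<alpha>: "\<alpha> \<in> Prob U" and f: "f \<in> Sb U" and U: "U \<in> sets borel"
  shows "(\<integral>x\<in>U. f x + c \<partial>\<alpha>) = (\<integral>x\<in>U. f x \<partial>\<alpha>) + c"
  using Prob_integral_lincomb[OF \<alpha> f Sb_const[OF U, of c], of 1 1] Prob_integral_const[OF \<alpha> U] by simp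

lemma Prob_integral_eq_integral:
  assumes \<alpha>: "\<alpha> \<in> Prob U" and U: "U \<in> sets borel" and h: "h \<in> borel_measurable borel"
  shows "(\<integral>x\<in>U. h x \<partial>\<alpha>) = (integral\<^sup>L \<alpha> h :: real)"
  unfolding set_lebesgue_integral_def
proof (rule integral_cong_AE)
  show "h \<in> borel_measurable \<alpha>" using h ProbD(1)[OF \<alpha>] by (simp cong: measurable_cong_sets)
  have "(\<lambda>x. indicator U x *\<^sub>R h x) \<in> borel_measurable borel"
    using U h by (intro borel_measurable_scaleR borel_measurable_indicator)
  thus "(\<lambda>x. indicator U x *\<^sub>R h x) \<in> borel_measurable \<alpha>"
    using ProbD(1)[OF \<alpha>] by (simp cong: measurable_cong_sets)
  show "AE x in \<alpha>. indicator U x *\<^sub>R h x = h x" using Prob_AE[OF \<alpha> U] by eventually_elim simp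
qed

lemma Prob_measurable:
  "\<alpha> \<in> Prob U \<Longrightarrow> p \<in> borel_measurable borel \<Longrightarrow> p \<in> borel_measurable \<alpha>"
  using ProbD(1)[of \<alpha> U] by (simp cong: measurable_cong_sets)

lemma Prob_distr:
  assumes M: "M \<in> Prob K" and p: "p \<in> borel_measurable borel" and U: "U \<in> sets borel"
    and AE: "AE z in M. p z \<in> U"
  shows "distr M borel p \<in> Prob U"
proof -
  interpret prob_space M using ProbD[OF M] by simp
  have pM: "p \<in> borel_measurable M" by (rule Prob_measurable[OF M p])
  interpret D: prob_space "distr M borel p" by (rule prob_space_distr[OF pM])
  have "AE x in distr M borel p. x \<in> U" using AE U by (subst AE_distr_iff[OF pM]) auto
  hence "emeasure (distr M borel p) U = 1"
    using U by (subst D.emeasure_eq_1_AE) auto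
  thus ?thesis unfolding Prob_def using D.prob_space_axioms by simp
qed

text \<open>\<open>f\<close> is controlled only on \<open>U\<close> and \<open>h\<close> only on
  \<open>K\<close>. Both sets have full measure, so agreement of \<open>h\<close> with
  \<open>f\<close> after \<open>p\<close> is required only where both make sense; this lets test
  functions live on the closure while the image measure lives on the open set.\<close>

lemma Prob_integral_distr:
  assumes M: "M \<in> Prob K" "K \<in> sets borel" and p: "p \<in> borel_measurable borel"
    and D: "distr M borel p \<in> Prob U" "U \<in> sets borel" and f: "f \<in> Sb U" and h: "h \<in> Sb K"
    and eq: "\<And>z. z \<in> K \<Longrightarrow> p z \<in> U \<Longrightarrow> h z = f (p z)"
  shows "(\<integral>x\<in>U. f x \<partial>(distr M borel p)) = (\<integral>z\<in>K. h z \<partial>M)"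
proof -
  have pM: "p \<in> borel_measurable M" by (rule Prob_measurable[OF M(1) p])
  have fm: "(\<lambda>x. indicator U x *\<^sub>R f x) \<in> borel_measurable borel" using Sb_measurable[OF f] by simp
  have AE: "AE z in M. p z \<in> U"
    using Prob_AE[OF D] D(2) by (subst (asm) AE_distr_iff[OF pM]) auto
  have "(\<integral>x\<in>U. f x \<partial>(distr M borel p)) = (\<integral>z. indicator U (p z) *\<^sub>R f (p z) \<partial>M)"
    unfolding set_lebesgue_integral_def by (rule integral_distr[OF pM fm])
  also have "\<dots> = (\<integral>z. indicator K z *\<^sub>R h z \<partial>M)"
  proof (rule integral_cong_AE)
    show "(\<lambda>z. indicator U (p z) *\<^sub>R f (p z)) \<in> borel_measurable M"
      by (rule measurable_compose[OF pM fm])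
    have "(\<lambda>z. indicator K z *\<^sub>R h z) \<in> borel_measurable borel" using Sb_measurable[OF h] by simp
    thus "(\<lambda>z. indicator K z *\<^sub>R h z) \<in> borel_measurable M" by (rule Prob_measurable[OF M(1)])
    show "AE z in M. indicator U (p z) *\<^sub>R f (p z) = indicator K z *\<^sub>R h z"
      using AE Prob_AE[OF M] by eventually_elim (simp add: eq)
  qed
  finally show ?thesis unfolding set_lebesgue_integral_def .
qed

lemma distr_eq_if_continuous_integrals_eq:
  fixes p :: "'b::euclidean_space \<Rightarrow> 'a::euclidean_space"
  assumes M: "M \<in> Prob K" "K \<in> sets borel" and p: "p \<in> borel_measurable borel"
    and \<mu>: "prob_space \<mu>" "sets \<mu> = sets borel"
    and eq: "\<And>a. a \<in> Cb UNIV \<Longrightarrow> (\<integral>z\<in>K. a (p z) \<partial>M) = (\<integral>x. a x \<partial>\<mu>)"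
  shows "distr M borel p = \<mu>"
proof (rule measure_eqI_continuous)
  interpret prob_space M using ProbD[OF M(1)] by simp
  have pM: "p \<in> borel_measurable M" by (rule Prob_measurable[OF M(1) p])
  show "prob_space (distr M borel p)" by (rule prob_space_distr[OF pM])
  fix a :: "'a \<Rightarrow> real" assume a: "continuous_on UNIV a" "bounded (range a)"
  have am: "a \<in> borel_measurable borel" by (rule borel_measurable_continuous_onI[OF a(1)])
  have "(\<integral>x. a x \<partial>(distr M borel p)) = (\<integral>z. a (p z) \<partial>M)" by (rule integral_distr[OF pM am])
  also have "\<dots> = (\<integral>z\<in>K. a (p z) \<partial>M)"
    using measurable_compose[OF p am] by (intro Prob_integral_eq_integral[OF M, symmetric])
  finally show "(\<integral>x. a x \<partial>(distr M borel p)) = (\<integral>x. a x \<partial>\<mu>)" using eq[of a] a by (simp add: Cb_def)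
qed (use \<mu> in auto)

text \<open>The law of the pair \<open>(p, q)\<close> under \<open>M\<close> is a coupling of the
  two image measures.\<close>

lemma T2_le_integral:
  fixes p q :: "'b::euclidean_space \<Rightarrow> 'a::euclidean_space"
  assumes M: "M \<in> Prob K" and [measurable]: "p \<in> borel_measurable borel" "q \<in> borel_measurable borel"
  shows "T2 (distr M borel p) (distr M borel q) \<le> (\<integral>z. (norm (p z - q z))\<^sup>2 \<partial>M)"
proof -
  interpret prob_space M using ProbD[OF M] by simp
  have pM[measurable]: "p \<in> borel_measurable M" "q \<in> borel_measurable M" by (rule Prob_measurable[OF M]; fact)+
  define \<pi> where "\<pi> = distr M (borel \<Otimes>\<^sub>M borel) (\<lambda>z. (p z, q z))"
  have m: "(\<lambda>z. (p z, q z)) \<in> M \<rightarrow>\<^sub>M (borel \<Otimes>\<^sub>M borel)" by measurable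
  have "\<pi> \<in> couplings (distr M borel p) (distr M borel q)"
    unfolding couplings_def \<pi>_def using m
    by (auto simp: distr_distr comp_def intro!: prob_space_distr)
  hence "T2 (distr M borel p) (distr M borel q) \<le> (\<integral>z. (norm (fst z - snd z))\<^sup>2 \<partial>\<pi>)"
    unfolding T2_def by (intro cINF_lower) (auto intro!: bdd_belowI2[of _ 0] integral_nonneg_AE)
  also have "\<dots> = (\<integral>z. (norm (p z - q z))\<^sup>2 \<partial>M)"
    unfolding \<pi>_def by (subst integral_distr[OF m]) auto
  finally show ?thesis .
qed

text \<open>A real infimum over the empty set says nothing, so lower bounds for \<open>T2\<close>
  need some coupling; the product measure is one.\<close>

lemma couplings_nonempty:
  fixes \<alpha> \<beta> :: "'a::euclidean_space measure"
  assumes \<alpha>: "prob_space \<alpha>" "sets \<alpha> = sets borel" and \<beta>: "prob_space \<beta>" "sets \<beta> = sets borel"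
  shows "couplings \<alpha> \<beta> \<noteq> {}"
proof -
  interpret A: prob_space \<alpha> by fact
  interpret B: prob_space \<beta> by fact
  interpret P: pair_prob_space \<alpha> \<beta> ..
  have "distr (\<alpha> \<Otimes>\<^sub>M \<beta>) borel fst = distr (\<alpha> \<Otimes>\<^sub>M \<beta>) \<alpha> fst" by (rule distr_cong) (use \<alpha> in auto)
  also have "\<dots> = \<alpha>" by (rule B.distr_pair_fst)
  finally have 1: "distr (\<alpha> \<Otimes>\<^sub>M \<beta>) borel fst = \<alpha>" .
  have "distr (\<alpha> \<Otimes>\<^sub>M \<beta>) borel snd = distr (\<alpha> \<Otimes>\<^sub>M \<beta>) \<beta> snd" by (rule distr_cong) (use \<beta> in auto)
  also have "\<dots> = \<beta>"
  proof (rule measure_eqI)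
    fix A assume "A \<in> sets (distr (\<alpha> \<Otimes>\<^sub>M \<beta>) \<beta> snd)"
    hence A: "A \<in> sets \<beta>" by simp
    hence "emeasure (distr (\<alpha> \<Otimes>\<^sub>M \<beta>) \<beta> snd) A = emeasure (\<alpha> \<Otimes>\<^sub>M \<beta>) (space \<alpha> \<times> A)"
      by (subst emeasure_distr) (auto simp: space_pair_measure dest: sets.sets_into_space intro!: arg_cong[where f="emeasure _"])
    also have "\<dots> = emeasure \<beta> A" using A by (subst B.emeasure_pair_measure_Times) (auto simp: A.emeasure_space_1)
    finally show "emeasure (distr (\<alpha> \<Otimes>\<^sub>M \<beta>) \<beta> snd) A = emeasure \<beta> A" .
  qed simp
  finally have 2: "distr (\<alpha> \<Otimes>\<^sub>M \<beta>) borel snd = \<beta>" .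
  have "sets (\<alpha> \<Otimes>\<^sub>M \<beta>) = sets (borel \<Otimes>\<^sub>M borel)" by (rule sets_pair_measure_cong[OF \<alpha>(2) \<beta>(2)])
  hence "\<alpha> \<Otimes>\<^sub>M \<beta> \<in> couplings \<alpha> \<beta>" unfolding couplings_def using 1 2 P.prob_space_axioms by simp
  thus ?thesis by blast
qed

text \<open>The easy half of Kantorovich duality: the pointwise inequality is integrated against any
  coupling. It is available on \<open>X \<times> Y\<close> only, which carries the coupling, so
  truncations by indicators stand in for \<open>f\<close> and \<open>g\<close>.\<close>

lemma T2_weak_duality:
  fixes X Y :: "'a::euclidean_space set"
  assumes X: "X \<in> sets borel" "bounded X" and Y: "Y \<in> sets borel" "bounded Y"
    and \<alpha>: "\<alpha> \<in> Prob X" and \<beta>: "\<beta> \<in> Prob Y" and f: "f \<in> Sb X" and g: "g \<in> Sb Y"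
    and le: "\<And>x y. x \<in> X \<Longrightarrow> y \<in> Y \<Longrightarrow> f x - g y \<le> (norm (x - y))\<^sup>2"
  shows "(\<integral>x\<in>X. f x \<partial>\<alpha>) - (\<integral>y\<in>Y. g y \<partial>\<beta>) \<le> T2 \<alpha> \<beta>"
  unfolding T2_def
proof (rule cINF_greatest)
  show "couplings \<alpha> \<beta> \<noteq> {}" using ProbD[OF \<alpha>] ProbD[OF \<beta>] by (intro couplings_nonempty)
  fix \<pi> assume "\<pi> \<in> couplings \<alpha> \<beta>"
  hence s: "sets \<pi> = sets (borel \<Otimes>\<^sub>M borel)" and "prob_space \<pi>"
    and d: "distr \<pi> borel fst = \<alpha>" "distr \<pi> borel snd = \<beta>" unfolding couplings_def by auto
  interpret prob_space \<pi> by fact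
  have m: "fst \<in> \<pi> \<rightarrow>\<^sub>M borel" "snd \<in> \<pi> \<rightarrow>\<^sub>M borel"
    using measurable_cong_sets[OF s refl, of borel] measurable_cong_sets[OF s refl, of borel] by auto
  note [measurable] = m
  have 1: "AE z in \<pi>. fst z \<in> X"
    using Prob_AE[OF \<alpha> X(1)] X(1) unfolding d(1)[symmetric] by (subst (asm) AE_distr_iff) auto
  have 2: "AE z in \<pi>. snd z \<in> Y"
    using Prob_AE[OF \<beta> Y(1)] Y(1) unfolding d(2)[symmetric] by (subst (asm) AE_distr_iff) auto
  obtain F where F: "F > 0" "\<And>x. x \<in> X \<Longrightarrow> \<bar>f x\<bar> \<le> F" using Sb_bound[OF f] by blast
  obtain G where G: "G > 0" "\<And>x. x \<in> Y \<Longrightarrow> \<bar>g x\<bar> \<le> G" using Sb_bound[OF g] by blast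
  obtain RX where RX: "\<And>x. x \<in> X \<Longrightarrow> norm x \<le> RX" using X(2) unfolding bounded_iff by auto
  obtain RY where RY: "\<And>x. x \<in> Y \<Longrightarrow> norm x \<le> RY" using Y(2) unfolding bounded_iff by auto
  define f' where "f' x = indicator X x * f x" for x
  define g' where "g' x = indicator Y x * g x" for x
  have f'm: "f' \<in> borel_measurable borel" and g'm: "g' \<in> borel_measurable borel"
    unfolding f'_def g'_def by (rule Sb_measurable[OF f] Sb_measurable[OF g])+
  have bd: "\<bar>f' x\<bar> \<le> F" "\<bar>g' x\<bar> \<le> G" for x
    using F G unfolding f'_def g'_def by (auto simp: indicator_def)
  have fi: "integrable \<pi> (\<lambda>z. f' (fst z))"
    by (rule integrable_const_bound[where B=F]) (use bd measurable_compose[OF m(1) f'm] in auto)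
  have gi: "integrable \<pi> (\<lambda>z. g' (snd z))"
    by (rule integrable_const_bound[where B=G]) (use bd measurable_compose[OF m(2) g'm] in auto)
  have ci: "integrable \<pi> (\<lambda>z. (norm (fst z - snd z))\<^sup>2)"
  proof (rule integrable_const_bound[where B="(RX + RY)\<^sup>2"])
    show "AE z in \<pi>. norm ((norm (fst z - snd z))\<^sup>2) \<le> (RX + RY)\<^sup>2"
      using 1 2
    proof eventually_elim
      case (elim z)
      have "norm (fst z - snd z) \<le> RX + RY"
        using norm_triangle_ineq4[of "fst z" "snd z"] RX[OF elim(1)] RY[OF elim(2)] by linarith
      hence "(norm (fst z - snd z))\<^sup>2 \<le> (RX + RY)\<^sup>2" by (intro power_mono) auto
      thus ?case by simp
    qed
  qed measurable
  have "(\<integral>x\<in>X. f x \<partial>\<alpha>) = (\<integral>z. f' (fst z) \<partial>\<pi>)"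
    unfolding d(1)[symmetric] set_lebesgue_integral_def using integral_distr[OF m(1) f'm]
    by (simp add: f'_def[abs_def])
  moreover have "(\<integral>y\<in>Y. g y \<partial>\<beta>) = (\<integral>z. g' (snd z) \<partial>\<pi>)"
    unfolding d(2)[symmetric] set_lebesgue_integral_def using integral_distr[OF m(2) g'm]
    by (simp add: g'_def[abs_def])
  moreover have "(\<integral>z. f' (fst z) - g' (snd z) \<partial>\<pi>) \<le> (\<integral>z. (norm (fst z - snd z))\<^sup>2 \<partial>\<pi>)"
  proof (rule integral_mono_AE[OF Bochner_Integration.integrable_diff[OF fi gi] ci])
    show "AE z in \<pi>. f' (fst z) - g' (snd z) \<le> (norm (fst z - snd z))\<^sup>2"
      using 1 2 by eventually_elim (simp add: f'_def g'_def le)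
  qed
  ultimately show "(\<integral>x\<in>X. f x \<partial>\<alpha>) - (\<integral>y\<in>Y. g y \<partial>\<beta>) \<le> (\<integral>z. (norm (fst z - snd z))\<^sup>2 \<partial>\<pi>)"
    using fi gi by simp
qed

section \<open>Infimal and supremal convolution with the quadratic cost\<close>

lemma Q2_lower:
  assumes "\<psi> \<in> Sb Y" "y \<in> Y"
  shows "Q2 Y \<psi> x \<le> \<psi> y + (norm (x - y))\<^sup>2"
proof -
  obtain B where B: "\<And>y. y \<in> Y \<Longrightarrow> \<bar>\<psi> y\<bar> \<le> B" using Sb_bound[OF assms(1)] by blast
  have "- B \<le> \<psi> z + (norm (x - z))\<^sup>2" if "z \<in> Y" for z
    using B[OF that] zero_le_power2[of "norm (x - z)"] by linarith
  thus ?thesis unfolding Q2_def using assms(2)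
    by (intro cINF_lower bdd_belowI2[of _ "- B"])
qed

lemma Q2_greatest:
  assumes "Y \<noteq> {}" "\<And>y. y \<in> Y \<Longrightarrow> c \<le> \<psi> y + (norm (x - y))\<^sup>2"
  shows "c \<le> Q2 Y \<psi> x"
  unfolding Q2_def using assms by (rule cINF_greatest)

text \<open>A strict sublevel set of the transform is a union over \<open>y\<close> of sets open in
  \<open>x\<close>. Hence the infimum over uncountably many \<open>y\<close> is Borel, whatever the
  regularity of \<open>\<psi>\<close>.\<close>

lemma Q2_Sb:
  fixes X Y :: "'a::euclidean_space set"
  assumes X: "X \<in> sets borel" "bounded X" and Y: "Y \<noteq> {}" and \<psi>: "\<psi> \<in> Sb Y"
  shows "Q2 Y \<psi> \<in> Sb X"
proof -
  obtain B where B: "\<And>y. y \<in> Y \<Longrightarrow> \<bar>\<psi> y\<bar> \<le> B" using Sb_bound[OF \<psi>] by blast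
  have lb: "- B \<le> \<psi> y + (norm (x - y))\<^sup>2" if "y \<in> Y" for x y
    using B[OF that] zero_le_power2[of "norm (x - y)"] by linarith
  have "Q2 Y \<psi> \<in> borel_measurable borel"
  proof (rule borel_measurableI_less)
    fix c
    have bd: "bdd_below ((\<lambda>y. \<psi> y + (norm (x - y))\<^sup>2) ` Y)" for x by (intro bdd_belowI2[of _ "- B"] lb)
    have "{x \<in> space borel. Q2 Y \<psi> x < c} = (\<Union>y\<in>Y. {x. \<psi> y + (norm (x - y))\<^sup>2 < c})"
      unfolding Q2_def using cINF_less_iff[OF Y bd] by auto
    moreover have "open (\<Union>y\<in>Y. {x. \<psi> y + (norm (x - y))\<^sup>2 < c})"
      by (intro open_UN ballI open_Collect_less continuous_intros)
    ultimately show "{x \<in> space borel. Q2 Y \<psi> x < c} \<in> sets borel" by simp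
  qed
  moreover obtain y where y: "y \<in> Y" using Y by blast
  obtain R where R: "\<And>x. x \<in> X \<Longrightarrow> norm x \<le> R" using X(2) unfolding bounded_iff by auto
  have "\<bar>Q2 Y \<psi> x\<bar> \<le> B + (R + norm y)\<^sup>2" if x: "x \<in> X" for x
  proof -
    have "norm (x - y) \<le> R + norm y" using norm_triangle_ineq4[of x y] R[OF x] by linarith
    hence "(norm (x - y))\<^sup>2 \<le> (R + norm y)\<^sup>2" by (intro power_mono) auto
    hence "Q2 Y \<psi> x \<le> B + (R + norm y)\<^sup>2" using Q2_lower[OF \<psi> y, of x] B[OF y] by linarith
    moreover have "- B \<le> Q2 Y \<psi> x" by (rule Q2_greatest[OF Y lb])
    ultimately show ?thesis using zero_le_power2[of "R + norm y"] unfolding abs_le_iff by linarith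
  qed
  ultimately show ?thesis using X(1) by (intro SbI[of _ _ "B + (R + norm y)\<^sup>2"]) auto
qed

text \<open>Through this sign change, bounds and measurability of the second transform come from
  those of the first.\<close>

lemma Q2bar_eq_Q2: "Q2bar X \<psi> y = - Q2 X (\<lambda>x. - \<psi> x) y"
  unfolding Q2bar_def Q2_def Inf_real_def by (simp add: image_image norm_minus_commute)

lemma Sb_uminus: "f \<in> Sb U \<Longrightarrow> (\<lambda>x. - f x) \<in> Sb U"
  using Sb_lincomb[of f U f "-1" 0] by simp

lemma Q2bar_Sb:
  fixes X Y :: "'a::euclidean_space set"
  assumes "Y \<in> sets borel" "bounded Y" "X \<noteq> {}" "\<psi> \<in> Sb X"
  shows "Q2bar X \<psi> \<in> Sb Y"
  unfolding Q2bar_eq_Q2[abs_def] using assms by (intro Sb_uminus Q2_Sb)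

lemma Q2bar_upper: "\<psi> \<in> Sb X \<Longrightarrow> x \<in> X \<Longrightarrow> \<psi> x - (norm (x - y))\<^sup>2 \<le> Q2bar X \<psi> y"
  using Q2_lower[OF Sb_uminus, of \<psi> X x y] unfolding Q2bar_eq_Q2 by (simp add: norm_minus_commute)

lemma Q2bar_least:
  assumes "X \<noteq> {}" "\<And>x. x \<in> X \<Longrightarrow> \<psi> x - (norm (x - y))\<^sup>2 \<le> c"
  shows "Q2bar X \<psi> y \<le> c"
  unfolding Q2bar_def using assms by (rule cSUP_least)

section \<open>Duality for the forward projection\<close>

text \<open>Used to isolate one constraint: its potential is scaled by ever larger \<open>t\<close>
  while the total stays bounded.\<close>

lemma bounded_ray_imp_nonpos:
  fixes C P D :: real
  assumes "\<And>t. t \<ge> 0 \<Longrightarrow> C + t * P \<le> D"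
  shows "P \<le> 0"
proof (rule ccontr)
  assume "\<not> P \<le> 0"
  hence P: "P > 0" by simp
  define t where "t = (\<bar>D - C\<bar> + 1) / P"
  have "C + t * P \<le> D" using P by (intro assms) (simp add: t_def)
  thus False using P unfolding t_def by simp
qed

lemma Cb_UNIV_lincomb:
  assumes "f \<in> Cb UNIV" "g \<in> Cb UNIV"
  shows "(\<lambda>x. a * f x + b * g x) \<in> Cb UNIV"
proof -
  have "bounded ((\<lambda>x. a *\<^sub>R f x + b *\<^sub>R g x) ` UNIV)"
    using assms unfolding Cb_def by (intro bounded_plus_comp bounded_scaleR_comp) auto
  thus ?thesis using assms unfolding Cb_def by (auto intro!: continuous_intros)
qed

lemma Cb_UNIV_Sb:
  assumes "f \<in> Cb UNIV" "U \<in> sets borel"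
  shows "f \<in> Sb U"
proof -
  obtain B where B: "\<And>x. \<bar>f x\<bar> \<le> B" using assms(1) unfolding Cb_def bounded_iff by auto
  show ?thesis
    using assms(1) B borel_measurable_continuous_onI[of f] unfolding Cb_def
    by (intro SbI[of _ _ B] borel_measurable_times borel_measurable_indicator assms(2)) auto
qed

lemma Prob_integral_Cb:
  assumes "\<alpha> \<in> Prob U" "U \<in> sets borel" "a \<in> Cb UNIV"
  shows "(\<integral>x\<in>U. a x \<partial>\<alpha>) = integral\<^sup>L \<alpha> a"
  using assms by (intro Prob_integral_eq_integral borel_measurable_continuous_onI) (auto simp: Cb_def)

lemma zero_Sc: "(\<lambda>x. 0) \<in> Sc U"
  unfolding Sc_def using submean_const by (auto intro: continuous_intros)

lemma zero_Cb: "(\<lambda>x. 0) \<in> Cb U"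
  unfolding Cb_def by (auto intro: continuous_intros simp: bounded_iff)

text \<open>The barrier is 1 off \<open>Y\<close>, so its integral dominates the \<eta>-mass of the
  complement, while its integral against \<nu> tends to 0 because \<nu> is carried by the open set
  \<open>Y\<close>.\<close>

lemma tight_imp_Prob:
  fixes Y :: "'a::euclidean_space set"
  assumes Y: "open Y" "Y \<noteq> UNIV" and \<eta>: "\<eta> \<in> Prob UNIV" and \<nu>: "\<nu> \<in> Prob Y"
    and le: "\<And>k::nat. (\<integral>x. max 0 (1 - real k * infdist x (- Y)) \<partial>\<eta>) \<le>
                (\<integral>x\<in>Y. max 0 (1 - real k * infdist x (- Y)) \<partial>\<nu>)"
  shows "\<eta> \<in> Prob Y"
proof -
  interpret E: prob_space \<eta> using ProbD[OF \<eta>] by simp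
  define f where "f k x = max 0 (1 - real k * infdist x (- Y))" for k :: nat and x
  have fc: "continuous_on UNIV (f k)" for k unfolding f_def by (intro continuous_intros)
  have f1: "0 \<le> f k x" "f k x \<le> 1" for k x unfolding f_def using infdist_nonneg[of x "- Y"] by auto
  have fCb: "f k \<in> Cb UNIV" for k
    unfolding Cb_def using fc f1 by (auto simp: bounded_iff intro!: exI[of _ 1])
  have Ym: "Y \<in> sets borel" using Y(1) by simp
  have ne: "- Y \<noteq> {}" using Y(2) by auto
  have "(\<lambda>k. \<integral>x\<in>Y. f k x \<partial>\<nu>) \<longlonglongrightarrow> (\<integral>x\<in>Y. 0 \<partial>\<nu>)"
  proof (rule Prob_set_integral_tendsto[OF \<nu>])
    show "f k \<in> Sb Y" for k by (rule Cb_UNIV_Sb[OF fCb Ym])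
    show "\<bar>f k x\<bar> \<le> 1" for k x using f1[of k x] by simp
    fix x assume x: "x \<in> Y"
    have p: "infdist x (- Y) > 0" using Y ne x by (intro infdist_pos_not_in_closed) auto
    obtain K :: nat where K: "1 / infdist x (- Y) < real K" using reals_Archimedean2 by blast
    have "f k x = 0" if "k \<ge> K" for k
    proof -
      have "1 < real K * infdist x (- Y)" using K p by (simp add: field_simps)
      also have "\<dots> \<le> real k * infdist x (- Y)" using that p by (intro mult_right_mono) auto
      finally show ?thesis unfolding f_def by simp
    qed
    hence "\<forall>\<^sub>F k in sequentially. f k x = 0" using eventually_sequentially by blast
    thus "(\<lambda>k. f k x) \<longlonglongrightarrow> 0" by (rule tendsto_eventually)
  qed
  hence lim: "(\<lambda>k. \<integral>x\<in>Y. f k x \<partial>\<nu>) \<longlonglongrightarrow> 0" by simp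
  have "measure \<eta> (- Y) \<le> (\<integral>x\<in>Y. f k x \<partial>\<nu>)" for k
  proof -
    have Yc: "- Y \<in> sets \<eta>" using Ym ProbD(1)[OF \<eta>] by simp
    have "measure \<eta> (- Y) = (\<integral>x. indicator (- Y) x \<partial>\<eta>)" using Yc by simp
    also have "\<dots> \<le> (\<integral>x. f k x \<partial>\<eta>)"
    proof (rule integral_mono)
      show "integrable \<eta> (indicator (- Y) :: 'a \<Rightarrow> real)" using Yc by (simp add: E.emeasure_finite less_top[symmetric])
      show "integrable \<eta> (f k)"
        using Prob_set_integrable[OF \<eta> Cb_UNIV_Sb[OF fCb, of UNIV]] unfolding set_integrable_def by simp
      show "indicator (- Y) x \<le> f k x" for x using f1[of k x] by (auto simp: indicator_def f_def)
    qed
    also have "\<dots> \<le> (\<integral>x\<in>Y. f k x \<partial>\<nu>)" using le[of k] unfolding f_def .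
    finally show ?thesis .
  qed
  hence "measure \<eta> (- Y) \<le> 0" using lim by (intro LIMSEQ_le_const) auto
  hence "measure \<eta> (- Y) = 0" by (simp add: measure_le_0_iff)
  moreover have "measure \<eta> (space \<eta> - Y) = 1 - measure \<eta> Y" using Ym ProbD(1)[OF \<eta>] by (intro E.prob_compl) simp
  ultimately have "measure \<eta> Y = 1" using ProbD(4)[OF \<eta>] by (simp add: Compl_eq_Diff_UNIV)
  thus ?thesis using ProbD[OF \<eta>] unfolding Prob_def by (simp add: E.emeasure_eq_measure)
qed

lemma compact_pos_imp_gap:
  fixes G :: "'b::topological_space \<Rightarrow> real"
  assumes "compact K" "K \<noteq> {}" "continuous_on K G" "\<not> (\<exists>z\<in>K. G z \<le> 0)"
  obtains e where "e > 0" "\<And>z. z \<in> K \<Longrightarrow> e \<le> G z"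
proof -
  obtain z where z: "z \<in> K" "\<And>w. w \<in> K \<Longrightarrow> G z \<le> G w" using continuous_attains_inf[OF assms(1-3)] by blast
  show ?thesis using that[of "G z"] z assms(4) by force
qed

text \<open>A measure on the product of the closures is produced whose marginals, order and cost are
  all read off from the one inequality \<open>IG\<close>; \<eta> is its second marginal.\<close>

lemma subharmonic_projection_duality:
  fixes X Y :: "'a::euclidean_space set"
  assumes X: "open X" "bounded X" and Y: "open Y" "convex Y" "bounded Y"
    and \<mu>: "\<mu> \<in> Prob X" and \<nu>: "\<nu> \<in> Prob Y"
    and D: "\<And>\<psi>. \<psi> \<in> Sc Y \<Longrightarrow> (\<integral>x\<in>X. Q2 Y \<psi> x \<partial>\<mu>) - (\<integral>y\<in>Y. \<psi> y \<partial>\<nu>) \<le> D"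
  shows "\<exists>\<eta>\<in>Psh_le Y \<nu>. T2 \<mu> \<eta> \<le> D"
proof -
  define K where "K = closure X \<times> closure Y"
  have K: "compact K" unfolding K_def using X Y by (intro compact_Times) (auto simp: compact_closure)
  have Km: "K \<in> sets borel" using K by (rule borel_compact)
  have Xm: "X \<in> sets borel" and Ym: "Y \<in> sets borel" using X Y by auto
  have Xne: "X \<noteq> {}" and Yne: "Y \<noteq> {}" using ProbD(3)[OF \<mu>] ProbD(3)[OF \<nu>] by auto
  have Yu: "Y \<noteq> UNIV" using Y(3) by auto
  have Kne: "K \<noteq> {}" unfolding K_def using Xne Yne by auto
  define c where "c z = (norm (fst z - snd z))\<^sup>2" for z :: "'a \<times> 'a"
  \<comment> \<open>For a measure with first marginal \<mu>, the integral of
    \<open>G a \<psi>\<close> is the cost minus \<open>D\<close> plus the amount by which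
    \<open>\<psi>\<close> violates the order; \<open>a\<close> is the multiplier of the marginal
    constraint.\<close>
  define V where "V a \<psi> = integral\<^sup>L \<mu> a - (\<integral>y\<in>Y. \<psi> y \<partial>\<nu>) - D" for a \<psi>
  define G where "G a \<psi> z = c z + \<psi> (snd z) - a (fst z) + V a \<psi>" for a \<psi> z
  have ScSb: "\<psi> \<in> Sb Y" if "\<psi> \<in> Sc Y" for \<psi> using Sc_imp_Cb[OF that Y(3)] Cb_subset_Sb[OF Y(1)] by blast
  have cc: "continuous_on K c" unfolding c_def by (intro continuous_intros)
  have \<psi>c: "continuous_on K (\<lambda>z. \<psi> (snd z))" if "\<psi> \<in> Sc Y" for \<psi>
    using that unfolding Sc_def K_def
    by (auto intro!: continuous_on_compose2[of "closure Y" \<psi>] continuous_intros)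
  have ac: "continuous_on K (\<lambda>z. a (fst z))" if "a \<in> Cb UNIV" for a
    using that unfolding Cb_def
    by (auto intro!: continuous_on_compose2[of UNIV a] continuous_intros)
  have Gc: "continuous_on K (G a \<psi>)" if "a \<in> Cb UNIV" "\<psi> \<in> Sc Y" for a \<psi>
    unfolding G_def using cc ac[OF that(1)] \<psi>c[OF that(2)] by (intro continuous_intros)
  define \<G> where "\<G> = {G a \<psi> | a \<psi>. a \<in> Cb UNIV \<and> \<psi> \<in> Sc Y}"
  have intlin: "integral\<^sup>L \<mu> (\<lambda>x. u * a x + v * b x) = u * integral\<^sup>L \<mu> a + v * integral\<^sup>L \<mu> b"
    if "a \<in> Cb UNIV" "b \<in> Cb UNIV" for u v a b
    using Prob_integral_lincomb[OF \<mu> Cb_UNIV_Sb[OF that(1) Xm] Cb_UNIV_Sb[OF that(2) Xm], of u v]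
    by (simp add: Prob_integral_Cb[OF \<mu> Xm] that Cb_UNIV_lincomb)
  have np: "\<exists>z\<in>K. G a \<psi> z \<le> 0" if a: "a \<in> Cb UNIV" and \<psi>: "\<psi> \<in> Sc Y" for a \<psi>
  proof (rule ccontr)
    assume "\<not> ?thesis"
    then obtain e where e: "e > 0" "\<And>z. z \<in> K \<Longrightarrow> e \<le> G a \<psi> z"
      using compact_pos_imp_gap[OF K Kne Gc[OF a \<psi>]] by blast
    \<comment> \<open>A gap \<open>e\<close> would make \<open>a + (e - V a \<psi>)\<close> a
      minorant of \<open>Q2 Y \<psi>\<close>, and integration against \<mu> would raise the dual
      functional at \<open>\<psi>\<close> to at least \<open>D + e\<close>.\<close>
    have "a x + (e - V a \<psi>) \<le> Q2 Y \<psi> x" if x: "x \<in> X" for x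
    proof (rule Q2_greatest[OF Yne])
      fix y assume y: "y \<in> Y"
      have "(x, y) \<in> K" unfolding K_def using x y closure_subset by auto
      from e(2)[OF this] show "a x + (e - V a \<psi>) \<le> \<psi> y + (norm (x - y))\<^sup>2"
        unfolding G_def c_def by simp
    qed
    hence "(\<integral>x\<in>X. a x + (e - V a \<psi>) \<partial>\<mu>) \<le> (\<integral>x\<in>X. Q2 Y \<psi> x \<partial>\<mu>)"
      using Sb_lincomb[OF Cb_UNIV_Sb[OF a Xm] Sb_const[OF Xm, of "e - V a \<psi>"], of 1 1]
      by (intro Prob_integral_mono[OF \<mu>] Q2_Sb Xm X Yne ScSb \<psi>) auto
    moreover have "(\<integral>x\<in>X. a x + (e - V a \<psi>) \<partial>\<mu>) = integral\<^sup>L \<mu> a + (e - V a \<psi>)"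
      by (simp add: Prob_integral_affine[OF \<mu> Cb_UNIV_Sb[OF a Xm] Xm] Prob_integral_Cb[OF \<mu> Xm a])
    ultimately show False using D[OF \<psi>] e(1) unfolding V_def by simp
  qed
  obtain M where M: "M \<in> Prob K" and MG: "\<And>F. F \<in> \<G> \<Longrightarrow> (\<integral>z\<in>K. F z \<partial>M) \<le> 0"
  proof (rule probability_measure_of_convex_family[OF K, of \<G>])
    show "\<G> \<noteq> {}" unfolding \<G>_def using zero_Sc zero_Cb by blast
    show "continuous_on K F" if "F \<in> \<G>" for F using that Gc unfolding \<G>_def by blast
    show "\<exists>z\<in>K. F z \<le> 0" if "F \<in> \<G>" for F using that np unfolding \<G>_def by blast
    fix F H and u :: real assume FH: "F \<in> \<G>" "H \<in> \<G>" and u: "0 \<le> u" "u \<le> 1"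
    obtain a \<psi> where 1: "F = G a \<psi>" "a \<in> Cb UNIV" "\<psi> \<in> Sc Y" using FH(1) unfolding \<G>_def by blast
    obtain b \<phi> where 2: "H = G b \<phi>" "b \<in> Cb UNIV" "\<phi> \<in> Sc Y" using FH(2) unfolding \<G>_def by blast
    define d where "d = (\<lambda>x. u * a x + (1 - u) * b x)"
    define \<theta> where "\<theta> = (\<lambda>x. u * \<psi> x + (1 - u) * \<phi> x)"
    have dC: "d \<in> Cb UNIV" unfolding d_def using 1 2 by (intro Cb_UNIV_lincomb)
    have tS: "\<theta> \<in> Sc Y" unfolding \<theta>_def using 1 2 u Y by (intro Sc_lincomb) auto
    have "V d \<theta> = u * V a \<psi> + (1 - u) * V b \<phi>"
      unfolding V_def d_def \<theta>_def intlin[OF 1(2) 2(2)] Prob_integral_lincomb[OF \<nu> ScSb[OF 1(3)] ScSb[OF 2(3)]]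
      by (simp add: algebra_simps)
    hence "G d \<theta> z = u * F z + (1 - u) * H z" for z
      unfolding 1(1) 2(1) G_def by (simp add: d_def \<theta>_def algebra_simps)
    hence "(\<lambda>z. u * F z + (1 - u) * H z) = G d \<theta>" by auto
    thus "(\<lambda>z. u * F z + (1 - u) * H z) \<in> \<G>" unfolding \<G>_def using dC tS by blast
  qed (rule that)
  define I where "I h = (\<integral>z\<in>K. h z \<partial>M)" for h :: "'a \<times> 'a \<Rightarrow> real"
  have Sb: "h \<in> Sb K" if "continuous_on K h" for h using continuous_on_compact_Sb[OF K that] .
  have lin: "I (\<lambda>z. u * f z + v * h z) = u * I f + v * I h" if "continuous_on K f" "continuous_on K h" for u v f h
    unfolding I_def using that by (intro Prob_integral_lincomb[OF M] Sb)
  have IG: "I c + I (\<lambda>z. \<psi> (snd z)) - I (\<lambda>z. a (fst z)) + V a \<psi> \<le> 0" if a: "a \<in> Cb UNIV" and \<psi>: "\<psi> \<in> Sc Y" for a \<psi>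
  proof -
    \<comment> \<open>The factors 1 and -1 are spelled out so that every sum has the shape of the
      two-term rule \<open>lin\<close>.\<close>
    have "I (G a \<psi>) = I (\<lambda>z. 1 * (1 * (1 * c z + 1 * \<psi> (snd z)) + (-1) * a (fst z)) + V a \<psi> * 1)"
      unfolding G_def by simp
    also have "\<dots> = 1 * I (\<lambda>z. 1 * (1 * c z + 1 * \<psi> (snd z)) + (-1) * a (fst z)) + V a \<psi> * I (\<lambda>z. 1)"
      by (rule lin) (intro continuous_intros cc \<psi>c ac a \<psi>)+
    also have "I (\<lambda>z. 1 * (1 * c z + 1 * \<psi> (snd z)) + (-1) * a (fst z)) =
        1 * I (\<lambda>z. 1 * c z + 1 * \<psi> (snd z)) + (-1) * I (\<lambda>z. a (fst z))"
      by (rule lin) (intro continuous_intros cc \<psi>c ac a \<psi>)+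
    also have "I (\<lambda>z. 1 * c z + 1 * \<psi> (snd z)) = 1 * I c + 1 * I (\<lambda>z. \<psi> (snd z))"
      by (rule lin) (intro continuous_intros cc \<psi>c ac a \<psi>)+
    also have "I (\<lambda>z. 1) = 1" unfolding I_def by (rule Prob_integral_const[OF M Km])
    finally have "I (G a \<psi>) = I c + I (\<lambda>z. \<psi> (snd z)) - I (\<lambda>z. a (fst z)) + V a \<psi>" by simp
    moreover have "I (G a \<psi>) \<le> 0" unfolding I_def using a \<psi> by (intro MG) (auto simp: \<G>_def)
    ultimately show ?thesis by simp
  qed
  have I0: "I (\<lambda>z. 0) = 0" unfolding I_def by simp
  have cost: "I c \<le> D" using IG[OF zero_Cb zero_Sc] I0 by (simp add: V_def)
  \<comment> \<open>\<open>Sc Y\<close> is a cone, so \<open>\<psi>\<close> may be scaled by every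
    \<open>t \<ge> 0\<close> with the cost and \<open>D\<close> fixed; this isolates the order
    constraint.\<close>
  have \<psi>le: "I (\<lambda>z. \<psi> (snd z)) \<le> (\<integral>y\<in>Y. \<psi> y \<partial>\<nu>)" if \<psi>: "\<psi> \<in> Sc Y" for \<psi>
  proof -
    have "I c + t * (I (\<lambda>z. \<psi> (snd z)) - (\<integral>y\<in>Y. \<psi> y \<partial>\<nu>)) \<le> D" if t: "t \<ge> 0" for t
    proof -
      have "(\<lambda>x. t * \<psi> x + 0 * \<psi> x) \<in> Sc Y" using t \<psi> Y by (intro Sc_lincomb) auto
      from IG[OF zero_Cb this] lin[OF \<psi>c \<psi>c, OF \<psi> \<psi>, of t 0] Prob_integral_lincomb[OF \<nu> ScSb ScSb, OF \<psi> \<psi>, of t 0]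
      show ?thesis by (simp add: V_def I0 algebra_simps)
    qed
    from bounded_ray_imp_nonpos[OF this] show ?thesis by simp
  qed
  have ale: "integral\<^sup>L \<mu> a \<le> I (\<lambda>z. a (fst z))" if a: "a \<in> Cb UNIV" for a
  proof -
    have "I c + t * (integral\<^sup>L \<mu> a - I (\<lambda>z. a (fst z))) \<le> D" if t: "t \<ge> 0" for t
      using IG[OF Cb_UNIV_lincomb[OF a a, of t 0] zero_Sc] lin[OF ac ac, OF a a, of t 0] intlin[OF a a, of t 0]
      by (simp add: V_def I0 algebra_simps)
    from bounded_ray_imp_nonpos[OF this] show ?thesis by simp
  qed
  \<comment> \<open>The multipliers \<open>a\<close> form a vector space, so the inequality for
    \<open>- a\<close> turns the marginal constraint into an equality.\<close>
  have aeq: "I (\<lambda>z. a (fst z)) = integral\<^sup>L \<mu> a" if a: "a \<in> Cb UNIV" for a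
    using ale[OF a] ale[OF Cb_UNIV_lincomb[OF a a, of "-1" 0]] lin[OF ac ac, OF a a, of "-1" 0] intlin[OF a a, of "-1" 0]
    by simp
  have fm: "fst \<in> borel_measurable (borel :: ('a \<times> 'a) measure)" and sm: "snd \<in> borel_measurable (borel :: ('a \<times> 'a) measure)"
    by (intro borel_measurable_continuous_onI continuous_intros)+
  have \<mu>eq: "distr M borel fst = \<mu>"
    by (rule distr_eq_if_continuous_integrals_eq[OF M Km fm])
       (use ProbD[OF \<mu>] aeq in \<open>auto simp: I_def\<close>)
  define \<eta> where "\<eta> = distr M borel snd"
  have \<eta>U: "\<eta> \<in> Prob UNIV" unfolding \<eta>_def by (rule Prob_distr[OF M sm]) auto
  have \<eta>: "\<eta> \<in> Prob Y"
  proof (rule tight_imp_Prob[OF Y(1) Yu \<eta>U \<nu>])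
    fix k :: nat
    define f where "f x = max 0 (1 - real k * infdist x (- Y))" for x
    have fS: "f \<in> Sc Y" unfolding f_def by (rule boundary_barrier_Sc[OF Y(1,2) Yu]) simp
    have fm': "f \<in> borel_measurable borel" unfolding f_def by (intro borel_measurable_continuous_onI continuous_intros)
    have "integral\<^sup>L \<eta> f = (\<integral>z. f (snd z) \<partial>M)" unfolding \<eta>_def
      by (rule integral_distr[OF Prob_measurable[OF M sm] fm'])
    also have "\<dots> = I (\<lambda>z. f (snd z))" unfolding I_def
      by (rule Prob_integral_eq_integral[OF M Km measurable_compose[OF sm fm'], symmetric])
    also have "\<dots> \<le> (\<integral>y\<in>Y. f y \<partial>\<nu>)" by (rule \<psi>le[OF fS])
    finally show "(\<integral>x. max 0 (1 - real k * infdist x (- Y)) \<partial>\<eta>) \<le>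
      (\<integral>x\<in>Y. max 0 (1 - real k * infdist x (- Y)) \<partial>\<nu>)" unfolding f_def .
  qed
  have "sh_le Y \<eta> \<nu>"
  proof (rule sh_le_iff_Sc[OF Y \<eta> \<nu>])
    fix \<psi> assume \<psi>: "\<psi> \<in> Sc Y"
    have "(\<integral>y\<in>Y. \<psi> y \<partial>\<eta>) = I (\<lambda>z. \<psi> (snd z))"
      unfolding \<eta>_def I_def
      by (rule Prob_integral_distr[OF M Km sm \<eta>[unfolded \<eta>_def] Ym ScSb[OF \<psi>] Sb[OF \<psi>c[OF \<psi>]]]) simp
    thus "(\<integral>y\<in>Y. \<psi> y \<partial>\<eta>) \<le> (\<integral>y\<in>Y. \<psi> y \<partial>\<nu>)" using \<psi>le[OF \<psi>] by simp
  qed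
  moreover have "T2 \<mu> \<eta> \<le> D"
  proof -
    have "T2 \<mu> \<eta> \<le> integral\<^sup>L M c"
      using T2_le_integral[OF M fm sm] unfolding \<mu>eq \<eta>_def[symmetric] c_def[abs_def] .
    also have "\<dots> = I c" unfolding I_def
      by (rule Prob_integral_eq_integral[OF M Km, symmetric])
         (auto simp: c_def[abs_def] intro!: borel_measurable_continuous_onI continuous_intros)
    finally show ?thesis using cost by simp
  qed
  ultimately show ?thesis using \<eta> unfolding Psh_le_def by blast
qed

section \<open>Duality for the backward projection\<close>

text \<open>Uniform continuity on the compact product gives all sections one common modulus in
  \<open>w\<close>, which their supremum inherits.\<close>

lemma continuous_on_compact_Sup:
  fixes F :: "'a::euclidean_space \<times> 'b::euclidean_space \<Rightarrow> real"
  assumes A: "compact A" "A \<noteq> {}" and B: "compact B" and F: "continuous_on (A \<times> B) F"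
  shows "continuous_on B (\<lambda>w. SUP x\<in>A. F (x, w))"
proof -
  have "compact (A \<times> B)" by (rule compact_Times[OF A(1) B])
  hence uc: "uniformly_continuous_on (A \<times> B) F" using F compact_uniformly_continuous by blast
  have bdd: "bdd_above ((\<lambda>x. F (x, w)) ` A)" if "w \<in> B" for w
  proof -
    have "continuous_on A (\<lambda>x. F (x, w))"
      by (rule continuous_on_compose2[OF F]) (use that in \<open>auto intro!: continuous_intros\<close>)
    thus ?thesis using A(1) by (intro bounded_imp_bdd_above compact_imp_bounded compact_continuous_image)
  qed
  show ?thesis unfolding continuous_on_iff
  proof (intro ballI allI impI)
    fix w and e :: real assume w: "w \<in> B" and e: "e > 0"
    obtain d where d: "d > 0" "\<And>z z'. z \<in> A \<times> B \<Longrightarrow> z' \<in> A \<times> B \<Longrightarrow> dist z' z < d \<Longrightarrow> dist (F z') (F z) < e / 2"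
      using uc e unfolding uniformly_continuous_on_def by (meson half_gt_zero)
    have le: "(SUP x\<in>A. F (x, u)) \<le> (SUP x\<in>A. F (x, v)) + e / 2"
      if uv: "u \<in> B" "v \<in> B" "dist u v < d" for u v
    proof (rule cSUP_least[OF A(2)])
      fix x assume x: "x \<in> A"
      have "dist (F (x, u)) (F (x, v)) < e / 2" using x uv by (intro d(2)) (auto simp: dist_prod_def)
      moreover have "F (x, v) \<le> (SUP x\<in>A. F (x, v))" by (rule cSUP_upper[OF x bdd[OF uv(2)]])
      ultimately show "F (x, u) \<le> (SUP x\<in>A. F (x, v)) + e / 2" unfolding dist_real_def by linarith
    qed
    show "\<exists>d>0. \<forall>w'\<in>B. dist w' w < d \<longrightarrow> dist (SUP x\<in>A. F (x, w')) (SUP x\<in>A. F (x, w)) < e"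
    proof (intro exI[of _ d] conjI ballI impI d(1))
      fix w' assume w': "w' \<in> B" "dist w' w < d"
      show "dist (SUP x\<in>A. F (x, w')) (SUP x\<in>A. F (x, w)) < e"
        using le[OF w'(1) w w'(2)] le[OF w w'(1)] w'(2) e
        by (simp add: dist_real_def abs_less_iff dist_commute)
    qed
  qed
qed

text \<open>These are the tests for the requirement that \<open>w\<close>, given \<open>x\<close>,
  be distributed above the point mass at \<open>x\<close> in the subharmonic order: the mean of
  \<open>\<Phi> (x, w)\<close> over \<open>w\<close> is then at least \<open>\<Phi> (x, x)\<close>,
  hence nonnegative. Joint continuity makes them usable on compact closures.\<close>

definition subharmonic_kernels :: "'a::euclidean_space set \<Rightarrow> ('a \<times> 'a \<Rightarrow> real) set" where
  "subharmonic_kernels X = {\<Phi>. continuous_on (closure X \<times> closure X) \<Phi> \<and>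
     (\<forall>x\<in>closure X. submean X (\<lambda>w. \<Phi> (x, w))) \<and> (\<forall>x\<in>closure X. 0 \<le> \<Phi> (x, x))}"

lemma subharmonic_kernel_section:
  assumes "\<Phi> \<in> subharmonic_kernels X" "x \<in> closure X"
  shows "(\<lambda>w. \<Phi> (x, w)) \<in> Sc X"
proof -
  have "continuous_on (closure X) (\<lambda>w. \<Phi> (x, w))"
    using assms unfolding subharmonic_kernels_def
    by (auto intro!: continuous_on_compose2[of "closure X \<times> closure X" \<Phi>] continuous_intros)
  thus ?thesis using assms unfolding subharmonic_kernels_def Sc_def by auto
qed

lemma subharmonic_kernels_lincomb:
  assumes "\<Phi> \<in> subharmonic_kernels X" "\<Theta> \<in> subharmonic_kernels X" "a \<ge> 0" "b \<ge> 0" "open X" "bounded X"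
  shows "(\<lambda>z. a * \<Phi> z + b * \<Theta> z) \<in> subharmonic_kernels X"
proof -
  have "submean X (\<lambda>w. a * \<Phi> (x, w) + b * \<Theta> (x, w))" if x: "x \<in> closure X" for x
    using Sc_lincomb[OF subharmonic_kernel_section[OF assms(1) x] subharmonic_kernel_section[OF assms(2) x] assms(3-6)]
    unfolding Sc_def by simp
  thus ?thesis using assms(1-4) unfolding subharmonic_kernels_def by (auto intro!: continuous_intros)
qed

lemma zero_subharmonic_kernels: "(\<lambda>z. 0) \<in> subharmonic_kernels X"
  unfolding subharmonic_kernels_def using submean_const by (auto intro: continuous_intros)

text \<open>The extra variable \<open>x\<close> is eliminated by the supremum of
  \<open>\<Phi> (x, w) + a x\<close> over \<open>x\<close>. It stays subharmonic in
  \<open>w\<close>, the choice \<open>x = w\<close> and the sign on the diagonal give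
  \<open>a \<le> \<Psi>\<close>, and the last property records that it is a least upper bound. A
  pair of \<open>\<Phi>\<close> and \<open>a\<close> thus does no better in the dual problem than
  one \<open>\<Psi>\<close>.\<close>

lemma subharmonic_kernel_envelope:
  fixes X :: "'a::euclidean_space set"
  assumes X: "open X" "bounded X" "X \<noteq> {}" and \<Phi>: "\<Phi> \<in> subharmonic_kernels X" and a: "a \<in> Cb UNIV"
  obtains \<Psi> where "\<Psi> \<in> Sc X" "\<And>x. x \<in> closure X \<Longrightarrow> a x \<le> \<Psi> x"
    "\<And>w c. w \<in> closure X \<Longrightarrow> (\<And>x. x \<in> closure X \<Longrightarrow> \<Phi> (x, w) + a x \<le> c) \<Longrightarrow> \<Psi> w \<le> c"
proof -
  define F where "F z = \<Phi> z + a (fst z)" for z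
  define \<Psi> where "\<Psi> w = (SUP x\<in>closure X. F (x, w))" for w
  have A: "compact (closure X)" "closure X \<noteq> {}" using X by (auto simp: compact_closure)
  have ac: "continuous_on UNIV a" using a unfolding Cb_def by simp
  have Fc: "continuous_on (closure X \<times> closure X) F"
    unfolding F_def using \<Phi> unfolding subharmonic_kernels_def
    by (auto intro!: continuous_intros continuous_on_compose2[OF ac])
  have \<Psi>c: "continuous_on (closure X) \<Psi>" unfolding \<Psi>_def by (rule continuous_on_compact_Sup[OF A A(1) Fc])
  have bdd: "bdd_above ((\<lambda>x. F (x, w)) ` closure X)" if "w \<in> closure X" for w
  proof -
    have "continuous_on (closure X) (\<lambda>x. F (x, w))"
      by (rule continuous_on_compose2[OF Fc]) (use that in \<open>auto intro!: continuous_intros\<close>)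
    thus ?thesis using A(1) by (intro bounded_imp_bdd_above compact_imp_bounded compact_continuous_image)
  qed
  have Fle: "F (x, w) \<le> \<Psi> w" if "x \<in> closure X" "w \<in> closure X" for x w
    unfolding \<Psi>_def by (rule cSUP_upper[OF that(1) bdd[OF that(2)]])
  have Xm: "X \<in> sets borel" using X(1) by simp
  have sub: "X \<subseteq> closure X" by (rule closure_subset)
  have "\<Psi> \<in> Sb X"
  proof -
    have "bounded (\<Psi> ` closure X)" by (rule compact_imp_bounded[OF compact_continuous_image[OF \<Psi>c A(1)]])
    hence "\<Psi> \<in> Cb X" unfolding Cb_def using \<Psi>c sub
      by (auto intro: continuous_on_subset bounded_subset image_mono)
    thus ?thesis using Cb_subset_Sb[OF X(1)] by blast
  qed
  moreover have "(\<lambda>w. F (x, w)) \<in> Sb X \<and> submean X (\<lambda>w. F (x, w))" if x: "x \<in> closure X" for x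
  proof -
    have S: "(\<lambda>w. \<Phi> (x, w)) \<in> Sc X" by (rule subharmonic_kernel_section[OF \<Phi> x])
    have S': "(\<lambda>w. \<Phi> (x, w)) \<in> Sb X" using Sc_imp_Cb[OF S X(2)] Cb_subset_Sb[OF X(1)] by blast
    show ?thesis
      using Sb_lincomb[OF S' Sb_const[OF Xm, of "a x"], of 1 1]
        submean_lincomb[OF S' Sb_const[OF Xm, of "a x"] _ submean_const, of 1 1] S
      unfolding F_def Sc_def by simp
  qed
  ultimately have "submean X \<Psi>"
  proof (intro submean_sup[of \<Psi> X "closure X" "\<lambda>x w. F (x, w)"])
    fix w and e :: real assume w: "w \<in> X" "e > 0"
    hence "\<Psi> w - e < (SUP x\<in>closure X. F (x, w))" unfolding \<Psi>_def by simp
    thus "\<exists>x\<in>closure X. \<Psi> w - e < F (x, w)"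
      using less_cSUP_iff[OF A(2) bdd[of w]] w sub by blast
  qed (use Fle sub in auto)
  show ?thesis
  proof (rule that[of \<Psi>])
    show "\<Psi> \<in> Sc X" unfolding Sc_def using \<Psi>c \<open>submean X \<Psi>\<close> by simp
    show "a x \<le> \<Psi> x" if x: "x \<in> closure X" for x
    proof -
      have "0 \<le> \<Phi> (x, x)" using \<Phi> x unfolding subharmonic_kernels_def by blast
      thus ?thesis using Fle[OF x x] unfolding F_def by simp
    qed
    show "\<Psi> w \<le> c" if "w \<in> closure X" "\<And>x. x \<in> closure X \<Longrightarrow> \<Phi> (x, w) + a x \<le> c" for w c
      unfolding \<Psi>_def using that(2) by (intro cSUP_least[OF A(2)]) (simp add: F_def)
  qed
qed

text \<open>With \<open>x\<close> as a parameter, the kernel is a dilate of \<open>\<psi>\<close> in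
  \<open>w\<close> minus a constant. The contraction fixes \<open>w = x\<close>, so the kernel is 0
  on the diagonal.\<close>

lemma dilation_subharmonic_kernel:
  fixes X :: "'a::euclidean_space set"
  assumes X: "open X" "convex X" "bounded X" and \<psi>: "\<psi> \<in> Sc X" and t: "0 < t" "t < 1"
  shows "(\<lambda>z. \<psi> ((1 - t) *\<^sub>R snd z + t *\<^sub>R fst z) - \<psi> (fst z)) \<in> subharmonic_kernels X"
proof -
  have Xm: "X \<in> sets borel" using X(1) by simp
  have \<psi>c: "continuous_on (closure X) \<psi>" and \<psi>s: "submean X \<psi>" using \<psi> unfolding Sc_def by auto
  have \<psi>S: "\<psi> \<in> Sb X" using Sc_imp_Cb[OF \<psi> X(3)] Cb_subset_Sb[OF X(1)] by blast
  have mem: "(1 - t) *\<^sub>R w + t *\<^sub>R x \<in> closure X" if "x \<in> closure X" "w \<in> closure X" for x w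
    using convexD_alt[OF convex_closure[OF X(2)] that(2,1)] t by simp
  \<comment> \<open>Here the interior point is \<open>w\<close>, with weight \<open>1 - t\<close>,
    while \<open>x\<close> may lie on the boundary; so the dilate is defined on \<open>X\<close> for
    every parameter in the closure.\<close>
  have mem': "(1 - t) *\<^sub>R w + t *\<^sub>R x \<in> X" if "x \<in> closure X" "w \<in> X" for x w
    using convex_dilation_mem[OF X(1,2) that(2,1), of "1 - t"] t by (simp add: add.commute)
  have "submean X (\<lambda>w. \<psi> ((1 - t) *\<^sub>R w + t *\<^sub>R x) - \<psi> x)" if x: "x \<in> closure X" for x
  proof -
    have "(\<lambda>w. \<psi> ((1 - t) *\<^sub>R w + t *\<^sub>R x)) \<in> Sb X" using mem'[OF x] by (intro Sb_affine[OF \<psi>S Xm])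
    moreover have "submean X (\<lambda>w. \<psi> ((1 - t) *\<^sub>R w + t *\<^sub>R x))"
      using mem'[OF x] t by (intro submean_affine[OF \<psi>s]) auto
    ultimately show ?thesis
      using submean_lincomb[OF _ Sb_const[OF Xm, of "- \<psi> x"] _ submean_const, of "\<lambda>w. \<psi> ((1 - t) *\<^sub>R w + t *\<^sub>R x)" 1 1]
      by simp
  qed
  moreover have "continuous_on (closure X \<times> closure X) (\<lambda>z. \<psi> ((1 - t) *\<^sub>R snd z + t *\<^sub>R fst z) - \<psi> (fst z))"
    by (intro continuous_intros continuous_on_compose2[OF \<psi>c]) (use mem in auto)
  ultimately show ?thesis unfolding subharmonic_kernels_def
    by (auto simp: scaleR_add_left[symmetric])
qed

text \<open>A triple \<open>(x, w, y)\<close> reads as starting point, displaced point and target: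
  \<mu> is the law of \<open>x\<close>, \<nu> that of \<open>y\<close>, and the cost involves
  \<open>w\<close> and \<open>y\<close> only. The measure \<xi> is the law of \<open>w\<close>
  pulled slightly towards \<open>x\<close>, and the pull is paid for by \<epsilon>.\<close>

lemma subharmonic_backward_projection_duality:
  fixes X Y :: "'a::euclidean_space set"
  assumes X: "open X" "convex X" "bounded X" and Y: "open Y" "bounded Y"
    and \<mu>: "\<mu> \<in> Prob X" and \<nu>: "\<nu> \<in> Prob Y"
    and D: "\<And>\<psi>. \<psi> \<in> Sc X \<Longrightarrow> (\<integral>x\<in>X. \<psi> x \<partial>\<mu>) - (\<integral>y\<in>Y. Q2bar X \<psi> y \<partial>\<nu>) \<le> D"
    and \<epsilon>: "\<epsilon> > 0"
  shows "\<exists>\<xi>\<in>Psh_ge X \<mu>. T2 \<xi> \<nu> \<le> D + \<epsilon>"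
proof -
  define K where "K = closure X \<times> closure X \<times> closure Y"
  have K: "compact K" unfolding K_def using X Y by (intro compact_Times) (auto simp: compact_closure)
  have Km: "K \<in> sets borel" using K by (rule borel_compact)
  have Xm: "X \<in> sets borel" and Ym: "Y \<in> sets borel" using X Y by auto
  have Xne: "X \<noteq> {}" and Yne: "Y \<noteq> {}" using ProbD(3)[OF \<mu>] ProbD(3)[OF \<nu>] by auto
  have Kne: "K \<noteq> {}" unfolding K_def using Xne Yne by auto
  define c where "c z = (norm (fst (snd z) - snd (snd z)))\<^sup>2" for z :: "'a \<times> 'a \<times> 'a"
  define V where "V a b = integral\<^sup>L \<mu> a + integral\<^sup>L \<nu> b - D" for a b
  \<comment> \<open>\<open>a\<close> and \<open>b\<close> are multipliers of the two marginals.
    \<open>\<Phi>\<close> enters with a minus sign because the constraint demands that its mean be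
    nonnegative.\<close>
  define G where "G a b \<Phi> z = c z - \<Phi> (fst z, fst (snd z)) - a (fst z) - b (snd (snd z)) + V a b" for a b \<Phi> z
  have ScSb: "\<psi> \<in> Sb X" if "\<psi> \<in> Sc X" for \<psi> using Sc_imp_Cb[OF that X(3)] Cb_subset_Sb[OF X(1)] by blast
  have cc: "continuous_on K c" unfolding c_def by (intro continuous_intros)
  have \<Phi>c: "continuous_on K (\<lambda>z. \<Phi> (fst z, fst (snd z)))" if "\<Phi> \<in> subharmonic_kernels X" for \<Phi>
    using that unfolding subharmonic_kernels_def K_def
    by (auto intro!: continuous_on_compose2[of "closure X \<times> closure X" \<Phi>] continuous_intros)
  have ac: "continuous_on K (\<lambda>z. a (fst z))" if "a \<in> Cb UNIV" for a
    using that unfolding Cb_def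
    by (auto intro!: continuous_on_compose2[of UNIV a] continuous_intros)
  have bc: "continuous_on K (\<lambda>z. b (snd (snd z)))" if "b \<in> Cb UNIV" for b
    using that unfolding Cb_def
    by (auto intro!: continuous_on_compose2[of UNIV b] continuous_intros)
  have Gc: "continuous_on K (G a b \<Phi>)" if "a \<in> Cb UNIV" "b \<in> Cb UNIV" "\<Phi> \<in> subharmonic_kernels X" for a b \<Phi>
    unfolding G_def using cc ac[OF that(1)] bc[OF that(2)] \<Phi>c[OF that(3)] by (intro continuous_intros)
  define \<G> where "\<G> = {G a b \<Phi> | a b \<Phi>. a \<in> Cb UNIV \<and> b \<in> Cb UNIV \<and> \<Phi> \<in> subharmonic_kernels X}"
  have intlin: "integral\<^sup>L \<alpha> (\<lambda>x. u * a x + v * b x) = u * integral\<^sup>L \<alpha> a + v * integral\<^sup>L \<alpha> b"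
    if "a \<in> Cb UNIV" "b \<in> Cb UNIV" "\<alpha> \<in> Prob U" "U \<in> sets borel" for u v a b \<alpha> and U :: "'a set"
    using Prob_integral_lincomb[OF that(3) Cb_UNIV_Sb[OF that(1,4)] Cb_UNIV_Sb[OF that(2,4)], of u v]
    by (simp add: Prob_integral_Cb[OF that(3,4)] that(1,2) Cb_UNIV_lincomb)
  have np: "\<exists>z\<in>K. G a b \<Phi> z \<le> 0"
    if a: "a \<in> Cb UNIV" and b: "b \<in> Cb UNIV" and \<Phi>: "\<Phi> \<in> subharmonic_kernels X" for a b \<Phi>
  proof (rule ccontr)
    assume "\<not> ?thesis"
    then obtain e where e: "e > 0" "\<And>z. z \<in> K \<Longrightarrow> e \<le> G a b \<Phi> z"
      using compact_pos_imp_gap[OF K Kne Gc[OF a b \<Phi>]] by blast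
    obtain \<Psi> where \<Psi>: "\<Psi> \<in> Sc X" "\<And>x. x \<in> closure X \<Longrightarrow> a x \<le> \<Psi> x"
      "\<And>w c. w \<in> closure X \<Longrightarrow> (\<And>x. x \<in> closure X \<Longrightarrow> \<Phi> (x, w) + a x \<le> c) \<Longrightarrow> \<Psi> w \<le> c"
      using subharmonic_kernel_envelope[OF X(1,3) Xne \<Phi> a] by blast
    \<comment> \<open>A gap \<open>e\<close> bounds \<open>\<Phi> (x, w) + a x\<close> uniformly in
      \<open>x\<close>, hence \<open>\<Psi> w\<close>, hence the transform of \<open>\<Psi>\<close>.
      Together with \<open>a \<le> \<Psi>\<close> this would raise the dual functional at
      \<open>\<Psi>\<close> to at least \<open>D + e\<close>.\<close>
    have "Q2bar X \<Psi> y \<le> (-1) * b y + (V a b - e)" if y: "y \<in> Y" for y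
    proof (rule Q2bar_least[OF Xne])
      fix w assume w: "w \<in> X"
      have "\<Psi> w \<le> (norm (w - y))\<^sup>2 - b y + (V a b - e)"
      proof (rule \<Psi>(3))
        show "w \<in> closure X" using w closure_subset by blast
        fix x assume x: "x \<in> closure X"
        have "(x, w, y) \<in> K" unfolding K_def using x w y closure_subset by auto
        from e(2)[OF this] show "\<Phi> (x, w) + a x \<le> (norm (w - y))\<^sup>2 - b y + (V a b - e)"
          unfolding G_def c_def by simp
      qed
      thus "\<Psi> w - (norm (w - y))\<^sup>2 \<le> (-1) * b y + (V a b - e)" by simp
    qed
    hence "(\<integral>y\<in>Y. Q2bar X \<Psi> y \<partial>\<nu>) \<le> (\<integral>y\<in>Y. (-1) * b y + (V a b - e) * 1 \<partial>\<nu>)"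
      by (intro Prob_integral_mono[OF \<nu>] Q2bar_Sb Sb_lincomb Cb_UNIV_Sb[OF b Ym] Sb_const Ym Y(2) Xne ScSb[OF \<Psi>(1)]) auto
    also have "\<dots> = - integral\<^sup>L \<nu> b + (V a b - e)"
      using Prob_integral_lincomb[OF \<nu> Cb_UNIV_Sb[OF b Ym] Sb_const[OF Ym, of 1], of "-1" "V a b - e"]
      by (simp add: Prob_integral_Cb[OF \<nu> Ym b] Prob_integral_const[OF \<nu> Ym])
    finally have "(\<integral>y\<in>Y. Q2bar X \<Psi> y \<partial>\<nu>) \<le> integral\<^sup>L \<mu> a - D - e" unfolding V_def by simp
    moreover have "(\<integral>x\<in>X. a x \<partial>\<mu>) \<le> (\<integral>x\<in>X. \<Psi> x \<partial>\<mu>)"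
      using \<Psi>(2) closure_subset[of X] by (intro Prob_integral_mono[OF \<mu>] Cb_UNIV_Sb[OF a Xm] ScSb[OF \<Psi>(1)]) auto
    ultimately show False using D[OF \<Psi>(1)] e(1) by (simp add: Prob_integral_Cb[OF \<mu> Xm a])
  qed
  obtain M where M: "M \<in> Prob K" and MG: "\<And>F. F \<in> \<G> \<Longrightarrow> (\<integral>z\<in>K. F z \<partial>M) \<le> 0"
  proof (rule probability_measure_of_convex_family[OF K, of \<G>])
    show "\<G> \<noteq> {}" unfolding \<G>_def using zero_subharmonic_kernels zero_Cb by blast
    show "continuous_on K F" if "F \<in> \<G>" for F using that Gc unfolding \<G>_def by blast
    show "\<exists>z\<in>K. F z \<le> 0" if "F \<in> \<G>" for F using that np unfolding \<G>_def by blast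
    fix F H and u :: real assume FH: "F \<in> \<G>" "H \<in> \<G>" and u: "0 \<le> u" "u \<le> 1"
    obtain a b \<Phi> where 1: "F = G a b \<Phi>" "a \<in> Cb UNIV" "b \<in> Cb UNIV" "\<Phi> \<in> subharmonic_kernels X"
      using FH(1) unfolding \<G>_def by blast
    obtain a' b' \<Theta> where 2: "H = G a' b' \<Theta>" "a' \<in> Cb UNIV" "b' \<in> Cb UNIV" "\<Theta> \<in> subharmonic_kernels X"
      using FH(2) unfolding \<G>_def by blast
    define d where "d = (\<lambda>x. u * a x + (1 - u) * a' x)"
    define d' where "d' = (\<lambda>x. u * b x + (1 - u) * b' x)"
    define \<theta> where "\<theta> = (\<lambda>x. u * \<Phi> x + (1 - u) * \<Theta> x)"
    have dC: "d \<in> Cb UNIV" "d' \<in> Cb UNIV" unfolding d_def d'_def using 1 2 by (intro Cb_UNIV_lincomb; simp)+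
    have tS: "\<theta> \<in> subharmonic_kernels X" unfolding \<theta>_def using 1 2 u X by (intro subharmonic_kernels_lincomb) auto
    have "V d d' = u * V a b + (1 - u) * V a' b'"
      unfolding V_def d_def d'_def intlin[OF 1(2) 2(2) \<mu> Xm] intlin[OF 1(3) 2(3) \<nu> Ym]
      by (simp add: algebra_simps)
    hence "G d d' \<theta> z = u * F z + (1 - u) * H z" for z
      unfolding 1(1) 2(1) G_def by (simp add: d_def d'_def \<theta>_def algebra_simps)
    hence "(\<lambda>z. u * F z + (1 - u) * H z) = G d d' \<theta>" by auto
    thus "(\<lambda>z. u * F z + (1 - u) * H z) \<in> \<G>" unfolding \<G>_def using dC tS by blast
  qed (rule that)
  define I where "I h = (\<integral>z\<in>K. h z \<partial>M)" for h :: "'a \<times> 'a \<times> 'a \<Rightarrow> real"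
  have Sb: "h \<in> Sb K" if "continuous_on K h" for h using continuous_on_compact_Sb[OF K that] .
  have lin: "I (\<lambda>z. u * f z + v * h z) = u * I f + v * I h" if "continuous_on K f" "continuous_on K h" for u v f h
    unfolding I_def using that by (intro Prob_integral_lincomb[OF M] Sb)
  have IG: "I c - I (\<lambda>z. \<Phi> (fst z, fst (snd z))) - I (\<lambda>z. a (fst z)) - I (\<lambda>z. b (snd (snd z))) + V a b \<le> 0"
    if a: "a \<in> Cb UNIV" and b: "b \<in> Cb UNIV" and \<Phi>: "\<Phi> \<in> subharmonic_kernels X" for a b \<Phi>
  proof -
    have "I (G a b \<Phi>) = I (\<lambda>z. 1 * (1 * (1 * c z + (-1) * \<Phi> (fst z, fst (snd z))) + (-1) * a (fst z)) +
        1 * ((-1) * b (snd (snd z)) + V a b * 1))"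
      unfolding G_def by (intro arg_cong[where f=I]) (simp add: fun_eq_iff)
    also have "\<dots> = 1 * I (\<lambda>z. 1 * (1 * c z + (-1) * \<Phi> (fst z, fst (snd z))) + (-1) * a (fst z)) +
        1 * I (\<lambda>z. (-1) * b (snd (snd z)) + V a b * 1)"
      by (rule lin) (intro continuous_intros cc \<Phi>c ac bc a b \<Phi>)+
    also have "I (\<lambda>z. 1 * (1 * c z + (-1) * \<Phi> (fst z, fst (snd z))) + (-1) * a (fst z)) =
        1 * I (\<lambda>z. 1 * c z + (-1) * \<Phi> (fst z, fst (snd z))) + (-1) * I (\<lambda>z. a (fst z))"
      by (rule lin) (intro continuous_intros cc \<Phi>c ac bc a b \<Phi>)+
    also have "I (\<lambda>z. (-1) * b (snd (snd z)) + V a b * 1) = (-1) * I (\<lambda>z. b (snd (snd z))) + V a b * I (\<lambda>z. 1)"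
      by (rule lin) (intro continuous_intros cc \<Phi>c ac bc a b \<Phi>)+
    also have "I (\<lambda>z. 1 * c z + (-1) * \<Phi> (fst z, fst (snd z))) = 1 * I c + (-1) * I (\<lambda>z. \<Phi> (fst z, fst (snd z)))"
      by (rule lin) (intro continuous_intros cc \<Phi>c ac bc a b \<Phi>)+
    also have "I (\<lambda>z. 1) = 1" unfolding I_def by (rule Prob_integral_const[OF M Km])
    finally have "I (G a b \<Phi>) = I c - I (\<lambda>z. \<Phi> (fst z, fst (snd z))) - I (\<lambda>z. a (fst z)) - I (\<lambda>z. b (snd (snd z))) + V a b" by simp
    moreover have "I (G a b \<Phi>) \<le> 0" unfolding I_def using a b \<Phi> by (intro MG) (auto simp: \<G>_def)
    ultimately show ?thesis by simp
  qed
  have I0: "I (\<lambda>z. 0) = 0" unfolding I_def by simp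
  have cost: "I c \<le> D" using IG[OF zero_Cb zero_Cb zero_subharmonic_kernels] I0 by (simp add: V_def)
  have \<Phi>ge: "0 \<le> I (\<lambda>z. \<Phi> (fst z, fst (snd z)))" if \<Phi>: "\<Phi> \<in> subharmonic_kernels X" for \<Phi>
  proof -
    have "I c + t * (- I (\<lambda>z. \<Phi> (fst z, fst (snd z)))) \<le> D" if t: "t \<ge> 0" for t
    proof -
      have "(\<lambda>x. t * \<Phi> x + 0 * \<Phi> x) \<in> subharmonic_kernels X" using t \<Phi> X by (intro subharmonic_kernels_lincomb) auto
      from IG[OF zero_Cb zero_Cb this] lin[OF \<Phi>c \<Phi>c, OF \<Phi> \<Phi>, of t 0]
      show ?thesis by (simp add: V_def I0 algebra_simps)
    qed
    from bounded_ray_imp_nonpos[OF this] show ?thesis by simp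
  qed
  have ale: "integral\<^sup>L \<mu> a \<le> I (\<lambda>z. a (fst z))" if a: "a \<in> Cb UNIV" for a
  proof -
    have "I c + t * (integral\<^sup>L \<mu> a - I (\<lambda>z. a (fst z))) \<le> D" if t: "t \<ge> 0" for t
      using IG[OF Cb_UNIV_lincomb[OF a a, of t 0] zero_Cb zero_subharmonic_kernels]
        lin[OF ac ac, OF a a, of t 0] intlin[OF a a \<mu> Xm, of t 0]
      by (simp add: V_def I0 algebra_simps)
    from bounded_ray_imp_nonpos[OF this] show ?thesis by simp
  qed
  have aeq: "I (\<lambda>z. a (fst z)) = integral\<^sup>L \<mu> a" if a: "a \<in> Cb UNIV" for a
    using ale[OF a] ale[OF Cb_UNIV_lincomb[OF a a, of "-1" 0]] lin[OF ac ac, OF a a, of "-1" 0]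
      intlin[OF a a \<mu> Xm, of "-1" 0] by simp
  have ble: "integral\<^sup>L \<nu> a \<le> I (\<lambda>z. a (snd (snd z)))" if a: "a \<in> Cb UNIV" for a
  proof -
    have "I c + t * (integral\<^sup>L \<nu> a - I (\<lambda>z. a (snd (snd z)))) \<le> D" if t: "t \<ge> 0" for t
      using IG[OF zero_Cb Cb_UNIV_lincomb[OF a a, of t 0] zero_subharmonic_kernels]
        lin[OF bc bc, OF a a, of t 0] intlin[OF a a \<nu> Ym, of t 0]
      by (simp add: V_def I0 algebra_simps)
    from bounded_ray_imp_nonpos[OF this] show ?thesis by simp
  qed
  have beq: "I (\<lambda>z. a (snd (snd z))) = integral\<^sup>L \<nu> a" if a: "a \<in> Cb UNIV" for a
    using ble[OF a] ble[OF Cb_UNIV_lincomb[OF a a, of "-1" 0]] lin[OF bc bc, OF a a, of "-1" 0]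
      intlin[OF a a \<nu> Ym, of "-1" 0] by simp
  have fm: "fst \<in> borel_measurable (borel :: ('a \<times> 'a \<times> 'a) measure)"
    and sm: "(\<lambda>z. snd (snd z)) \<in> borel_measurable (borel :: ('a \<times> 'a \<times> 'a) measure)"
    by (intro borel_measurable_continuous_onI continuous_intros)+
  have \<mu>eq: "distr M borel fst = \<mu>"
    by (rule distr_eq_if_continuous_integrals_eq[OF M Km fm])
       (use ProbD[OF \<mu>] aeq in \<open>auto simp: I_def\<close>)
  have \<nu>eq: "distr M borel (\<lambda>z. snd (snd z)) = \<nu>"
    by (rule distr_eq_if_continuous_integrals_eq[OF M Km sm])
       (use ProbD[OF \<nu>] beq in \<open>auto simp: I_def\<close>)
  obtain R where R: "\<And>x. x \<in> closure X \<Longrightarrow> norm x \<le> R" "\<And>y. y \<in> closure Y \<Longrightarrow> norm y \<le> R" "R > 0"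
  proof -
    have "bounded (closure X \<union> closure Y)" using X Y by (simp add: bounded_closure)
    thus ?thesis using that unfolding bounded_pos by blast
  qed
  \<comment> \<open>Expanding \<open>(norm (w - y) + t * (2 * R))\<^sup>2\<close> with
    \<open>norm (w - y) \<le> 2 * R\<close> and \<open>t * t \<le> t\<close> leaves an excess of at
    most \<open>t * (8 + 4) * R\<^sup>2\<close>.\<close>
  define C where "C = 12 * R\<^sup>2"
  have C: "C > 0" unfolding C_def using R(3) by simp
  define t where "t = min (1/2) (\<epsilon> / C)"
  have t: "0 < t" "t < 1" "t \<le> 1" "t * C \<le> \<epsilon>"
    using \<epsilon> C unfolding t_def by (auto simp: min_def field_simps)
  define p where "p z = (1 - t) *\<^sub>R fst (snd z) + t *\<^sub>R fst z" for z :: "'a \<times> 'a \<times> 'a"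
  have pc: "continuous_on S p" for S unfolding p_def by (intro continuous_intros)
  have pm: "p \<in> borel_measurable borel" by (rule borel_measurable_continuous_onI[OF pc])
  define \<xi> where "\<xi> = distr M borel p"
  have AE1: "AE z in M. fst z \<in> X"
  proof -
    have "AE x in distr M borel fst. x \<in> X" unfolding \<mu>eq by (rule Prob_AE[OF \<mu> Xm])
    thus ?thesis using Xm by (subst (asm) AE_distr_iff[OF Prob_measurable[OF M fm]]) auto
  qed
  \<comment> \<open>Almost every \<open>x\<close> lies in the open set \<open>X\<close> because its
    law is \<mu>, so the positive fraction \<open>t\<close> of the way from \<open>w\<close> to
    \<open>x\<close> leads off the boundary.\<close>
  have \<xi>: "\<xi> \<in> Prob X" unfolding \<xi>_def
  proof (rule Prob_distr[OF M pm Xm])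
    show "AE z in M. p z \<in> X" using AE1 Prob_AE[OF M Km]
    proof eventually_elim
      case (elim z)
      thus ?case unfolding p_def K_def using t by (intro convex_dilation_mem X) auto
    qed
  qed
  have "sh_le X \<mu> \<xi>"
  proof (rule sh_le_iff_Sc[OF X \<mu> \<xi>])
    fix \<psi> assume \<psi>: "\<psi> \<in> Sc X"
    have \<psi>c: "continuous_on (closure X) \<psi>" using \<psi> unfolding Sc_def by simp
    have 1: "continuous_on K (\<lambda>z. \<psi> (fst z))"
      by (rule continuous_on_compose2[OF \<psi>c]) (auto simp: K_def intro!: continuous_intros)
    have 2: "continuous_on K (\<lambda>z. \<psi> (p z))"
    proof (rule continuous_on_compose2[OF \<psi>c pc])
      show "p ` K \<subseteq> closure X" unfolding p_def K_def
        using convexD_alt[OF convex_closure[OF X(2)]] t by auto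
    qed
    have "(\<integral>x\<in>X. \<psi> x \<partial>\<mu>) = I (\<lambda>z. \<psi> (fst z))" unfolding I_def \<mu>eq[symmetric]
      by (rule Prob_integral_distr[OF M Km fm _ Xm ScSb[OF \<psi>] Sb[OF 1]]) (simp_all add: \<mu>eq \<mu>)
    moreover have "(\<integral>x\<in>X. \<psi> x \<partial>\<xi>) = I (\<lambda>z. \<psi> (p z))" unfolding I_def \<xi>_def
      by (rule Prob_integral_distr[OF M Km pm \<xi>[unfolded \<xi>_def] Xm ScSb[OF \<psi>] Sb[OF 2]]) simp
    \<comment> \<open>The difference of the two integrals is the mean of the dilation kernel of
      \<open>\<psi>\<close>, which \<open>\<Phi>ge\<close> makes nonnegative.\<close>
    moreover have "I (\<lambda>z. 1 * \<psi> (p z) + (-1) * \<psi> (fst z)) = 1 * I (\<lambda>z. \<psi> (p z)) + (-1) * I (\<lambda>z. \<psi> (fst z))"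
      by (rule lin[OF 2 1])
    moreover have "0 \<le> I (\<lambda>z. 1 * \<psi> (p z) + (-1) * \<psi> (fst z))"
      using \<Phi>ge[OF dilation_subharmonic_kernel[OF X \<psi> t(1,2)]] unfolding p_def by simp
    ultimately show "(\<integral>x\<in>X. \<psi> x \<partial>\<mu>) \<le> (\<integral>x\<in>X. \<psi> x \<partial>\<xi>)" by simp
  qed
  moreover have "T2 \<xi> \<nu> \<le> D + \<epsilon>"
  proof -
    define h where "h z = (norm (p z - snd (snd z)))\<^sup>2" for z
    have hc: "continuous_on S h" for S unfolding h_def by (intro continuous_intros pc)
    have "T2 \<xi> \<nu> \<le> integral\<^sup>L M h"
      using T2_le_integral[OF M pm sm] unfolding \<nu>eq \<xi>_def[symmetric] h_def[abs_def] .
    also have "\<dots> = I h" unfolding I_def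
      by (rule Prob_integral_eq_integral[OF M Km, symmetric]) (rule borel_measurable_continuous_onI[OF hc])
    also have "\<dots> \<le> I (\<lambda>z. c z + t * C)" unfolding I_def
    proof (rule Prob_integral_mono[OF M Sb[OF hc] Sb])
      show "continuous_on K (\<lambda>z. c z + t * C)" by (intro continuous_intros cc)
      fix z assume z: "z \<in> K"
      define w y x where "w = fst (snd z)" and "y = snd (snd z)" and "x = fst z"
      have n: "norm w \<le> R" "norm y \<le> R" "norm x \<le> R" using z R unfolding K_def w_def y_def x_def by auto
      have wy: "norm (w - y) \<le> 2 * R" and xw: "norm (x - w) \<le> 2 * R"
        using norm_triangle_ineq4[of w y] norm_triangle_ineq4[of x w] n by linarith+
      have "p z - y = (w - y) + t *\<^sub>R (x - w)" unfolding p_def w_def x_def by (simp add: algebra_simps)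
      hence "norm (p z - y) \<le> norm (w - y) + t * norm (x - w)"
        using norm_triangle_ineq[of "w - y" "t *\<^sub>R (x - w)"] t(1) by (metis abs_of_pos norm_scaleR)
      also have "\<dots> \<le> norm (w - y) + t * (2 * R)" using xw t by (intro add_left_mono mult_left_mono) auto
      finally have "(norm (p z - y))\<^sup>2 \<le> (norm (w - y) + t * (2 * R))\<^sup>2" by (intro power_mono) auto
      also have "\<dots> = (norm (w - y))\<^sup>2 + t * (4 * R * norm (w - y)) + (t * t) * (4 * R\<^sup>2)"
        by (simp add: power2_eq_square algebra_simps)
      also have "\<dots> \<le> (norm (w - y))\<^sup>2 + t * (4 * R * (2 * R)) + (t * 1) * (4 * R\<^sup>2)"
        using wy t R(3) by (intro add_mono mult_left_mono mult_right_mono) auto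
      also have "\<dots> = (norm (w - y))\<^sup>2 + t * C" unfolding C_def by (simp add: power2_eq_square algebra_simps)
      finally show "h z \<le> c z + t * C" unfolding h_def c_def w_def y_def .
    qed
    also have "\<dots> = I c + t * C" unfolding I_def by (rule Prob_integral_affine[OF M Sb[OF cc] Km])
    also have "\<dots> \<le> D + \<epsilon>" using cost t(4) by simp
    finally show ?thesis .
  qed
  ultimately show ?thesis using \<xi> unfolding Psh_ge_def by blast
qed

section \<open>Assembly of the two dualities\<close>

lemma Sc_Ash_Cb:
  assumes "\<psi> \<in> Sc U" "bounded U"
  shows "\<psi> \<in> Ash U \<inter> Cb U"
  using assms Sc_imp_Cb[OF assms] unfolding Ash_def subharmonic_on_iff Sc_def
  by (auto simp: Cb_def intro: continuous_imp_usc_on bounded_imp_bdd_below)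

text \<open>A weak inequality on the large class and a strong one on the small class close the chain
  from the supremum over \<open>A\<close> through that over \<open>B\<close> and the infimum over
  \<open>E\<close> back to the first, which settles both formulas. Nonemptiness and the bounds drawn
  from \<open>weak\<close> keep the real suprema and infima meaningful.\<close>

lemma sup_eq_inf_sandwich:
  fixes f :: "'b \<Rightarrow> real" and T :: "'c \<Rightarrow> real"
  assumes E: "E \<noteq> {}" and AB: "A \<subseteq> B" "A \<noteq> {}"
    and weak: "\<And>\<psi> \<eta>. \<psi> \<in> B \<Longrightarrow> \<eta> \<in> E \<Longrightarrow> f \<psi> \<le> T \<eta>"
    and strong: "\<And>D \<epsilon>. (\<And>\<psi>. \<psi> \<in> A \<Longrightarrow> f \<psi> \<le> D) \<Longrightarrow> \<epsilon> > 0 \<Longrightarrow> \<exists>\<eta>\<in>E. T \<eta> \<le> D + \<epsilon>"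
  shows "(INF \<eta>\<in>E. T \<eta>) = (SUP \<psi>\<in>A. f \<psi>) \<and> (INF \<eta>\<in>E. T \<eta>) = (SUP \<psi>\<in>B. f \<psi>)"
proof -
  obtain \<eta>0 \<psi>0 where e0: "\<eta>0 \<in> E" "\<psi>0 \<in> A" using E AB by blast
  have bA: "bdd_above (f ` A)" and bB: "bdd_above (f ` B)"
    using weak[OF _ e0(1)] AB(1) by (auto intro!: bdd_aboveI2[of _ _ "T \<eta>0"])
  have bE: "bdd_below (T ` E)" using weak[of \<psi>0] e0 AB(1) by (auto intro!: bdd_belowI2[of _ "f \<psi>0"])
  have 1: "(SUP \<psi>\<in>A. f \<psi>) \<le> (SUP \<psi>\<in>B. f \<psi>)" by (rule cSUP_subset_mono[OF AB(2) bB AB(1)]) simp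
  have 2: "(SUP \<psi>\<in>B. f \<psi>) \<le> (INF \<eta>\<in>E. T \<eta>)"
    using AB E weak by (intro cINF_greatest cSUP_least) auto
  have 3: "(INF \<eta>\<in>E. T \<eta>) \<le> (SUP \<psi>\<in>A. f \<psi>)"
  proof (rule field_le_epsilon)
    fix \<epsilon> :: real assume "\<epsilon> > 0"
    with strong[of "SUP \<psi>\<in>A. f \<psi>" \<epsilon>] bA obtain \<eta> where \<eta>: "\<eta> \<in> E" "T \<eta> \<le> (SUP \<psi>\<in>A. f \<psi>) + \<epsilon>"
      by (auto intro: cSUP_upper)
    have "(INF \<eta>\<in>E. T \<eta>) \<le> T \<eta>" by (rule cINF_lower[OF bE \<eta>(1)])
    thus "(INF \<eta>\<in>E. T \<eta>) \<le> (SUP \<psi>\<in>A. f \<psi>) + \<epsilon>" using \<eta>(2) by simp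
  qed
  show ?thesis using 1 2 3 by simp
qed

theorem mainTheorem15:
  fixes X Y :: "'a::euclidean_space set" and \<mu> \<nu> :: "'a measure"
  assumes "open X" "convex X" "bounded X"
    and "open Y" "convex Y" "bounded Y"
    and "\<mu> \<in> Prob X" "\<nu> \<in> Prob Y"
  shows "((INF \<eta>\<in>Psh_le Y \<nu>. T2 \<mu> \<eta>) =
           (SUP \<psi>\<in>Ash Y \<inter> Cb Y. (\<integral>x\<in>X. Q2 Y \<psi> x \<partial>\<mu>) - (\<integral>y\<in>Y. \<psi> y \<partial>\<nu>))) \<and>
         ((INF \<eta>\<in>Psh_le Y \<nu>. T2 \<mu> \<eta>) =
           (SUP \<psi>\<in>Ash Y \<inter> Sb Y. (\<integral>x\<in>X. Q2 Y \<psi> x \<partial>\<mu>) - (\<integral>y\<in>Y. \<psi> y \<partial>\<nu>))) \<and>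
         ((INF \<xi>\<in>Psh_ge X \<mu>. T2 \<xi> \<nu>) =
           (SUP \<psi>\<in>Ash X \<inter> Cb X. (\<integral>x\<in>X. \<psi> x \<partial>\<mu>) - (\<integral>y\<in>Y. Q2bar X \<psi> y \<partial>\<nu>))) \<and>
         ((INF \<xi>\<in>Psh_ge X \<mu>. T2 \<xi> \<nu>) =
           (SUP \<psi>\<in>Ash X \<inter> Sb X. (\<integral>x\<in>X. \<psi> x \<partial>\<mu>) - (\<integral>y\<in>Y. Q2bar X \<psi> y \<partial>\<nu>)))"
proof -
  note X = assms(1-3) and Y = assms(4-6) and \<mu> = assms(7) and \<nu> = assms(8)
  have Xm: "X \<in> sets borel" and Ym: "Y \<in> sets borel" using X Y by auto
  have Xne: "X \<noteq> {}" and Yne: "Y \<noteq> {}" using ProbD(3)[OF \<mu>] ProbD(3)[OF \<nu>] by auto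
  have i: "(INF \<eta>\<in>Psh_le Y \<nu>. T2 \<mu> \<eta>) =
           (SUP \<psi>\<in>Ash Y \<inter> Cb Y. (\<integral>x\<in>X. Q2 Y \<psi> x \<partial>\<mu>) - (\<integral>y\<in>Y. \<psi> y \<partial>\<nu>)) \<and>
         (INF \<eta>\<in>Psh_le Y \<nu>. T2 \<mu> \<eta>) =
           (SUP \<psi>\<in>Ash Y \<inter> Sb Y. (\<integral>x\<in>X. Q2 Y \<psi> x \<partial>\<mu>) - (\<integral>y\<in>Y. \<psi> y \<partial>\<nu>))"
  proof (rule sup_eq_inf_sandwich)
    have "\<nu> \<in> Psh_le Y \<nu>" unfolding Psh_le_def sh_le_def using \<nu> by simp
    thus "Psh_le Y \<nu> \<noteq> {}" by blast
    show "Ash Y \<inter> Cb Y \<subseteq> Ash Y \<inter> Sb Y" using Cb_subset_Sb[OF Y(1)] by blast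
    show "Ash Y \<inter> Cb Y \<noteq> {}" using Sc_Ash_Cb[OF zero_Sc Y(3)] by blast
  next
    fix \<psi> \<eta> assume \<psi>: "\<psi> \<in> Ash Y \<inter> Sb Y" and \<eta>: "\<eta> \<in> Psh_le Y \<nu>"
    have P: "\<eta> \<in> Prob Y" "sh_le Y \<eta> \<nu>" using \<eta> unfolding Psh_le_def by auto
    have S: "\<psi> \<in> Sb Y" "subharmonic_on Y \<psi>" using \<psi> unfolding Ash_def by auto
    have "(\<integral>y\<in>Y. \<psi> y \<partial>\<eta>) \<le> (\<integral>y\<in>Y. \<psi> y \<partial>\<nu>)" by (rule sh_le_Sb[OF Y P(1) \<nu> P(2) S])
    moreover have "(\<integral>x\<in>X. Q2 Y \<psi> x \<partial>\<mu>) - (\<integral>y\<in>Y. \<psi> y \<partial>\<eta>) \<le> T2 \<mu> \<eta>"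
    proof (rule T2_weak_duality[OF Xm X(3) Ym Y(3) \<mu> P(1) Q2_Sb[OF Xm X(3) Yne S(1)] S(1)])
      show "Q2 Y \<psi> x - \<psi> y \<le> (norm (x - y))\<^sup>2" if "y \<in> Y" for x y
        using Q2_lower[OF S(1) that, of x] by simp
    qed
    ultimately show "(\<integral>x\<in>X. Q2 Y \<psi> x \<partial>\<mu>) - (\<integral>y\<in>Y. \<psi> y \<partial>\<nu>) \<le> T2 \<mu> \<eta>" by simp
  next
    fix D \<epsilon> :: real
    assume D: "\<And>\<psi>. \<psi> \<in> Ash Y \<inter> Cb Y \<Longrightarrow> (\<integral>x\<in>X. Q2 Y \<psi> x \<partial>\<mu>) - (\<integral>y\<in>Y. \<psi> y \<partial>\<nu>) \<le> D" and \<epsilon>: "\<epsilon> > 0"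
    have "\<exists>\<eta>\<in>Psh_le Y \<nu>. T2 \<mu> \<eta> \<le> D"
      by (rule subharmonic_projection_duality[OF X(1,3) Y \<mu> \<nu> D[OF Sc_Ash_Cb[OF _ Y(3)]]])
    thus "\<exists>\<eta>\<in>Psh_le Y \<nu>. T2 \<mu> \<eta> \<le> D + \<epsilon>" using \<epsilon> by force
  qed
  have ii: "(INF \<xi>\<in>Psh_ge X \<mu>. T2 \<xi> \<nu>) =
           (SUP \<psi>\<in>Ash X \<inter> Cb X. (\<integral>x\<in>X. \<psi> x \<partial>\<mu>) - (\<integral>y\<in>Y. Q2bar X \<psi> y \<partial>\<nu>)) \<and>
         (INF \<xi>\<in>Psh_ge X \<mu>. T2 \<xi> \<nu>) =
           (SUP \<psi>\<in>Ash X \<inter> Sb X. (\<integral>x\<in>X. \<psi> x \<partial>\<mu>) - (\<integral>y\<in>Y. Q2bar X \<psi> y \<partial>\<nu>))"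
  proof (rule sup_eq_inf_sandwich)
    have "\<mu> \<in> Psh_ge X \<mu>" unfolding Psh_ge_def sh_le_def using \<mu> by simp
    thus "Psh_ge X \<mu> \<noteq> {}" by blast
    show "Ash X \<inter> Cb X \<subseteq> Ash X \<inter> Sb X" using Cb_subset_Sb[OF X(1)] by blast
    show "Ash X \<inter> Cb X \<noteq> {}" using Sc_Ash_Cb[OF zero_Sc X(3)] by blast
  next
    fix \<psi> \<xi> assume \<psi>: "\<psi> \<in> Ash X \<inter> Sb X" and \<xi>: "\<xi> \<in> Psh_ge X \<mu>"
    have P: "\<xi> \<in> Prob X" "sh_le X \<mu> \<xi>" using \<xi> unfolding Psh_ge_def by auto
    have S: "\<psi> \<in> Sb X" "subharmonic_on X \<psi>" using \<psi> unfolding Ash_def by auto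
    \<comment> \<open>Here \<open>\<psi>\<close> enters with a plus sign and \<xi> lies above \<mu>,
      so the replacement again raises the dual functional.\<close>
    have "(\<integral>x\<in>X. \<psi> x \<partial>\<mu>) \<le> (\<integral>x\<in>X. \<psi> x \<partial>\<xi>)" by (rule sh_le_Sb[OF X \<mu> P S])
    moreover have "(\<integral>x\<in>X. \<psi> x \<partial>\<xi>) - (\<integral>y\<in>Y. Q2bar X \<psi> y \<partial>\<nu>) \<le> T2 \<xi> \<nu>"
    proof (rule T2_weak_duality[OF Xm X(3) Ym Y(3) P(1) \<nu> S(1) Q2bar_Sb[OF Ym Y(3) Xne S(1)]])
      show "\<psi> x - Q2bar X \<psi> y \<le> (norm (x - y))\<^sup>2" if "x \<in> X" for x y
        using Q2bar_upper[OF S(1) that, of y] by simp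
    qed
    ultimately show "(\<integral>x\<in>X. \<psi> x \<partial>\<mu>) - (\<integral>y\<in>Y. Q2bar X \<psi> y \<partial>\<nu>) \<le> T2 \<xi> \<nu>" by simp
  next
    fix D \<epsilon> :: real
    assume D: "\<And>\<psi>. \<psi> \<in> Ash X \<inter> Cb X \<Longrightarrow> (\<integral>x\<in>X. \<psi> x \<partial>\<mu>) - (\<integral>y\<in>Y. Q2bar X \<psi> y \<partial>\<nu>) \<le> D" and \<epsilon>: "\<epsilon> > 0"
    show "\<exists>\<xi>\<in>Psh_ge X \<mu>. T2 \<xi> \<nu> \<le> D + \<epsilon>"
      by (rule subharmonic_backward_projection_duality[OF X Y(1,3) \<mu> \<nu> D[OF Sc_Ash_Cb[OF _ X(3)]] \<epsilon>])
  qed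
  show ?thesis using i ii by simp
qed

end
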